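(* Let $1<p<\infty$, let $d\ge 2$ be an integer, and let $w\in A_p(\mathcal{R})$ be a weight on $\mathbb{R}^d$. Set $$\beta=\frac1p+\frac{d-1}{p-1}-\frac{\lfloor d/2\rfloor}{2p(p-1)}.$$ Then $$\|\mathcal{M}_{\mathcal{R}}f\|_{L^{p,\infty}(w)}\le C_{p,d}\,[w]_{A_p(\mathcal{R})}^{\beta}\,\|f\|_{L^p(w)}\qquad\text{for all } f\in L^p(w),$$ where $C_{p,d}$ is a constant depending only on $p$ and $d$ (not on $w$ or $f$).
   Context: $\mathcal{R}$ is the collection of all axis-parallel rectangles in $\mathbb{R}^d$, i.e. cartesian products of $d$ one-dimensional bounded intervals of positive length. $|E|$ is Lebesgue measure and $\langle f\rangle_R=\frac{1}{|R|}\int_R f$. The strong maximal function is $\mathcal{M}_{\mathcal{R}}f(x)=\sup_{R\in\mathcal{R}}\frac{\mathbf{1}_R(x)}{|R|}\int_R|f(y)|\,dy$. A weight is an a.e. positive, locally integrable function $w$; $w(E)=\int_E w$. With the dual weight $\sigma=w^{1-p'}$, $p'=p/(p-1)$, put $$[w]_{A_p(\mathcal{R})}=\sup_{R\in\mathcal{R}}\langle w\rangle_R\,\langle\sigma\rangle_R^{p-1},$$ and write $w\in A_p(\mathcal{R})$ if this is finite. Finally $\|f\|_{L^p(w)}=\big(\int_{\mathbb{R}^d}|f|^p\,w\,dx\big)^{1/p}$ and $\|g\|_{L^{p,\infty}(w)}=\sup_{\lambda>0}\lambda\, w(\{x:|g(x)|>\lambda\})^{1/p}$. *)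

theory Defs
  imports "HOL-Analysis.Analysis"
begin

text \<open>Euclidean space of dimension \<open>d\<close> is \<open>real ^ 'n\<close> with \<open>d = CARD('n)\<close>. Averages, suprema and
  norms take values in \<open>ennreal\<close>, so that no finiteness is built into the definitions.\<close>

text \<open>Power with a positive real exponent on the extended nonnegative reals.\<close>

definition epowr :: "ennreal \<Rightarrow> real \<Rightarrow> ennreal" where
  "epowr x a = (if x = \<infinity> then \<infinity> else ennreal (enn2real x powr a))"

text \<open>The factors may be open, closed or half-open; \<open>0 < emeasure lborel (I i)\<close> says that the
  interval \<open>I i\<close> has positive length.\<close>

definition rectangles :: "(real ^ 'n) set set" where
  "rectangles = {R. \<exists>I :: 'n \<Rightarrow> real set.
     (\<forall>i. is_interval (I i) \<and> bounded (I i) \<and> 0 < emeasure lborel (I i)) \<and>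
     R = {x. \<forall>i. x $ i \<in> I i}}"

definition average :: "(real ^ 'n) set \<Rightarrow> (real ^ 'n \<Rightarrow> ennreal) \<Rightarrow> ennreal" where
  "average R g = (\<integral>\<^sup>+ y \<in> R. g y \<partial>lebesgue) / emeasure lebesgue R"

definition strong_maximal :: "(real ^ 'n \<Rightarrow> complex) \<Rightarrow> real ^ 'n \<Rightarrow> ennreal" where
  "strong_maximal f x =
     (SUP R \<in> rectangles. indicator R x * average R (\<lambda>y. ennreal (norm (f y))))"

definition weight :: "(real ^ 'n \<Rightarrow> real) \<Rightarrow> bool" where
  "weight w \<longleftrightarrow> w \<in> borel_measurable lebesgue \<and> (AE x in lebesgue. 0 < w x) \<and>
     (\<forall>K. compact K \<longrightarrow> set_integrable lebesgue K w)"

definition weight_measure :: "(real ^ 'n \<Rightarrow> real) \<Rightarrow> (real ^ 'n) set \<Rightarrow> ennreal" where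
  "weight_measure w E = (\<integral>\<^sup>+ x \<in> E. ennreal (w x) \<partial>lebesgue)"

definition conj_exponent :: "real \<Rightarrow> real" where
  "conj_exponent p = p / (p - 1)"

definition dual_weight :: "real \<Rightarrow> (real ^ 'n \<Rightarrow> real) \<Rightarrow> real ^ 'n \<Rightarrow> real" where
  "dual_weight p w x = w x powr (1 - conj_exponent p)"

definition Ap_const :: "real \<Rightarrow> (real ^ 'n \<Rightarrow> real) \<Rightarrow> ennreal" where
  "Ap_const p w =
     (SUP R \<in> rectangles. average R (\<lambda>x. ennreal (w x)) *
        epowr (average R (\<lambda>x. ennreal (dual_weight p w x))) (p - 1))"

definition Ap_weights :: "real \<Rightarrow> (real ^ 'n \<Rightarrow> real) set" where
  "Ap_weights p = {w. weight w \<and> Ap_const p w < \<infinity>}"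

definition Lp_norm :: "real \<Rightarrow> (real ^ 'n \<Rightarrow> real) \<Rightarrow> (real ^ 'n \<Rightarrow> complex) \<Rightarrow> ennreal" where
  "Lp_norm p w f = epowr (\<integral>\<^sup>+ x. ennreal (norm (f x) powr p * w x) \<partial>lebesgue) (1 / p)"

definition Lp_space :: "real \<Rightarrow> (real ^ 'n \<Rightarrow> real) \<Rightarrow> (real ^ 'n \<Rightarrow> complex) set" where
  "Lp_space p w = {f. f \<in> borel_measurable lebesgue \<and> Lp_norm p w f < \<infinity>}"

definition weak_Lp_norm :: "real \<Rightarrow> (real ^ 'n \<Rightarrow> real) \<Rightarrow> (real ^ 'n \<Rightarrow> ennreal) \<Rightarrow> ennreal" where
  "weak_Lp_norm p w g =
     (SUP t \<in> {0<..}. ennreal t * epowr (weight_measure w {x. ennreal t < g x}) (1 / p))"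

definition beta_exponent :: "real \<Rightarrow> nat \<Rightarrow> real" where
  "beta_exponent p d =
     1 / p + (real d - 1) / (p - 1) - real_of_int \<lfloor>real d / 2\<rfloor> / (2 * p * (p - 1))"

end

theory Submission
  imports Defs
begin

text \<open>
Covering rectangles by those of two shifted dyadic systems per coordinate and averaging
\<open>w\<close>, \<open>\<sigma>\<close> and \<open>f\<close> over cells of a fine scale turns the problem into one about finite sums on a grid.
There the maximal function over all coordinates is at most a composition of maximal functions
over disjoint pairs of coordinates (and one single coordinate if \<open>d\<close> is odd); the outermost one needs
only a weak type bound, the others a strong one.

The gain comes from the weak type bound for one pair. Put \<open>K = [w]\<close> and \<open>S = K powr (1 / (p - 1))\<close>.
From rectangles with average above \<open>t\<close> select a subfamily minimizing the total overlap minus half of the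
total area. Its members are sparse in both directions, and every other rectangle is covered to a
fixed proportion in one of the two directions, which costs one factor \<open>K\<close>. The \<open>n\<close> selected
rectangles through a point form a chain of crossing rectangles; the \<open>j\<close>-th one receives the weight
\<open>sqrt (S / (j (n + 1 - j)))\<close>. These weights add up to \<open>O(sqrt S)\<close>, and their negative moments with respect
to \<open>\<sigma>\<close> on each rectangle are bounded, since the intersections of crossing rectangles are sparse and
\<open>\<sigma>(R) \<le> O(S) \<sigma>(E)\<close> whenever \<open>E\<close> fills a fixed proportion of \<open>R\<close>. Hoelder's inequality with these weights
gives the weak type bound with \<open>K\<^sup>2 sqrt S\<close> in place of \<open>K\<^sup>2 S\<close>. The strong type bound with
\<open>K\<^sup>2 sqrt S S\<close> follows by a reverse Hoelder inequality for \<open>\<sigma>\<close> and interpolation.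
\<close>

section \<open>Sparse laminar families\<close>

text \<open>The obstacle is that rectangles in a plane admit no disjoint selection: arbitrarily many
  selected ones may cross at one point. The gain rests on one observation. For a point of a selected
  \<open>R\<close>, the numbers of tall and of wide rectangles crossing \<open>R\<close> there are
  depths in two sparse families, and the product of both depths costs a single factor
  \<open>S\<close>, because the product of two cores still fills a quarter of the product of the two
  sides. So j (n + 1 - j) has, with respect to \<sigma>, size about \<open>S\<close> on each
  rectangle. With weights (S / (j (n + 1 - j)))^a, a < 1, the sum over the chain is of order S^a
  n^(1 - 2a), which is bounded in n as soon as a is at least 1/2; hence the square root. Iterating
  one coordinate at a time would give, for p-th powers of the norms, one factor \<open>K\<close> and
  d - 1 factors \<open>K S\<close>. Each of the floor(d/2) pairs saves sqrt S, and the p-th root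
  turns this saving into the subtracted term of the exponent.\<close>

lemma powr_tangent:
  fixes x c p :: real
  assumes "1 < p" "0 \<le> x" "0 < c"
  shows "p * x * c powr (p - 1) \<le> x powr p + (p - 1) * c powr p"
proof (cases "x = 0")
  case False
  then have x: "0 < x" using assms by simp
  have "(x powr p) powr (1/p) * (c powr p) powr (1 - 1/p) \<le> (1/p) * x powr p + (1 - 1/p) * c powr p"
    by (rule Youngs_inequality_0) (use assms x in auto)
  moreover have "(x powr p) powr (1/p) = x" "(c powr p) powr (1 - 1/p) = c powr (p - 1)"
    using assms x by (simp_all add: powr_powr algebra_simps)
  ultimately have "x * c powr (p - 1) \<le> (1/p) * x powr p + (1 - 1/p) * c powr p" by simp
  then have "p * (x * c powr (p - 1)) \<le> p * ((1/p) * x powr p + (1 - 1/p) * c powr p)"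
    using assms by (intro mult_left_mono) auto
  then show ?thesis using assms by (simp add: algebra_simps)
qed (use assms in auto)

text \<open>Hoelder's inequality with \<open>v\<close> as a free weight. It is the sum over
  \<open>z\<close> of \<open>v z\<close> times the tangent inequality for u / v, all taken at one
  common point \<open>c\<close>.\<close>

lemma holder_sum:
  fixes u v :: "'a \<Rightarrow> real" and p :: real
  assumes "1 < p" "finite E" "\<And>z. z \<in> E \<Longrightarrow> 0 \<le> u z" "\<And>z. z \<in> E \<Longrightarrow> 0 < v z"
  shows "(\<Sum>z\<in>E. u z) powr p \<le> (\<Sum>z\<in>E. u z powr p * v z powr (1 - p)) * (\<Sum>z\<in>E. v z) powr (p - 1)"
proof (cases "(\<Sum>z\<in>E. u z) = 0")
  case True
  then show ?thesis using assms by (simp add: sum_nonneg)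
next
  case False
  define U where "U = (\<Sum>z\<in>E. u z)"
  define V where "V = (\<Sum>z\<in>E. v z)"
  define F where "F = (\<Sum>z\<in>E. u z powr p * v z powr (1 - p))"
  have U: "0 < U" using False assms by (simp add: U_def sum_nonneg order_less_le)
  then have "E \<noteq> {}" by (auto simp: U_def)
  then have V: "0 < V" using assms by (simp add: V_def sum_pos)
  \<comment> \<open>The \<open>v\<close>-mean of u / v, the point of tangency in Jensen's
    inequality.\<close>
  define c where "c = U / V"
  have c: "0 < c" using U V by (simp add: c_def)
  have "p * u z * c powr (p - 1) \<le> u z powr p * v z powr (1 - p) + (p - 1) * c powr p * v z" if "z \<in> E" for z
  proof -
    have v: "0 < v z" using assms that by auto
    have "p * (u z / v z) * c powr (p - 1) \<le> (u z / v z) powr p + (p - 1) * c powr p"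
      using powr_tangent[of p "u z / v z" c] assms that c by (simp add: less_imp_le)
    from mult_left_mono[OF this, of "v z"] v
    have "p * u z * c powr (p - 1) \<le> v z * (u z / v z) powr p + (p - 1) * c powr p * v z"
      by (simp add: algebra_simps)
    moreover have "v z * (u z / v z) powr p = u z powr p * v z powr (1 - p)"
      using assms that v by (simp add: powr_divide powr_diff less_imp_le)
    ultimately show ?thesis by simp
  qed
  then have "(\<Sum>z\<in>E. p * u z * c powr (p - 1)) \<le> (\<Sum>z\<in>E. u z powr p * v z powr (1 - p) + (p - 1) * c powr p * v z)"
    by (rule sum_mono)
  also have "\<dots> = F + (p - 1) * c powr p * V"
    by (simp add: F_def V_def sum.distrib sum_distrib_left)
  also have "(\<Sum>z\<in>E. p * u z * c powr (p - 1)) = p * U * c powr (p - 1)"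
    by (simp add: U_def sum_distrib_left sum_distrib_right)
  also have "\<dots> = p * c powr p * V"
  proof -
    have "U = c * V" using V by (simp add: c_def)
    moreover have "c * c powr (p - 1) = c powr p" using c by (simp add: powr_diff)
    ultimately show ?thesis by (metis mult.assoc mult.commute)
  qed
  finally have "c powr p * V \<le> F" by (simp add: algebra_simps)
  then have "c powr p * V * V powr (p - 1) \<le> F * V powr (p - 1)" by (intro mult_right_mono) auto
  moreover have "c powr p * V * V powr (p - 1) = U powr p"
    using U V by (simp add: c_def powr_divide powr_diff)
  ultimately show ?thesis by (simp add: U_def V_def F_def)
qed

definition laminar :: "'a set set \<Rightarrow> bool" where
  "laminar C \<longleftrightarrow> (\<forall>I\<in>C. \<forall>J\<in>C. I \<subseteq> J \<or> J \<subseteq> I \<or> I \<inter> J = {})"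

lemma laminar_subset: "laminar C \<Longrightarrow> C' \<subseteq> C \<Longrightarrow> laminar C'"
  by (auto simp: laminar_def subset_iff)

lemma laminarD: "laminar C \<Longrightarrow> I \<in> C \<Longrightarrow> J \<in> C \<Longrightarrow> I \<inter> J \<noteq> {} \<Longrightarrow> I \<subseteq> J \<or> J \<subseteq> I"
  by (auto simp: laminar_def)

text \<open>Maximal members are disjoint by laminarity. The last property serves stopping arguments:
  no member of \<open>C\<close> strictly contains a chosen one.\<close>

lemma laminar_maximal:
  assumes "finite C" "laminar C"
  obtains M where "M \<subseteq> C" "\<Union>M = \<Union>C" "\<And>I J. I \<in> M \<Longrightarrow> J \<in> M \<Longrightarrow> I \<noteq> J \<Longrightarrow> I \<inter> J = {}"
    "\<And>I J. I \<in> M \<Longrightarrow> J \<in> C \<Longrightarrow> I \<subseteq> J \<Longrightarrow> I = J"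
proof -
  define M where "M = {I\<in>C. \<forall>J\<in>C. I \<subseteq> J \<longrightarrow> I = J}"
  have "\<exists>J\<in>M. I \<subseteq> J" if "I \<in> C" for I
  proof -
    have "finite {J\<in>C. I \<subseteq> J}" "{J\<in>C. I \<subseteq> J} \<noteq> {}" using assms that by auto
    from finite_has_maximal[OF this]
    obtain J where J: "J \<in> C" "I \<subseteq> J" "\<And>J'. J' \<in> C \<Longrightarrow> I \<subseteq> J' \<Longrightarrow> J \<subseteq> J' \<Longrightarrow> J = J'"
      by auto
    then show ?thesis unfolding M_def by blast
  qed
  then have "\<Union>M = \<Union>C" unfolding M_def by blast
  moreover have "I \<inter> J = {}" if "I \<in> M" "J \<in> M" "I \<noteq> J" for I J
    using that laminarD[OF assms(2), of I J] unfolding M_def by blast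
  moreover have "M \<subseteq> C" by (auto simp: M_def)
  moreover have "I = J" if "I \<in> M" "J \<in> C" "I \<subseteq> J" for I J
    using that by (auto simp: M_def)
  ultimately show ?thesis by (intro that[of M])
qed

text \<open>The covering argument of dimension one: maximal members partition the union, so no
  constant is lost.\<close>

lemma laminar_sum_Union_mono:
  fixes u v :: "'a \<Rightarrow> real"
  assumes "finite C" "laminar C" "\<And>I. I \<in> C \<Longrightarrow> finite I"
    and "\<And>I. I \<in> C \<Longrightarrow> sum u I \<le> sum v I"
  shows "sum u (\<Union>C) \<le> sum v (\<Union>C)"
proof -
  obtain M where M: "M \<subseteq> C" "\<Union>M = \<Union>C" "\<And>I J. I \<in> M \<Longrightarrow> J \<in> M \<Longrightarrow> I \<noteq> J \<Longrightarrow> I \<inter> J = {}"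
    using laminar_maximal[OF assms(1,2)] by metis
  have *: "sum g (\<Union>C) = (\<Sum>I\<in>M. sum g I)" for g :: "'a \<Rightarrow> real"
    using sum.Union_disjoint[of M g] assms(3) M by auto
  show ?thesis unfolding * by (rule sum_mono) (use assms(4) M(1) in blast)
qed

text \<open>A subfamily that minimizes half of the total pairwise overlap minus half of the total size: both
  conclusions say that changing the membership of a single set does not decrease this quantity.\<close>

lemma overlap_selection:
  fixes F :: "'i set" and r :: "'i \<Rightarrow> 'a set"
  assumes "finite F"
  shows "\<exists>S\<subseteq>F. (\<forall>R\<in>S. 2 * (\<Sum>T\<in>S - {R}. card (r R \<inter> r T)) \<le> card (r R)) \<and>
    (\<forall>R\<in>F - S. card (r R) \<le> 2 * (\<Sum>T\<in>S. card (r R \<inter> r T)))"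
proof -
  \<comment> \<open>The overlap is summed over ordered pairs, so inserting a set changes it by twice
    the overlap of that set with the rest.\<close>
  define \<Phi> :: "'i set \<Rightarrow> int" where
    "\<Phi> S = (\<Sum>R\<in>S. \<Sum>T\<in>S - {R}. int (card (r R \<inter> r T))) - (\<Sum>R\<in>S. int (card (r R)))" for S
  have ins: "\<Phi> (insert R S) = \<Phi> S + 2 * (\<Sum>T\<in>S. int (card (r R \<inter> r T))) - int (card (r R))"
    if "finite S" "R \<notin> S" for R S
  proof -
    have "(\<Sum>R'\<in>S. \<Sum>T\<in>insert R S - {R'}. int (card (r R' \<inter> r T)))
        = (\<Sum>R'\<in>S. (\<Sum>T\<in>S - {R'}. int (card (r R' \<inter> r T))) + int (card (r R \<inter> r R')))"
    proof (rule sum.cong[OF refl])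
      fix R' assume "R' \<in> S"
      then have "insert R S - {R'} = insert R (S - {R'})" using that by auto
      then show "(\<Sum>T\<in>insert R S - {R'}. int (card (r R' \<inter> r T)))
         = (\<Sum>T\<in>S - {R'}. int (card (r R' \<inter> r T))) + int (card (r R \<inter> r R'))"
        using that by (simp add: Int_commute)
    qed
    moreover have "insert R S - {R} = S" using that by auto
    ultimately show ?thesis using that by (simp add: \<Phi>_def sum.distrib)
  qed
  have fin: "finite (\<Phi> ` Pow F)" "\<Phi> ` Pow F \<noteq> {}" using assms(1) by auto
  obtain S where S: "S \<subseteq> F" "\<Phi> S = Min (\<Phi> ` Pow F)"
    using Min_in[OF fin] by (metis (no_types, lifting) PowD imageE)
  have min: "\<Phi> S \<le> \<Phi> T" if "T \<subseteq> F" for T using fin that S by simp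
  have finS: "finite S" using S assms finite_subset by blast
  show ?thesis
  proof (intro exI[of _ S] conjI ballI S(1))
    fix R assume R: "R \<in> S"
    have "\<Phi> S = \<Phi> (insert R (S - {R}))" using R by (simp add: insert_absorb)
    also have "\<dots> = \<Phi> (S - {R}) + 2 * (\<Sum>T\<in>S - {R}. int (card (r R \<inter> r T))) - int (card (r R))"
      using finS by (intro ins) auto
    finally have "2 * (\<Sum>T\<in>S - {R}. int (card (r R \<inter> r T))) \<le> int (card (r R))"
      using min[of "S - {R}"] S by auto
    then have "int (2 * (\<Sum>T\<in>S - {R}. card (r R \<inter> r T))) \<le> int (card (r R))" by simp
    then show "2 * (\<Sum>T\<in>S - {R}. card (r R \<inter> r T)) \<le> card (r R)" by linarith
  next
    fix R assume "R \<in> F - S"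
    then have R: "R \<in> F" "R \<notin> S" by auto
    have "int (card (r R)) \<le> 2 * (\<Sum>T\<in>S. int (card (r R \<inter> r T)))"
      using min[of "insert R S"] ins[OF finS R(2)] R S by auto
    then have "int (card (r R)) \<le> int (2 * (\<Sum>T\<in>S. card (r R \<inter> r T)))" by simp
    then show "card (r R) \<le> 2 * (\<Sum>T\<in>S. card (r R \<inter> r T))" by linarith
  qed
qed

text \<open>The sum takes the members properly inside \<open>I\<close> of every generation, not just
  the maximal ones; a bound on total overlap yields exactly this.\<close>

definition sparse :: "'a set set \<Rightarrow> bool" where
  "sparse C \<longleftrightarrow> finite C \<and> laminar C \<and> (\<forall>I\<in>C. finite I \<and> 2 * (\<Sum>J | J \<in> C \<and> J \<subset> I. card J) \<le> card I)"

definition core :: "'a set set \<Rightarrow> 'a set \<Rightarrow> 'a set" where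
  "core C I = I - \<Union>{J\<in>C. J \<subset> I}"

definition depth :: "'a set set \<Rightarrow> 'a \<Rightarrow> nat" where
  "depth C x = card {I\<in>C. x \<in> I}"

lemma core_subset: "core C I \<subseteq> I"
  by (auto simp: core_def)

lemma core_disjoint:
  assumes "laminar C" "I \<in> C" "J \<in> C" "I \<noteq> J"
  shows "core C I \<inter> core C J = {}"
  using laminarD[OF assms(1-3)] assms(2-4) unfolding core_def by blast

lemma card_core:
  assumes "sparse C" "I \<in> C"
  shows "card I \<le> 2 * card (core C I)"
proof -
  have f: "finite I" "finite {J\<in>C. J \<subset> I}" using assms by (auto simp: sparse_def)
  have "card (\<Union>{J\<in>C. J \<subset> I}) \<le> (\<Sum>J | J \<in> C \<and> J \<subset> I. card J)"
    using card_Union_le_sum_card[of "{J\<in>C. J \<subset> I}"] by simp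
  moreover have "2 * (\<Sum>J | J \<in> C \<and> J \<subset> I. card J) \<le> card I" using assms by (auto simp: sparse_def)
  moreover have "card I - card (\<Union>{J\<in>C. J \<subset> I}) \<le> card (core C I)"
    unfolding core_def using f
    by (intro diff_card_le_card_Diff) (auto intro: finite_subset[of _ I])
  ultimately show ?thesis by linarith
qed

text \<open>A member through a point of the core meets \<open>I\<close>, so it contains
  \<open>I\<close> or lies properly inside; the core excludes the latter. Hence the depth is
  constant on each core.\<close>

lemma depth_core:
  assumes "laminar C" "I \<in> C" "x \<in> core C I"
  shows "depth C x = card {J\<in>C. I \<subseteq> J}"
proof -
  have "{J\<in>C. x \<in> J} = {J\<in>C. I \<subseteq> J}"
    using assms laminarD[OF assms(1), of I] unfolding core_def by blast
  then show ?thesis by (simp add: depth_def)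
qed

text \<open>Ranks count from the largest set, which has rank 1. Removing the smallest set leaves all
  other ranks unchanged, which drives the induction.\<close>

lemma sum_rank_chain:
  fixes g :: "nat \<Rightarrow> real"
  assumes "finite C" "\<And>I J. I \<in> C \<Longrightarrow> J \<in> C \<Longrightarrow> I \<subseteq> J \<or> J \<subseteq> I"
  shows "(\<Sum>I\<in>C. g (card {J\<in>C. I \<subseteq> J})) = (\<Sum>k=1..card C. g k)"
  using assms
proof (induction "card C" arbitrary: C)
  case (Suc n)
  then have ne: "C \<noteq> {}" by auto
  obtain I0 where I0: "I0 \<in> C" "\<And>J. J \<in> C \<Longrightarrow> J \<subseteq> I0 \<Longrightarrow> I0 = J"
    using finite_has_minimal[OF Suc.prems(1) ne] by blast
  then have I0': "I0 \<subseteq> J" if "J \<in> C" for J using Suc.prems(2) that by blast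
  have n: "n = card (C - {I0})" using Suc I0 by simp
  have "(\<Sum>I\<in>C. g (card {J\<in>C. I \<subseteq> J})) = g (card {J\<in>C. I0 \<subseteq> J}) + (\<Sum>I\<in>C-{I0}. g (card {J\<in>C. I \<subseteq> J}))"
    using Suc.prems I0 by (simp add: sum.remove)
  also have "{J\<in>C. I0 \<subseteq> J} = C" using I0' by auto
  also have "(\<Sum>I\<in>C-{I0}. g (card {J\<in>C. I \<subseteq> J})) = (\<Sum>I\<in>C-{I0}. g (card {J\<in>C-{I0}. I \<subseteq> J}))"
  proof (rule sum.cong[OF refl])
    fix I assume "I \<in> C - {I0}"
    then have "{J\<in>C. I \<subseteq> J} = {J\<in>C-{I0}. I \<subseteq> J}" using I0 by blast
    then show "g (card {J\<in>C. I \<subseteq> J}) = g (card {J\<in>C-{I0}. I \<subseteq> J})" by simp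
  qed
  also have "\<dots> = (\<Sum>k=1..card (C - {I0}). g k)"
    using Suc.prems by (intro Suc.hyps(1) n) auto
  finally show ?case unfolding n[symmetric] Suc.hyps(2)[symmetric] by simp
qed simp

text \<open>Discrete integration of x^m: the increment of n^(m+1) is at most (m+1) (n+1)^m.\<close>

lemma power_le_sum_powers:
  fixes n m :: nat
  shows "real n ^ Suc m \<le> Suc m * (\<Sum>k=1..n. real k ^ m)"
proof (induction n)
  case (Suc n)
  have *: "(real n + 1) ^ Suc m \<le> real n ^ Suc m + Suc m * (real n + 1) ^ m" for m
  proof (induction m)
    case (Suc m)
    have "(real n + 1) ^ Suc (Suc m) = (real n + 1) * (real n + 1) ^ Suc m" by simp
    also have "\<dots> \<le> (real n + 1) * (real n ^ Suc m + Suc m * (real n + 1) ^ m)"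
      by (intro mult_left_mono Suc) auto
    also have "\<dots> = real n ^ Suc (Suc m) + real n ^ Suc m + Suc m * (real n + 1) ^ Suc m"
      by (simp add: algebra_simps)
    also have "real n ^ Suc m \<le> (real n + 1) ^ Suc m" by (intro power_mono) auto
    finally show ?case by (simp add: algebra_simps)
  qed simp
  show ?case using Suc *[of m] by (simp add: algebra_simps)
qed simp

text \<open>Lowers the power of a depth by one at the price of a sum over the members through
  \<open>x\<close>. The summands are ranks, which depend on the member and not on the point.\<close>

lemma depth_power:
  assumes "finite C" "laminar C"
  shows "real (depth C x) ^ Suc m \<le> Suc m * (\<Sum>I | I \<in> C \<and> x \<in> I. real (card {J\<in>C. I \<subseteq> J}) ^ m)"
proof -
  let ?Cx = "{I\<in>C. x \<in> I}"
  have "(\<Sum>I\<in>?Cx. real (card {J\<in>?Cx. I \<subseteq> J}) ^ m) = (\<Sum>k=1..card ?Cx. real k ^ m)"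
    by (rule sum_rank_chain) (use assms laminarD[OF assms(2)] in auto)
  moreover have "{J\<in>?Cx. I \<subseteq> J} = {J\<in>C. I \<subseteq> J}" if "I \<in> ?Cx" for I using that by auto
  ultimately show ?thesis using power_le_sum_powers[of "card ?Cx" m] by (simp add: depth_def)
qed

text \<open>Both powers are expanded by \<open>depth_power\<close> into a sum over rectangles
  \<open>I \<times> J\<close>. On each of them \<sigma> is pushed into the product of cores; these
  products are disjoint, and on them ranks are depths again, so the sum reassembles to the moment of
  order \<open>m\<close>.\<close>

lemma depth_moment_step:
  fixes \<sigma> :: "'a \<times> 'b \<Rightarrow> real" and \<kappa> :: real
  assumes C: "sparse C" "sparse C'" and X: "finite X" "finite Y" "\<And>I. I \<in> C \<Longrightarrow> I \<subseteq> X" "\<And>J. J \<in> C' \<Longrightarrow> J \<subseteq> Y"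
    and s: "\<And>z. 0 \<le> \<sigma> z" "0 \<le> \<kappa>"
    and \<kappa>: "\<And>I J. I \<in> C \<Longrightarrow> J \<in> C' \<Longrightarrow> sum \<sigma> (I \<times> J) \<le> \<kappa> * sum \<sigma> (core C I \<times> core C' J)"
  shows "(\<Sum>z\<in>X\<times>Y. (real (depth C (fst z)) * real (depth C' (snd z))) ^ Suc m * \<sigma> z)
    \<le> (Suc m)^2 * \<kappa> * (\<Sum>z\<in>X\<times>Y. (real (depth C (fst z)) * real (depth C' (snd z))) ^ m * \<sigma> z)"
proof -
  define k where "k I = real (card {J\<in>C. I \<subseteq> J}) ^ m" for I
  define k' where "k' I = real (card {J\<in>C'. I \<subseteq> J}) ^ m" for I
  have fin: "finite C" "laminar C" "finite C'" "laminar C'" using C by (auto simp: sparse_def)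
  have fI: "finite I" if "I \<in> C" for I using X(1,3) that finite_subset by blast
  have fJ: "finite J" if "J \<in> C'" for J using X(2,4) that finite_subset by blast
  have k0: "0 \<le> k I" "0 \<le> k' J" for I J by (simp_all add: k_def k'_def)
  let ?D = "\<lambda>z. real (depth C (fst z)) * real (depth C' (snd z))"
  have pt: "?D z ^ Suc m * \<sigma> z \<le> (Suc m)^2 * (\<Sum>P\<in>C\<times>C'. if z \<in> fst P \<times> snd P then k (fst P) * k' (snd P) * \<sigma> z else 0)" for z
  proof -
    obtain x y where z: "z = (x, y)" by (cases z)
    have "real (depth C x) ^ Suc m * real (depth C' y) ^ Suc m \<le>
      (Suc m * (\<Sum>I | I \<in> C \<and> x \<in> I. k I)) * (Suc m * (\<Sum>J | J \<in> C' \<and> y \<in> J. k' J))"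
      unfolding k_def k'_def by (intro mult_mono depth_power fin mult_nonneg_nonneg sum_nonneg) auto
    also have "(\<Sum>I | I \<in> C \<and> x \<in> I. k I) = (\<Sum>I\<in>C. if x \<in> I then k I else 0)"
      using fin by (simp add: sum.inter_filter)
    also have "(\<Sum>J | J \<in> C' \<and> y \<in> J. k' J) = (\<Sum>J\<in>C'. if y \<in> J then k' J else 0)"
      using fin by (simp add: sum.inter_filter)
    also have "(Suc m * (\<Sum>I\<in>C. if x \<in> I then k I else 0)) * (Suc m * (\<Sum>J\<in>C'. if y \<in> J then k' J else 0))
       = (Suc m)^2 * ((\<Sum>I\<in>C. if x \<in> I then k I else 0) * (\<Sum>J\<in>C'. if y \<in> J then k' J else 0))"
      by (simp add: power2_eq_square algebra_simps)
    also have "(\<Sum>I\<in>C. if x \<in> I then k I else 0) * (\<Sum>J\<in>C'. if y \<in> J then k' J else 0)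
       = (\<Sum>P\<in>C\<times>C'. (if x \<in> fst P then k (fst P) else 0) * (if y \<in> snd P then k' (snd P) else 0))"
      by (simp add: sum_product sum.cartesian_product case_prod_unfold)
    also have "\<dots> = (\<Sum>P\<in>C\<times>C'. if z \<in> fst P \<times> snd P then k (fst P) * k' (snd P) else 0)"
      by (intro sum.cong) (auto simp: z)
    finally have "?D z ^ Suc m \<le> (Suc m)^2 * (\<Sum>P\<in>C\<times>C'. if z \<in> fst P \<times> snd P then k (fst P) * k' (snd P) else 0)"
      by (simp add: z power_mult_distrib mult_ac)
    from mult_right_mono[OF this s(1)[of z]]
    have "?D z ^ Suc m * \<sigma> z \<le> (Suc m)^2 * ((\<Sum>P\<in>C\<times>C'. if z \<in> fst P \<times> snd P then k (fst P) * k' (snd P) else 0) * \<sigma> z)"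
      by (simp only: mult.assoc)
    also have "(\<Sum>P\<in>C\<times>C'. if z \<in> fst P \<times> snd P then k (fst P) * k' (snd P) else 0) * \<sigma> z
      = (\<Sum>P\<in>C\<times>C'. if z \<in> fst P \<times> snd P then k (fst P) * k' (snd P) * \<sigma> z else 0)"
      unfolding sum_distrib_right by (intro sum.cong) auto
    finally show ?thesis .
  qed
  have "(\<Sum>z\<in>X\<times>Y. ?D z ^ Suc m * \<sigma> z)
    \<le> (\<Sum>z\<in>X\<times>Y. (Suc m)^2 * (\<Sum>P\<in>C\<times>C'. if z \<in> fst P \<times> snd P then k (fst P) * k' (snd P) * \<sigma> z else 0))"
    by (intro sum_mono pt)
  also have "\<dots> = (Suc m)^2 * (\<Sum>P\<in>C\<times>C'. \<Sum>z\<in>X\<times>Y. if z \<in> fst P \<times> snd P then k (fst P) * k' (snd P) * \<sigma> z else 0)"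
    unfolding sum_distrib_left[symmetric] by (subst sum.swap) simp
  also have "(\<Sum>P\<in>C\<times>C'. \<Sum>z\<in>X\<times>Y. if z \<in> fst P \<times> snd P then k (fst P) * k' (snd P) * \<sigma> z else 0)
    = (\<Sum>P\<in>C\<times>C'. k (fst P) * k' (snd P) * sum \<sigma> (fst P \<times> snd P))"
  proof (rule sum.cong[OF refl])
    fix P assume P: "P \<in> C \<times> C'"
    have "{z\<in>X\<times>Y. z \<in> fst P \<times> snd P} = fst P \<times> snd P"
      using P X(3)[of "fst P"] X(4)[of "snd P"] by auto
    then show "(\<Sum>z\<in>X\<times>Y. if z \<in> fst P \<times> snd P then k (fst P) * k' (snd P) * \<sigma> z else 0) = k (fst P) * k' (snd P) * sum \<sigma> (fst P \<times> snd P)"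
      using X by (simp add: sum.inter_filter[symmetric] sum_distrib_left)
  qed
  also have "\<dots> \<le> (\<Sum>P\<in>C\<times>C'. \<kappa> * (\<Sum>z\<in>core C (fst P) \<times> core C' (snd P). ?D z ^ m * \<sigma> z))"
  proof (rule sum_mono)
    fix P assume P: "P \<in> C \<times> C'"
    then have P': "fst P \<in> C" "snd P \<in> C'" by auto
    \<comment> \<open>One factor \<open>\<kappa>\<close> pays for both directions together.\<close>
    have "k (fst P) * k' (snd P) * sum \<sigma> (fst P \<times> snd P) \<le> k (fst P) * k' (snd P) * (\<kappa> * sum \<sigma> (core C (fst P) \<times> core C' (snd P)))"
      by (intro mult_left_mono \<kappa> P' mult_nonneg_nonneg k0)
    also have "\<dots> = \<kappa> * (\<Sum>z\<in>core C (fst P) \<times> core C' (snd P). k (fst P) * k' (snd P) * \<sigma> z)"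
      by (simp add: sum_distrib_left mult_ac)
    also have "(\<Sum>z\<in>core C (fst P) \<times> core C' (snd P). k (fst P) * k' (snd P) * \<sigma> z) = (\<Sum>z\<in>core C (fst P) \<times> core C' (snd P). ?D z ^ m * \<sigma> z)"
      by (intro sum.cong refl) (auto simp: k_def k'_def depth_core[OF fin(2) P'(1)] depth_core[OF fin(4) P'(2)] power_mult_distrib)
    finally show "k (fst P) * k' (snd P) * sum \<sigma> (fst P \<times> snd P) \<le> \<kappa> * (\<Sum>z\<in>core C (fst P) \<times> core C' (snd P). ?D z ^ m * \<sigma> z)" .
  qed
  also have "\<dots> = \<kappa> * (\<Sum>P\<in>C\<times>C'. (\<Sum>z\<in>core C (fst P) \<times> core C' (snd P). ?D z ^ m * \<sigma> z))"
    by (simp add: sum_distrib_left)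
  also have "(\<Sum>P\<in>C\<times>C'. (\<Sum>z\<in>core C (fst P) \<times> core C' (snd P). ?D z ^ m * \<sigma> z))
     = (\<Sum>z\<in>(\<Union>P\<in>C\<times>C'. core C (fst P) \<times> core C' (snd P)). ?D z ^ m * \<sigma> z)"
  proof (rule sum.UNION_disjoint[symmetric])
    show "\<forall>P\<in>C\<times>C'. finite (core C (fst P) \<times> core C' (snd P))"
      using fI fJ by (auto simp: core_def)
    show "\<forall>P\<in>C\<times>C'. \<forall>Q\<in>C\<times>C'. P \<noteq> Q \<longrightarrow> (core C (fst P) \<times> core C' (snd P)) \<inter> (core C (fst Q) \<times> core C' (snd Q)) = {}"
    proof (intro ballI impI)
      fix P Q assume PQ: "P \<in> C\<times>C'" "Q \<in> C\<times>C'" "P \<noteq> Q"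
      then have "core C (fst P) \<inter> core C (fst Q) = {} \<or> core C' (snd P) \<inter> core C' (snd Q) = {}"
        using core_disjoint[OF fin(2)] core_disjoint[OF fin(4)] by (metis mem_Times_iff prod_eqI)
      then show "(core C (fst P) \<times> core C' (snd P)) \<inter> (core C (fst Q) \<times> core C' (snd Q)) = {}" by blast
    qed
  qed (use fin in auto)
  also have "\<dots> \<le> (\<Sum>z\<in>X\<times>Y. ?D z ^ m * \<sigma> z)"
  proof (rule sum_mono2)
    show "(\<Union>P\<in>C\<times>C'. core C (fst P) \<times> core C' (snd P)) \<subseteq> X \<times> Y"
      using X core_subset[of C] core_subset[of C'] by fastforce
  qed (use X s in auto)
  finally show ?thesis using s by (simp add: mult_left_mono mult.assoc)
qed

text \<open>In every moment the product of the two depths behaves like a quantity of size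
  \<open>\<kappa>\<close>, up to a constant depending on \<open>m\<close>.\<close>

lemma depth_moment:
  fixes \<sigma> :: "'a \<times> 'b \<Rightarrow> real" and \<kappa> :: real
  assumes C: "sparse C" "sparse C'" and X: "finite X" "finite Y" "\<And>I. I \<in> C \<Longrightarrow> I \<subseteq> X" "\<And>J. J \<in> C' \<Longrightarrow> J \<subseteq> Y"
    and s: "\<And>z. 0 \<le> \<sigma> z" "0 \<le> \<kappa>"
    and \<kappa>: "\<And>I J. I \<in> C \<Longrightarrow> J \<in> C' \<Longrightarrow> sum \<sigma> (I \<times> J) \<le> \<kappa> * sum \<sigma> (core C I \<times> core C' J)"
  shows "(\<Sum>z\<in>X\<times>Y. (real (depth C (fst z)) * real (depth C' (snd z))) ^ m * \<sigma> z)
    \<le> (fact m)^2 * \<kappa> ^ m * sum \<sigma> (X \<times> Y)"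
proof (induction m)
  case (Suc m)
  have "(\<Sum>z\<in>X\<times>Y. (real (depth C (fst z)) * real (depth C' (snd z))) ^ Suc m * \<sigma> z)
    \<le> (Suc m)^2 * \<kappa> * (\<Sum>z\<in>X\<times>Y. (real (depth C (fst z)) * real (depth C' (snd z))) ^ m * \<sigma> z)"
    by (rule depth_moment_step[OF assms])
  also have "\<dots> \<le> (Suc m)^2 * \<kappa> * ((fact m)^2 * \<kappa> ^ m * sum \<sigma> (X \<times> Y))"
    using s by (intro mult_left_mono Suc) auto
  finally show ?case by (simp add: power_mult_distrib mult_ac)
qed simp

lemma sparse_subset:
  assumes "sparse C" "C' \<subseteq> C"
  shows "sparse C'"
proof -
  have "(\<Sum>J | J \<in> C' \<and> J \<subset> I. card J) \<le> (\<Sum>J | J \<in> C \<and> J \<subset> I. card J)" for I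
    using assms by (intro sum_mono2) (auto simp: sparse_def)
  then show ?thesis using assms laminar_subset[of C C'] finite_subset[of C' C]
    unfolding sparse_def by (meson le_trans mult_le_mono2 subset_iff)
qed

lemma sum_card_sparse:
  assumes "sparse C"
  shows "(\<Sum>I\<in>C. card I) \<le> 2 * card (\<Union>C)"
proof -
  have f: "finite C" "laminar C" "\<And>I. I \<in> C \<Longrightarrow> finite I" using assms by (auto simp: sparse_def)
  have "(\<Sum>I\<in>C. card I) \<le> (\<Sum>I\<in>C. 2 * card (core C I))"
    by (intro sum_mono card_core assms)
  also have "\<dots> = 2 * card (\<Union>I\<in>C. core C I)"
    using f core_disjoint[OF f(2)]
    by (subst card_UN_disjoint) (auto simp: sum_distrib_left core_def)
  also have "\<dots> \<le> 2 * card (\<Union>C)"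
    using f core_subset[of C] by (intro mult_le_mono2 card_mono) auto
  finally show ?thesis .
qed

section \<open>Antichains of crossing rectangles\<close>

abbreviation rect :: "'a set \<times> 'b set \<Rightarrow> ('a \<times> 'b) set" where
  "rect R \<equiv> fst R \<times> snd R"

text \<open>For nonempty sides this says that no rectangle of \<open>F\<close> contains another
  one.\<close>

definition antichain :: "('a set \<times> 'b set) set \<Rightarrow> bool" where
  "antichain F \<longleftrightarrow> (\<forall>R\<in>F. \<forall>T\<in>F. fst R \<subseteq> fst T \<longrightarrow> snd R \<subseteq> snd T \<longrightarrow> R = T)"

lemma antichain_swap: "antichain F \<Longrightarrow> antichain (prod.swap ` F)"
  unfolding antichain_def by auto

text \<open>Laminarity makes the sides comparable in each direction, and a rectangle larger in both
  directions would violate the antichain condition. So two members that meet form a cross.\<close>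

lemma antichain_cross:
  assumes "laminar \<I>" "laminar \<J>" "F \<subseteq> \<I> \<times> \<J>" "antichain F" "R \<in> F" "T \<in> F"
    "fst R \<inter> fst T \<noteq> {}" "snd R \<inter> snd T \<noteq> {}"
  shows "fst R \<subseteq> fst T \<and> snd T \<subseteq> snd R \<or> fst T \<subseteq> fst R \<and> snd R \<subseteq> snd T"
proof -
  have "fst R \<in> \<I>" "fst T \<in> \<I>" "snd R \<in> \<J>" "snd T \<in> \<J>" using assms by auto
  then have "fst R \<subseteq> fst T \<or> fst T \<subseteq> fst R" "snd R \<subseteq> snd T \<or> snd T \<subseteq> snd R"
    using assms(7,8) laminarD[OF assms(1)] laminarD[OF assms(2)] by blast+
  then show ?thesis using assms(4-6) unfolding antichain_def by blast
qed

text \<open>Ordering by width reverses ordering by height; this turns the rectangles through a point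
  into a chain.\<close>

lemma antichain_fst_subset_iff:
  assumes "laminar \<I>" "laminar \<J>" "F \<subseteq> \<I> \<times> \<J>" "antichain F" "R \<in> F" "T \<in> F"
    "fst R \<inter> fst T \<noteq> {}" "snd R \<inter> snd T \<noteq> {}"
  shows "fst R \<subseteq> fst T \<longleftrightarrow> snd T \<subseteq> snd R"
  using antichain_cross[OF assms] assms(4-6) unfolding antichain_def by blast

text \<open>A member \<open>T\<close> whose first side is strictly inside that of \<open>R\<close>
  and whose second side also contains \<open>J0\<close> is at least as tall as \<open>R\<close>, so
  the two meet in \<open>fst T \<times> snd R\<close>. Dividing the overlap bound for
  \<open>R\<close> by the height of \<open>R\<close> gives sparseness of the first sides.\<close>

lemma sparse_cross:
  assumes lam: "laminar \<I>" "laminar \<J>" and S: "finite S" "S \<subseteq> \<I> \<times> \<J>" "antichain S"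
    and fin: "\<And>I. I \<in> \<I> \<Longrightarrow> finite I" "\<And>J. J \<in> \<J> \<Longrightarrow> finite J"
    and sel: "\<And>R. R \<in> S \<Longrightarrow> 2 * (\<Sum>T\<in>S - {R}. card (rect R \<inter> rect T)) \<le> card (rect R)"
    and J0: "J0 \<noteq> {}"
  shows "sparse (fst ` {T\<in>S. J0 \<subseteq> snd T})" (is "sparse ?C")
proof -
  have "2 * (\<Sum>J | J \<in> ?C \<and> J \<subset> I. card J) \<le> card I" if "I \<in> ?C" for I
  proof -
    from that obtain R where R: "R \<in> S" "J0 \<subseteq> snd R" "I = fst R" by auto
    let ?T = "{T\<in>S. J0 \<subseteq> snd T \<and> fst T \<subset> I}"
    have T: "card (rect R \<inter> rect T) = card (fst T) * card (snd R)" "T \<noteq> R" if "T \<in> ?T" for T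
    proof -
      have mem: "snd R \<in> \<J>" "snd T \<in> \<J>" using that R S by auto
      have "snd R \<inter> snd T \<noteq> {}" using that R J0 by auto
      then have "snd R \<subseteq> snd T \<or> snd T \<subseteq> snd R" using laminarD[OF lam(2) mem] by blast
      moreover have "\<not> snd T \<subseteq> snd R" using S(3) that R unfolding antichain_def by blast
      ultimately have "snd R \<subseteq> snd T" by blast
      then have "rect R \<inter> rect T = fst T \<times> snd R" using that R by auto
      then show "card (rect R \<inter> rect T) = card (fst T) * card (snd R)" "T \<noteq> R"
        using that R by (auto simp: card_cartesian_product)
    qed
    have "{J. J \<in> ?C \<and> J \<subset> I} = fst ` ?T" by auto
    then have "(\<Sum>J | J \<in> ?C \<and> J \<subset> I. card J) = (\<Sum>J\<in>fst ` ?T. card J)" by simp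
    also have "\<dots> \<le> (\<Sum>T\<in>?T. card (fst T))"
      using sum_image_le[of ?T card fst] S(1) by simp
    finally have "2 * (\<Sum>J | J \<in> ?C \<and> J \<subset> I. card J) * card (snd R) \<le> 2 * (\<Sum>T\<in>?T. card (fst T) * card (snd R))"
      by (simp add: sum_distrib_right[symmetric] mult.assoc)
    also have "(\<Sum>T\<in>?T. card (fst T) * card (snd R)) = (\<Sum>T\<in>?T. card (rect R \<inter> rect T))"
      using T by simp
    also have "\<dots> \<le> (\<Sum>T\<in>S - {R}. card (rect R \<inter> rect T))"
      using T S(1) by (intro sum_mono2) auto
    also have "2 * \<dots> \<le> card I * card (snd R)" using sel[OF R(1)] R by (simp add: card_cartesian_product)
    finally have *: "2 * (\<Sum>J | J \<in> ?C \<and> J \<subset> I. card J) * card (snd R) \<le> card I * card (snd R)" by simp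
    have "0 < card (snd R)" using R S fin J0 by (metis card_gt_0_iff mem_Times_iff subset_eq subset_empty)
    then show ?thesis using * by simp
  qed
  moreover have sub: "?C \<subseteq> \<I>" using S(2) by auto
  moreover have "laminar ?C" using laminar_subset[OF lam(1) sub] .
  moreover have "finite ?C" using S(1) by simp
  moreover have "finite I" if "I \<in> ?C" for I using fin(1) sub that by blast
  ultimately show ?thesis unfolding sparse_def by (intro conjI ballI)
qed

lemma sum_reciprocal_sqrt:
  "(\<Sum>k=1..n. 1 / sqrt (real k)) \<le> 2 * sqrt (real n)"
proof (induction n)
  case (Suc n)
  have "1 / sqrt (real (Suc n)) \<le> 2 * (sqrt (real (Suc n)) - sqrt (real n))"
  proof -
    have pos: "0 < sqrt (real (Suc n))" by simp
    have "(sqrt (real (Suc n)) - sqrt (real n)) * (sqrt (real (Suc n)) + sqrt (real n)) = 1"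
      by (simp add: algebra_simps)
    moreover have "sqrt (real (Suc n)) + sqrt (real n) \<le> 2 * sqrt (real (Suc n))" by simp
    moreover have "0 \<le> sqrt (real (Suc n)) - sqrt (real n)" by simp
    ultimately have "1 \<le> (sqrt (real (Suc n)) - sqrt (real n)) * (2 * sqrt (real (Suc n)))"
      by (metis mult_left_mono)
    then show ?thesis using pos by (simp add: divide_simps algebra_simps)
  qed
  then show ?case using Suc by simp
qed simp

text \<open>A discrete version of the integral of 1 / sqrt (x (1 - x)) over the unit interval: one
  of the two factors is at least half of n + 1, and the other gives a sum of order sqrt n.\<close>

lemma sum_reciprocal_sqrt_product:
  "(\<Sum>k=1..n. 1 / sqrt (real k * real (Suc n - k))) \<le> 6"
proof (cases "n = 0")
  case False
  \<comment> \<open>Bounds 1 / sqrt a for every a that is at least (n + 1) / 2.\<close>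
  define c where "c = sqrt (2 / (real n + 1))"
  have pt: "1 / sqrt (real k * real (Suc n - k)) \<le> c * (1 / sqrt (real k)) + c * (1 / sqrt (real (Suc n - k)))"
    if k: "k \<in> {1..n}" for k
  proof -
    have *: "1 / sqrt (a * b) \<le> c * (1 / sqrt b)" if "0 < a" "0 < b" "(real n + 1) / 2 \<le> a" for a b :: real
    proof -
      have "sqrt (1 / a) \<le> c"
        unfolding c_def using that by (intro real_sqrt_le_mono) (simp add: field_simps)
      then have "1 / sqrt a \<le> c" by (simp add: real_sqrt_divide)
      then have "1 / sqrt a * (1 / sqrt b) \<le> c * (1 / sqrt b)" using that by (intro mult_right_mono) auto
      then show ?thesis by (simp add: real_sqrt_mult)
    qed
    have ks: "0 < real k" "0 < real (Suc n - k)" "real k + real (Suc n - k) = real n + 1" using k by auto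
    have c0: "0 \<le> c * (1 / sqrt (real k))" "0 \<le> c * (1 / sqrt (real (Suc n - k)))" by (auto simp: c_def)
    show ?thesis
    proof (cases "(real n + 1) / 2 \<le> real k")
      case True
      then show ?thesis using *[of "real k" "real (Suc n - k)"] ks c0 by linarith
    next
      case False
      moreover have "(real n + 1) / 2 \<le> b" if "\<not> (real n + 1) / 2 \<le> a" "a + b = real n + 1" for a b :: real
        using that by (simp add: field_simps)
      ultimately have "(real n + 1) / 2 \<le> real (Suc n - k)" using ks by blast
      then show ?thesis using *[of "real (Suc n - k)" "real k"] ks c0 by (simp add: mult.commute)
    qed
  qed
  have "(\<Sum>k=1..n. 1 / sqrt (real k * real (Suc n - k)))
     \<le> (\<Sum>k=1..n. c * (1 / sqrt (real k)) + c * (1 / sqrt (real (Suc n - k))))"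
    by (intro sum_mono pt)
  also have "\<dots> = c * (\<Sum>k=1..n. 1 / sqrt (real k)) + c * (\<Sum>k=1..n. 1 / sqrt (real (Suc n - k)))"
    by (simp add: sum.distrib sum_distrib_left)
  also have "(\<Sum>k=1..n. 1 / sqrt (real (Suc n - k))) = (\<Sum>k=1..n. 1 / sqrt (real k))"
    by (rule sum.reindex_bij_witness[of _ "\<lambda>k. Suc n - k" "\<lambda>k. Suc n - k"]) auto
  finally have "(\<Sum>k=1..n. 1 / sqrt (real k * real (Suc n - k))) \<le> 2 * c * (\<Sum>k=1..n. 1 / sqrt (real k))"
    by simp
  also have "\<dots> \<le> 2 * c * (2 * sqrt (real n))"
    by (intro mult_left_mono sum_reciprocal_sqrt) (simp add: c_def)
  also have "\<dots> = 4 * sqrt (2 * real n / (real n + 1))"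
    by (simp add: c_def real_sqrt_mult[symmetric])
  \<comment> \<open>The root is below sqrt 2, which is replaced by the rational bound 3/2.\<close>
  also have "\<dots> \<le> 4 * sqrt ((3/2)\<^sup>2)"
    by (intro mult_left_mono real_sqrt_le_mono) (simp_all add: field_simps power2_eq_square)
  finally show ?thesis by simp
qed simp

lemma sum_fibres_mono:
  fixes w :: "'a \<times> 'b \<Rightarrow> real"
  assumes "finite A" "finite B"
    and "\<And>y. (\<Sum>x | (x, y) \<in> A. w (x, y)) \<le> c * (\<Sum>x | (x, y) \<in> B. w (x, y))"
  shows "sum w A \<le> c * sum w B"
proof -
  define Y where "Y = snd ` (A \<union> B)"
  have *: "sum w E = (\<Sum>y\<in>Y. \<Sum>x | (x, y) \<in> E. w (x, y))" if "E \<subseteq> A \<union> B" for E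
  proof -
    have fin: "finite {x. (x, y) \<in> E}" for y
      using finite_subset[of "{x. (x, y) \<in> E}" "fst ` (A \<union> B)"] that assms by force
    have "(\<Sum>y\<in>Y. \<Sum>x | (x, y) \<in> E. w (x, y)) = (\<Sum>(y, x)\<in>(SIGMA y:Y. {x. (x, y) \<in> E}). w (x, y))"
      using assms fin by (intro sum.Sigma) (auto simp: Y_def)
    also have "\<dots> = sum w E"
      by (rule sum.reindex_bij_witness[of _ prod.swap prod.swap]) (use that in \<open>force simp: Y_def\<close>)+
    finally show ?thesis by simp
  qed
  show ?thesis using assms(3) *[of A] *[of B] by (simp add: sum_distrib_left sum_mono)
qed

section \<open>Pairs of weights on a plane grid\<close>

locale ap_pair =
  fixes \<I> :: "'a set set" and \<J> :: "'b set set" and w \<sigma> :: "'a \<times> 'b \<Rightarrow> real" and p K :: real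
  assumes p: "1 < p"
    and lam: "laminar \<I>" "laminar \<J>"
    and fin: "\<And>I. I \<in> \<I> \<Longrightarrow> finite I" "\<And>J. J \<in> \<J> \<Longrightarrow> finite J"
    and ne: "{} \<notin> \<I>" "{} \<notin> \<J>"
    and sing: "\<And>x. {x} \<in> \<I>" "\<And>y. {y} \<in> \<J>"
    and pos: "\<And>z. 0 < w z" "\<And>z. 0 < \<sigma> z"
    and lower: "\<And>z. 1 \<le> w z * \<sigma> z powr (p - 1)"
    and upper: "\<And>I J. I \<in> \<I> \<Longrightarrow> J \<in> \<J> \<Longrightarrow>
      sum w (I \<times> J) * sum \<sigma> (I \<times> J) powr (p - 1) \<le> K * real (card (I \<times> J)) powr p"
begin

text \<open>Lets every statement about first sides be applied to second sides.\<close>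

lemma swap: "ap_pair \<J> \<I> (w \<circ> prod.swap) (\<sigma> \<circ> prod.swap) p K"
proof
  show "sum (w \<circ> prod.swap) (J \<times> I) * sum (\<sigma> \<circ> prod.swap) (J \<times> I) powr (p - 1) \<le> K * real (card (J \<times> I)) powr p"
    if "J \<in> \<J>" "I \<in> \<I>" for I J
  proof -
    have *: "sum (g \<circ> prod.swap) (J \<times> I) = sum g (I \<times> J)" for g :: "'a \<times> 'b \<Rightarrow> real"
      by (rule sum.reindex_bij_witness[of _ prod.swap prod.swap]) auto
    show ?thesis using upper[OF that(2,1)] unfolding * by (simp add: card_cartesian_product mult.commute)
  qed
qed (use p lam fin ne sing pos lower in auto)

lemma K_ge_1: "1 \<le> K"
  using upper[OF sing(1) sing(2), of undefined undefined] lower[of "(undefined, undefined)"] by simp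

lemma dual_le: "\<sigma> z powr (1 - p) \<le> w z"
proof -
  have "\<sigma> z powr (1 - p) * 1 \<le> \<sigma> z powr (1 - p) * (w z * \<sigma> z powr (p - 1))"
    by (intro mult_left_mono lower) auto
  also have "\<dots> = w z * (\<sigma> z powr (1 - p) * \<sigma> z powr (p - 1))" by (simp add: mult_ac)
  also have "\<sigma> z powr (1 - p) * \<sigma> z powr (p - 1) = 1"
    using pos(2)[of z] by (simp add: powr_add[symmetric])
  finally show ?thesis by simp
qed

lemma card_powr_le:
  assumes "finite E"
  shows "real (card E) powr p \<le> sum w E * sum \<sigma> E powr (p - 1)"
proof -
  have "(\<Sum>z\<in>E. 1) powr p \<le> (\<Sum>z\<in>E. 1 powr p * \<sigma> z powr (1 - p)) * sum \<sigma> E powr (p - 1)"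
    using holder_sum[of p E "\<lambda>_. 1" \<sigma>] p assms pos by simp
  also have "\<dots> \<le> sum w E * sum \<sigma> E powr (p - 1)"
    using dual_le by (intro mult_right_mono sum_mono) auto
  finally show ?thesis by simp
qed

text \<open>\<open>card_powr_le\<close> on \<open>E\<close> is combined with \<open>upper\<close> on
  the rectangle; the \<sigma>-mass of \<open>E\<close> is at most that of the rectangle and cancels.
  A set of fixed proportion therefore carries at least a multiple of 1/K of the
  \<open>w\<close>-mass.\<close>

lemma w_subset_bound:
  assumes "I \<in> \<I>" "J \<in> \<J>" "E \<subseteq> I \<times> J"
  shows "real (card E) powr p * sum w (I \<times> J) \<le> K * real (card (I \<times> J)) powr p * sum w E"
proof -
  have f: "finite (I \<times> J)" "finite E" using fin assms finite_subset[of E "I \<times> J"] by auto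
  have w0: "0 \<le> sum w A" for A using pos by (simp add: sum_nonneg less_imp_le)
  have s0: "0 \<le> sum \<sigma> A" for A using pos by (simp add: sum_nonneg less_imp_le)
  have "sum \<sigma> E \<le> sum \<sigma> (I \<times> J)" using f assms pos by (intro sum_mono2) (auto simp: less_imp_le)
  then have "sum \<sigma> E powr (p - 1) \<le> sum \<sigma> (I \<times> J) powr (p - 1)" using p s0 by (intro powr_mono2) auto
  then have "real (card E) powr p \<le> sum w E * sum \<sigma> (I \<times> J) powr (p - 1)"
    using card_powr_le[OF f(2)] w0 by (meson mult_left_mono order_trans)
  then have "real (card E) powr p * sum w (I \<times> J) \<le> sum w E * sum \<sigma> (I \<times> J) powr (p - 1) * sum w (I \<times> J)"
    using w0 by (intro mult_right_mono) auto
  also have "\<dots> = sum w E * (sum w (I \<times> J) * sum \<sigma> (I \<times> J) powr (p - 1))" by (simp add: mult_ac)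
  also have "\<dots> \<le> sum w E * (K * real (card (I \<times> J)) powr p)"
    using w0 upper[OF assms(1,2)] by (intro mult_left_mono) auto
  finally show ?thesis by (simp add: mult_ac)
qed

text \<open>The same argument with the weights exchanged. Solving for \<sigma> takes a root of order
  p - 1, and this is where \<open>K\<close> becomes \<open>S\<close>.\<close>

lemma sigma_subset_bound:
  assumes "I \<in> \<I>" "J \<in> \<J>" "E \<subseteq> I \<times> J" "real (card (I \<times> J)) \<le> c * real (card E)" "0 \<le> c"
  shows "sum \<sigma> (I \<times> J) \<le> K powr (1 / (p - 1)) * c powr (p / (p - 1)) * sum \<sigma> E"
proof -
  have f: "finite (I \<times> J)" "finite E" using fin assms finite_subset[of E "I \<times> J"] by auto
  have ne': "I \<times> J \<noteq> {}" using assms(1,2) ne by auto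
  have R0: "0 < real (card (I \<times> J))" using f ne' by (simp add: card_gt_0_iff del: card_cartesian_product)
  have w0: "0 < sum w (I \<times> J)" using pos f ne' by (intro sum_pos) auto
  have s0: "0 \<le> sum \<sigma> A" for A using pos by (simp add: sum_nonneg less_imp_le)
  have "sum w E \<le> sum w (I \<times> J)" using f assms pos by (intro sum_mono2) (auto simp: less_imp_le)
  then have E: "real (card E) powr p \<le> sum w (I \<times> J) * sum \<sigma> E powr (p - 1)"
    using card_powr_le[OF f(2)] by (meson mult_right_mono order_trans powr_ge_zero)
  let ?n = "real (card (I \<times> J))"
  have "?n powr p \<le> (c * real (card E)) powr p" using assms p by (intro powr_mono2) auto
  also have "\<dots> = c powr p * real (card E) powr p" using assms by (simp add: powr_mult)
  also have "\<dots> \<le> c powr p * (sum w (I \<times> J) * sum \<sigma> E powr (p - 1))" by (intro mult_left_mono E) auto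
  finally have "?n powr p * sum \<sigma> (I \<times> J) powr (p - 1)
      \<le> c powr p * (sum w (I \<times> J) * sum \<sigma> E powr (p - 1)) * sum \<sigma> (I \<times> J) powr (p - 1)"
    by (intro mult_right_mono) auto
  also have "\<dots> = c powr p * sum \<sigma> E powr (p - 1) * (sum w (I \<times> J) * sum \<sigma> (I \<times> J) powr (p - 1))"
    by (simp add: mult_ac)
  also have "\<dots> \<le> c powr p * sum \<sigma> E powr (p - 1) * (K * ?n powr p)"
    by (intro mult_left_mono upper assms) auto
  finally have "?n powr p * sum \<sigma> (I \<times> J) powr (p - 1) \<le> ?n powr p * (K * c powr p * sum \<sigma> E powr (p - 1))"
    by (simp add: mult_ac)
  then have *: "sum \<sigma> (I \<times> J) powr (p - 1) \<le> K * c powr p * sum \<sigma> E powr (p - 1)"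
    using R0 by simp
  have "sum \<sigma> (I \<times> J) = (sum \<sigma> (I \<times> J) powr (p - 1)) powr (1 / (p - 1))"
    using s0 p by (simp add: powr_powr)
  also have "\<dots> \<le> (K * c powr p * sum \<sigma> E powr (p - 1)) powr (1 / (p - 1))"
    using p by (intro powr_mono2 *) auto
  also have "\<dots> = K powr (1 / (p - 1)) * c powr (p / (p - 1)) * sum \<sigma> E"
    using s0 p K_ge_1 by (simp add: powr_mult powr_powr)
  finally show ?thesis .
qed

text \<open>Hoelder with \<sigma> \<rho>^(-1/(p-1)) in place of \<sigma>; \<rho> = 1 gives the usual
  bound. Since \<rho> ends up as a factor of f^p, the bounds for several overlapping rectangles can
  be added whenever the sum of their weights at each point is controlled.\<close>

lemma average_powr_bound:
  assumes IJ: "I \<in> \<I>" "J \<in> \<J>" and f: "\<And>z. 0 \<le> f z" and \<rho>: "\<And>z. z \<in> I \<times> J \<Longrightarrow> 0 < \<rho> z"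
    and \<rho>_le: "(\<Sum>z\<in>I \<times> J. \<sigma> z * \<rho> z powr (- (1 / (p - 1)))) \<le> c * sum \<sigma> (I \<times> J)" "0 \<le> c"
    and t: "0 \<le> t" "t * real (card (I \<times> J)) \<le> sum f (I \<times> J)"
  shows "t powr p * sum w (I \<times> J) \<le> c powr (p - 1) * K * (\<Sum>z\<in>I \<times> J. f z powr p * \<sigma> z powr (1 - p) * \<rho> z)"
proof -
  have fR: "finite (I \<times> J)" using fin IJ by auto
  have ne': "I \<times> J \<noteq> {}" using IJ ne by auto
  let ?n = "real (card (I \<times> J))"
  have R0: "0 < ?n" using fR ne' by (simp add: card_gt_0_iff del: card_cartesian_product)
  have w0: "0 \<le> sum w A" for A using pos by (simp add: sum_nonneg less_imp_le)
  have s0: "0 \<le> sum \<sigma> A" for A using pos by (simp add: sum_nonneg less_imp_le)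
  define X where "X = (\<Sum>z\<in>I \<times> J. f z powr p * \<sigma> z powr (1 - p) * \<rho> z)"
  have X0: "0 \<le> X" unfolding X_def using \<rho> by (intro sum_nonneg mult_nonneg_nonneg) (auto simp: less_imp_le)
  have "(t * ?n) powr p \<le> sum f (I \<times> J) powr p" using t p R0 by (intro powr_mono2) auto
  also have "\<dots> \<le> (\<Sum>z\<in>I \<times> J. f z powr p * (\<sigma> z * \<rho> z powr (- (1 / (p - 1)))) powr (1 - p))
      * (\<Sum>z\<in>I \<times> J. \<sigma> z * \<rho> z powr (- (1 / (p - 1)))) powr (p - 1)"
    using p fR f pos \<rho> by (intro holder_sum mult_pos_pos) (auto simp: less_le[of 0])
  also have "(\<Sum>z\<in>I \<times> J. f z powr p * (\<sigma> z * \<rho> z powr (- (1 / (p - 1)))) powr (1 - p)) = X"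
    unfolding X_def
  proof (rule sum.cong[OF refl])
    fix z assume z: "z \<in> I \<times> J"
    have "- (1 / (p - 1)) * (1 - p) = 1" using p by (simp add: divide_simps)
    then have "(\<rho> z powr (- (1 / (p - 1)))) powr (1 - p) = \<rho> z"
      unfolding powr_powr using \<rho>[OF z] by simp
    then show "f z powr p * (\<sigma> z * \<rho> z powr (- (1 / (p - 1)))) powr (1 - p) = f z powr p * \<sigma> z powr (1 - p) * \<rho> z"
      using pos[of z] by (simp add: powr_mult less_imp_le)
  qed
  also have "X * (\<Sum>z\<in>I \<times> J. \<sigma> z * \<rho> z powr (- (1 / (p - 1)))) powr (p - 1) \<le> X * (c * sum \<sigma> (I \<times> J)) powr (p - 1)"
    using p pos X0 \<rho>_le by (intro mult_left_mono powr_mono2 sum_nonneg) (auto simp: less_imp_le)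
  also have "\<dots> = X * c powr (p - 1) * sum \<sigma> (I \<times> J) powr (p - 1)"
    using \<rho>_le s0 by (simp add: powr_mult)
  finally have "(t * ?n) powr p * sum w (I \<times> J) \<le> X * c powr (p - 1) * sum \<sigma> (I \<times> J) powr (p - 1) * sum w (I \<times> J)"
    using w0 by (intro mult_right_mono) auto
  also have "\<dots> = X * c powr (p - 1) * (sum w (I \<times> J) * sum \<sigma> (I \<times> J) powr (p - 1))"
    by (simp add: mult_ac)
  also have "\<dots> \<le> X * c powr (p - 1) * (K * ?n powr p)"
    using X0 by (intro mult_left_mono upper IJ) auto
  finally have "?n powr p * (t powr p * sum w (I \<times> J)) \<le> ?n powr p * (c powr (p - 1) * K * X)"
    using t R0 by (simp add: powr_mult mult_ac)
  then show ?thesis using R0 unfolding X_def by simp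
qed

text \<open>On the horizontal line through \<open>y\<close>, each \<open>fst R\<close> is an
  interval of which \<open>U\<close> fills a proportion 1/c. The weight on that line satisfies the
  A_p condition with the same \<open>K\<close>, so passing to maximal intervals costs one factor
  \<open>K\<close> and no further covering constant.\<close>

lemma fibre_cover_bound:
  assumes F: "finite F" "F \<subseteq> \<I> \<times> \<J>" and U: "finite U"
    and cov: "\<And>R y. R \<in> F \<Longrightarrow> y \<in> snd R \<Longrightarrow> real (card (fst R)) \<le> c * real (card {x\<in>fst R. (x, y) \<in> U})" "0 \<le> c"
  shows "sum w (\<Union>R\<in>F. rect R) \<le> c powr p * K * sum w U"
proof (rule sum_fibres_mono)
  have fR: "finite (fst R)" "finite (snd R)" "fst R \<noteq> {}" if "R \<in> F" for R
    using that F fin ne by auto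
  then show "finite (\<Union>R\<in>F. rect R)" using F by auto
  show "finite U" by fact
  fix y
  let ?M = "fst ` {R\<in>F. y \<in> snd R}"
  let ?U = "{x. (x, y) \<in> U}"
  have finU: "finite ?U" using finite_subset[of ?U "fst ` U"] U by force
  have M: "finite ?M" "?M \<subseteq> \<I>" using F by auto
  have c0: "0 \<le> c powr p * K" using K_ge_1 by simp
  have "(\<Sum>x\<in>\<Union>?M. w (x, y)) \<le> (\<Sum>x\<in>\<Union>?M. c powr p * K * (if (x, y) \<in> U then w (x, y) else 0))"
  proof (rule laminar_sum_Union_mono[OF M(1) laminar_subset[OF lam(1) M(2)]])
    fix I assume "I \<in> ?M"
    then obtain R where R: "R \<in> F" "y \<in> snd R" "I = fst R" by auto
    show "finite I" using fR R by auto
    let ?E = "{x\<in>I. (x, y) \<in> U}"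
    have cE: "card ((\<lambda>x. (x, y)) ` ?E) = card ?E" by (intro card_image) (auto simp: inj_on_def)
    have sE: "sum w ((\<lambda>x. (x, y)) ` A) = (\<Sum>x\<in>A. w (x, y))" for A
      by (subst sum.reindex) (auto simp: inj_on_def)
    have IE: "I \<times> {y} = (\<lambda>x. (x, y)) ` I" by auto
    have I: "I \<in> \<I>" using R F by auto
    have n0: "0 < real (card I)" using fR[OF R(1)] R(3) by (simp add: card_gt_0_iff)
    have "real (card ?E) powr p * (\<Sum>x\<in>I. w (x, y)) \<le> K * real (card I) powr p * (\<Sum>x\<in>?E. w (x, y))"
      using w_subset_bound[OF I sing(2)[of y], of "(\<lambda>x. (x, y)) ` ?E"]
      unfolding cE sE card_cartesian_product unfolding IE sE by auto
    also have "\<dots> \<le> K * (c * real (card ?E)) powr p * (\<Sum>x\<in>?E. w (x, y))"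
      using cov(1)[OF R(1,2)] R(3) K_ge_1 p pos
      by (intro mult_right_mono mult_left_mono powr_mono2 sum_nonneg) (auto simp: less_imp_le)
    also have "\<dots> = real (card ?E) powr p * (c powr p * K * (\<Sum>x\<in>?E. w (x, y)))"
      using cov(2) by (simp add: powr_mult mult_ac)
    finally have "real (card ?E) powr p * (\<Sum>x\<in>I. w (x, y)) \<le> real (card ?E) powr p * (c powr p * K * (\<Sum>x\<in>?E. w (x, y)))" .
    moreover have "0 < real (card ?E) powr p" using cov(1)[OF R(1,2)] R(3) n0 by (cases "card ?E = 0") auto
    ultimately have "(\<Sum>x\<in>I. w (x, y)) \<le> c powr p * K * (\<Sum>x\<in>?E. w (x, y))" by simp
    also have "(\<Sum>x\<in>?E. w (x, y)) = (\<Sum>x\<in>I. if (x, y) \<in> U then w (x, y) else 0)"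
      using fR R by (simp add: sum.inter_filter)
    finally show "(\<Sum>x\<in>I. w (x, y)) \<le> (\<Sum>x\<in>I. c powr p * K * (if (x, y) \<in> U then w (x, y) else 0))"
      by (simp add: sum_distrib_left)
  qed
  also have "\<dots> = c powr p * K * (\<Sum>x | x \<in> \<Union>?M \<and> (x, y) \<in> U. w (x, y))"
  proof -
    have "finite (\<Union>?M)" using M(1) fR by auto
    from sum.inter_filter[OF this, of "\<lambda>x. w (x, y)" "\<lambda>x. (x, y) \<in> U"]
    show ?thesis by (simp only: sum_distrib_left[symmetric])
  qed
  also have "\<dots> \<le> c powr p * K * (\<Sum>x\<in>?U. w (x, y))"
    using c0 finU pos by (intro mult_left_mono sum_mono2) (auto simp: less_imp_le)
  also have "\<Union>?M = {x. (x, y) \<in> (\<Union>R\<in>F. rect R)}" by auto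
  finally show "(\<Sum>x | (x, y) \<in> (\<Union>R\<in>F. rect R). w (x, y)) \<le> c powr p * K * (\<Sum>x | (x, y) \<in> U. w (x, y))" .
qed

end

text \<open>The factor by which the averaging inequality loses when the measure is redistributed along the
  chains of rectangles; \<open>m\<close> is the order of the depth moment that is used.\<close>

definition moment_const :: "real \<Rightarrow> nat \<Rightarrow> real" where
  "moment_const p m = 1 + (fact m)\<^sup>2 * (4 powr (p / (p - 1))) ^ m"

lemma sum_UN_le:
  fixes w :: "'a \<Rightarrow> real"
  assumes "finite S" "\<And>i. i \<in> S \<Longrightarrow> finite (A i)" "\<And>z. 0 \<le> w z"
  shows "sum w (\<Union>i\<in>S. A i) \<le> (\<Sum>i\<in>S. sum w (A i))"
  using assms(1,2)
proof (induction S rule: finite_induct)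
  case (insert i S)
  have "sum w (A i \<union> (\<Union>i\<in>S. A i)) + sum w (A i \<inter> (\<Union>i\<in>S. A i)) = sum w (A i) + sum w (\<Union>i\<in>S. A i)"
    using insert by (intro sum.union_inter) auto
  moreover have "0 \<le> sum w (A i \<inter> (\<Union>i\<in>S. A i))" using assms(3) by (simp add: sum_nonneg)
  ultimately show ?case using insert by simp
qed simp

text \<open>Equal first sides force inclusion of the second sides both ways. Sums over rectangles
  thus become sums over sides without multiplicity.\<close>

lemma antichain_inj_on:
  assumes "laminar \<I>" "laminar \<J>" "F \<subseteq> \<I> \<times> \<J>" "antichain F" "{} \<notin> \<I>" "J0 \<noteq> {}"
  shows "inj_on fst {T\<in>F. J0 \<subseteq> snd T}"
proof (rule inj_onI)
  fix R T assume *: "R \<in> {T\<in>F. J0 \<subseteq> snd T}" "T \<in> {T\<in>F. J0 \<subseteq> snd T}" "fst R = fst T"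
  have "fst R \<in> \<I>" using * assms(3) by auto
  then have "fst R \<inter> fst T \<noteq> {}" "snd R \<inter> snd T \<noteq> {}" using * assms(5,6) by auto
  then have "snd T \<subseteq> snd R" "snd R \<subseteq> snd T"
    using antichain_fst_subset_iff[OF assms(1-4), of R T] antichain_fst_subset_iff[OF assms(1-4), of T R] * by auto
  then show "R = T" using * by (auto simp: prod_eq_iff)
qed

section \<open>Selected rectangles and the weak type bound for a pair of coordinates\<close>

context ap_pair
begin

text \<open>Only the rectangles that are maximal under inclusion are kept; finiteness puts every
  rectangle below one of them.\<close>

lemma antichain_reduction:
  assumes "finite F" "F \<subseteq> \<I> \<times> \<J>"
  obtains F' where "F' \<subseteq> F" "antichain F'" "(\<Union>R\<in>F'. rect R) = (\<Union>R\<in>F. rect R)"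
proof -
  define F' where "F' = {R\<in>F. \<forall>T\<in>F. fst R \<subseteq> fst T \<longrightarrow> snd R \<subseteq> snd T \<longrightarrow> R = T}"
  let ?r = rect
  have nonempty: "fst R \<noteq> {}" "snd R \<noteq> {}" if "R \<in> F" for R using that assms ne by auto
  have "\<exists>T\<in>F'. ?r R \<subseteq> ?r T" if "R \<in> F" for R
  proof -
    have "R \<in> {T\<in>F. ?r R \<subseteq> ?r T}" using that by blast
    then have "?r ` {T\<in>F. ?r R \<subseteq> ?r T} \<noteq> {}" by blast
    moreover have "finite (?r ` {T\<in>F. ?r R \<subseteq> ?r T})" using assms(1) by simp
    ultimately have "finite (?r ` {T\<in>F. ?r R \<subseteq> ?r T})" "?r ` {T\<in>F. ?r R \<subseteq> ?r T} \<noteq> {}" by blast+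
    from finite_has_maximal[OF this]
    obtain T where T: "T \<in> F" "?r R \<subseteq> ?r T" "\<And>T'. T' \<in> F \<Longrightarrow> ?r R \<subseteq> ?r T' \<Longrightarrow> ?r T \<subseteq> ?r T' \<Longrightarrow> ?r T = ?r T'"
      by auto
    have "T = T'" if "T' \<in> F" "fst T \<subseteq> fst T'" "snd T \<subseteq> snd T'" for T'
    proof -
      have "?r T \<subseteq> ?r T'" using that by auto
      then have "?r T = ?r T'" using T that by blast
      then show ?thesis using nonempty[OF T(1)] nonempty[OF that(1)] by (auto simp: times_eq_iff prod_eq_iff)
    qed
    then have "T \<in> F'" unfolding F'_def using T(1) by blast
    then show ?thesis using T(2) by blast
  qed
  then have "(\<Union>R\<in>F. ?r R) \<subseteq> (\<Union>R\<in>F'. ?r R)" by blast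
  moreover have sub: "F' \<subseteq> F" unfolding F'_def by blast
  ultimately have "(\<Union>R\<in>F'. ?r R) = (\<Union>R\<in>F. ?r R)" by blast
  moreover have "antichain F'" unfolding antichain_def F'_def by blast
  ultimately show ?thesis using sub by (intro that[of F'])
qed

definition selected :: "('a set \<times> 'b set) set \<Rightarrow> bool" where
  "selected S \<longleftrightarrow> finite S \<and> S \<subseteq> \<I> \<times> \<J> \<and> antichain S \<and>
    (\<forall>R\<in>S. 2 * (\<Sum>T\<in>S - {R}. card (rect R \<inter> rect T)) \<le> card (rect R))"

lemma sparse_fst:
  assumes "selected S" "J0 \<noteq> {}"
  shows "sparse (fst ` {T\<in>S. J0 \<subseteq> snd T})"
  using assms by (intro sparse_cross[OF lam]) (auto simp: selected_def fin)

lemma selected_swap: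
  assumes "selected S"
  shows "ap_pair.selected \<J> \<I> (prod.swap ` S)"
proof -
  interpret sw: ap_pair \<J> \<I> "w \<circ> prod.swap" "\<sigma> \<circ> prod.swap" p K by (rule swap)
  have "2 * (\<Sum>T\<in>prod.swap ` S - {prod.swap R}. card ((snd R \<times> fst R) \<inter> (rect T))) \<le> card (snd R \<times> fst R)"
    if "R \<in> S" for R
  proof -
    have "prod.swap ` S - {prod.swap R} = prod.swap ` (S - {R})" by (auto simp: prod_eq_iff)
    then have "(\<Sum>T\<in>prod.swap ` S - {prod.swap R}. card ((snd R \<times> fst R) \<inter> (rect T)))
      = (\<Sum>T\<in>S - {R}. card ((snd R \<times> fst R) \<inter> (snd T \<times> fst T)))"
      by (simp add: sum.reindex)
    also have "\<dots> = (\<Sum>T\<in>S - {R}. card (rect R \<inter> rect T))"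
      by (simp add: Times_Int_Times card_cartesian_product mult.commute)
    finally show ?thesis using that assms by (simp add: selected_def card_cartesian_product mult.commute)
  qed
  then show ?thesis
    using assms antichain_swap unfolding selected_def sw.selected_def by auto
qed

lemma sparse_snd:
  assumes "selected S" "I0 \<noteq> {}"
  shows "sparse (snd ` {T\<in>S. I0 \<subseteq> fst T})"
proof -
  interpret sw: ap_pair \<J> \<I> "w \<circ> prod.swap" "\<sigma> \<circ> prod.swap" p K by (rule swap)
  have "snd ` {T\<in>S. I0 \<subseteq> fst T} = fst ` {T\<in>prod.swap ` S. I0 \<subseteq> snd T}" by force
  then show ?thesis using sw.sparse_fst[OF selected_swap[OF assms(1)] assms(2)] by simp
qed

text \<open>First sides of the members that cross \<open>R\<close> from bottom to top: at least as
  tall and at most as wide. \<open>R\<close> itself takes part if it belongs to \<open>S\<close>;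
  for \<open>R\<close> outside \<open>S\<close> the family measures how well \<open>R\<close> is
  covered.\<close>

definition fst_family :: "('a set \<times> 'b set) set \<Rightarrow> ('a set \<times> 'b set) \<Rightarrow> 'a set set" where
  "fst_family S R = fst ` {T\<in>S. snd R \<subseteq> snd T \<and> fst T \<subseteq> fst R}"

definition snd_family :: "('a set \<times> 'b set) set \<Rightarrow> ('a set \<times> 'b set) \<Rightarrow> 'b set set" where
  "snd_family S R = snd ` {T\<in>S. fst R \<subseteq> fst T \<and> snd T \<subseteq> snd R}"

lemma sparse_families:
  assumes "selected S" "R \<in> \<I> \<times> \<J>"
  shows "sparse (fst_family S R)" "sparse (snd_family S R)"
proof -
  have "fst R \<noteq> {}" "snd R \<noteq> {}" using assms ne by auto
  then show "sparse (fst_family S R)" "sparse (snd_family S R)"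
    using sparse_fst[OF assms(1), of "snd R"] sparse_snd[OF assms(1), of "fst R"]
    by (auto elim!: sparse_subset simp: fst_family_def snd_family_def)
qed

lemma family_subsets:
  "I \<in> fst_family S R \<Longrightarrow> I \<subseteq> fst R" "J \<in> snd_family S R \<Longrightarrow> J \<subseteq> snd R"
  "selected S \<Longrightarrow> I \<in> fst_family S R \<Longrightarrow> I \<in> \<I>" "selected S \<Longrightarrow> J \<in> snd_family S R \<Longrightarrow> J \<in> \<J>"
  by (auto simp: fst_family_def snd_family_def selected_def)

text \<open>Each core fills half of its set, so a product of two cores fills a quarter of the
  rectangle. This gives the 4 and, more importantly, one application of
  \<open>sigma_subset_bound\<close> and hence one factor \<open>K powr (1 / (p - 1))\<close> for
  both depths.\<close>

lemma depth_moment_sigma: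
  assumes S: "selected S" and R: "R \<in> \<I> \<times> \<J>"
  shows "(\<Sum>z\<in>rect R. (real (depth (fst_family S R) (fst z)) * real (depth (snd_family S R) (snd z))) ^ m * \<sigma> z)
    \<le> (fact m)\<^sup>2 * (K powr (1 / (p - 1)) * 4 powr (p / (p - 1))) ^ m * sum \<sigma> (rect R)"
proof (rule depth_moment)
  note sp = sparse_families[OF S R]
  show "sparse (fst_family S R)" "sparse (snd_family S R)" by fact+
  show "finite (fst R)" "finite (snd R)" using R fin by auto
  show "I \<subseteq> fst R" if "I \<in> fst_family S R" for I using family_subsets that by blast
  show "J \<subseteq> snd R" if "J \<in> snd_family S R" for J using family_subsets that by blast
  show "0 \<le> \<sigma> z" for z using pos(2)[of z] by simp
  show "sum \<sigma> (I \<times> J) \<le> K powr (1 / (p - 1)) * 4 powr (p / (p - 1)) * sum \<sigma> (core (fst_family S R) I \<times> core (snd_family S R) J)"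
    if "I \<in> fst_family S R" "J \<in> snd_family S R" for I J
  proof (rule sigma_subset_bound)
    show "I \<in> \<I>" "J \<in> \<J>" using family_subsets(3,4)[OF S] that by auto
    show "core (fst_family S R) I \<times> core (snd_family S R) J \<subseteq> I \<times> J"
      by (intro Sigma_mono core_subset)
    have "card I * card J \<le> (2 * card (core (fst_family S R) I)) * (2 * card (core (snd_family S R) J))"
      by (intro mult_le_mono card_core sp that)
    then have "card (I \<times> J) \<le> 4 * card (core (fst_family S R) I \<times> core (snd_family S R) J)"
      by (simp add: card_cartesian_product)
    then show "real (card (I \<times> J)) \<le> 4 * real (card (core (fst_family S R) I \<times> core (snd_family S R) J))"
      by linarith
  qed simp
qed simp

text \<open>\<open>C\<close> lists the n rectangles through the point (x, y) by width. If
  \<open>R\<close> has rank j, counted from the widest, the narrower ones cross it bottom to top and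
  the wider ones left to right, so the two depths are n + 1 - j and j.\<close>

lemma depth_chain:
  assumes S: "selected S" and R: "R \<in> S" and x: "x \<in> fst R" and y: "y \<in> snd R"
  defines "C \<equiv> fst ` {T\<in>S. x \<in> fst T \<and> y \<in> snd T}"
  shows "depth (fst_family S R) x = Suc (card C) - card {I\<in>C. fst R \<subseteq> I}"
    and "depth (snd_family S R) y = card {I\<in>C. fst R \<subseteq> I}"
    and "finite C" "\<And>I J. I \<in> C \<Longrightarrow> J \<in> C \<Longrightarrow> I \<subseteq> J \<or> J \<subseteq> I"
    and "inj_on fst {T\<in>S. x \<in> fst T \<and> y \<in> snd T}"
proof -
  have S': "finite S" "S \<subseteq> \<I> \<times> \<J>" "antichain S" using S by (auto simp: selected_def)
  let ?Z = "{T\<in>S. x \<in> fst T \<and> y \<in> snd T}"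
  show finC: "finite C" using S' by (simp add: C_def)
  show inj: "inj_on fst ?Z"
    using inj_on_subset[OF antichain_inj_on[OF lam S'(2,3) ne(1), of "{y}"], of ?Z] by auto
  have iff: "fst T \<subseteq> fst T' \<longleftrightarrow> snd T' \<subseteq> snd T" if "T \<in> ?Z" "T' \<in> ?Z" for T T'
    using antichain_fst_subset_iff[OF lam S'(2,3), of T T'] that by blast
  show chain: "I \<subseteq> J \<or> J \<subseteq> I" if "I \<in> C" "J \<in> C" for I J
  proof -
    from that have "I \<in> \<I>" "J \<in> \<I>" "x \<in> I" "x \<in> J" using S'(2) by (auto simp: C_def)
    then show ?thesis using laminarD[OF lam(1)] by blast
  qed
  have RZ: "R \<in> ?Z" using R x y by auto
  have "{I\<in>fst_family S R. x \<in> I} = {I\<in>C. I \<subseteq> fst R}"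
  proof
    show "{I\<in>fst_family S R. x \<in> I} \<subseteq> {I\<in>C. I \<subseteq> fst R}"
      using y by (auto simp: fst_family_def C_def)
    show "{I\<in>C. I \<subseteq> fst R} \<subseteq> {I\<in>fst_family S R. x \<in> I}"
    proof
      fix I assume "I \<in> {I\<in>C. I \<subseteq> fst R}"
      then obtain T where T: "T \<in> ?Z" "I = fst T" "fst T \<subseteq> fst R" by (auto simp: C_def)
      then have "snd R \<subseteq> snd T" using iff[OF T(1) RZ] by simp
      then show "I \<in> {I\<in>fst_family S R. x \<in> I}" using T by (auto simp: fst_family_def)
    qed
  qed
  then have d1: "depth (fst_family S R) x = card {I\<in>C. I \<subseteq> fst R}" by (simp add: depth_def)
  have fR: "fst R \<in> C" using RZ by (auto simp: C_def)
  \<comment> \<open>\<open>R\<close> is counted in both halves of the chain; this accounts for the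
    \<open>Suc\<close>.\<close>
  have "{I\<in>C. I \<subseteq> fst R} \<union> {I\<in>C. fst R \<subseteq> I} = C" "{I\<in>C. I \<subseteq> fst R} \<inter> {I\<in>C. fst R \<subseteq> I} = {fst R}"
    using chain fR by auto
  then have "card C + 1 = card {I\<in>C. I \<subseteq> fst R} + card {I\<in>C. fst R \<subseteq> I}"
    using card_Un_Int[of "{I\<in>C. I \<subseteq> fst R}" "{I\<in>C. fst R \<subseteq> I}"] finC by simp
  then show "depth (fst_family S R) x = Suc (card C) - card {I\<in>C. fst R \<subseteq> I}" using d1 by simp
  have "{J\<in>snd_family S R. y \<in> J} = snd ` {T\<in>?Z. fst R \<subseteq> fst T}"
  proof
    show "{J\<in>snd_family S R. y \<in> J} \<subseteq> snd ` {T\<in>?Z. fst R \<subseteq> fst T}"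
      using x by (auto simp: snd_family_def)
    show "snd ` {T\<in>?Z. fst R \<subseteq> fst T} \<subseteq> {J\<in>snd_family S R. y \<in> J}"
    proof
      fix J assume "J \<in> snd ` {T\<in>?Z. fst R \<subseteq> fst T}"
      then obtain T where T: "T \<in> ?Z" "fst R \<subseteq> fst T" "J = snd T" by auto
      then show "J \<in> {J\<in>snd_family S R. y \<in> J}" using iff[OF RZ T(1)] by (auto simp: snd_family_def)
    qed
  qed
  moreover have "inj_on snd {T\<in>?Z. fst R \<subseteq> fst T}"
  proof (rule inj_onI)
    fix T T' assume *: "T \<in> {T\<in>?Z. fst R \<subseteq> fst T}" "T' \<in> {T\<in>?Z. fst R \<subseteq> fst T}" "snd T = snd T'"
    then have "fst T = fst T'" using iff[of T T'] iff[of T' T] by auto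
    then show "T = T'" using * by (auto simp: prod_eq_iff)
  qed
  moreover have "{I\<in>C. fst R \<subseteq> I} = fst ` {T\<in>?Z. fst R \<subseteq> fst T}" by (auto simp: C_def)
  moreover have "inj_on fst {T\<in>?Z. fst R \<subseteq> fst T}" using inj by (rule inj_on_subset) auto
  ultimately show "depth (snd_family S R) y = card {I\<in>C. fst R \<subseteq> I}"
    by (simp add: depth_def card_image)
qed

text \<open>\<open>average_powr_bound\<close> is applied to each selected rectangle with its own
  weight, and the resulting bounds are added; the sum of the weights at a point is the reciprocal
  root sum along its chain.\<close>

lemma selected_weak_bound:
  assumes S: "selected S" and f: "\<And>z. 0 \<le> f z" and t: "0 \<le> t"
    and avg: "\<And>R. R \<in> S \<Longrightarrow> t * real (card (rect R)) \<le> sum f (rect R)"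
    and Z: "finite Z" "(\<Union>R\<in>S. rect R) \<subseteq> Z" and m: "1 / (2 * (p - 1)) \<le> real m"
  shows "t powr p * sum w (\<Union>R\<in>S. rect R)
    \<le> moment_const p m powr (p - 1) * K * (6 * sqrt (K powr (1 / (p - 1)))) * (\<Sum>z\<in>Z. f z powr p * \<sigma> z powr (1 - p))"
proof -
  define s where "s = K powr (1 / (p - 1))"
  have s: "0 < s" using K_ge_1 by (simp add: s_def)
  have S': "finite S" "S \<subseteq> \<I> \<times> \<J>" "antichain S" using S by (auto simp: selected_def)
  define D where "D R z = real (depth (fst_family S R) (fst z)) * real (depth (snd_family S R) (snd z))" for R z
  have D: "1 \<le> D R z" if "R \<in> S" "z \<in> rect R" for R z
  proof -
    have "fst R \<in> {I\<in>fst_family S R. fst z \<in> I}" "snd R \<in> {I\<in>snd_family S R. snd z \<in> I}"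
      using that by (auto simp: fst_family_def snd_family_def)
    moreover have "finite (fst_family S R)" "finite (snd_family S R)" using S' by (auto simp: fst_family_def snd_family_def)
    ultimately have "0 < depth (fst_family S R) (fst z)" "0 < depth (snd_family S R) (snd z)"
      unfolding depth_def by (auto simp: card_gt_0_iff)
    then have "1 \<le> depth (fst_family S R) (fst z) * depth (snd_family S R) (snd z)" by (simp add: Suc_le_eq)
    then have "real 1 \<le> real (depth (fst_family S R) (fst z) * depth (snd_family S R) (snd z))" by (rule of_nat_mono)
    then show ?thesis by (simp add: D_def)
  qed
  \<comment> \<open>By \<open>depth_chain\<close>, \<open>D R z\<close> is j (n + 1 - j) for the
    rank j of \<open>R\<close> among the n members through \<open>z\<close>.\<close>
  define \<rho> where "\<rho> R z = sqrt s / sqrt (D R z)" for R z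
  have \<rho>pos: "0 < \<rho> R z" if "R \<in> S" "z \<in> rect R" for R z
    using D[OF that] s by (simp add: \<rho>_def)
  have single: "t powr p * sum w (rect R)
      \<le> moment_const p m powr (p - 1) * K * (\<Sum>z\<in>rect R. f z powr p * \<sigma> z powr (1 - p) * \<rho> R z)" if R: "R \<in> S" for R
  proof (rule average_powr_bound)
    show IJ: "fst R \<in> \<I>" "snd R \<in> \<J>" using R S' by auto
    show "0 \<le> f z" for z by (rule f)
    show "0 < \<rho> R z" if "z \<in> rect R" for z by (rule \<rho>pos[OF R that])
    show "0 \<le> moment_const p m" unfolding moment_const_def by (intro add_nonneg_nonneg mult_nonneg_nonneg) auto
    show "0 \<le> t" "t * real (card (rect R)) \<le> sum f (rect R)" using t avg[OF R] by auto
    \<comment> \<open>Moments are available for integer orders only, so the fractional power of D /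
      s is dominated by 1 when D / s is at most 1 and by the power of order \<open>m\<close>
      otherwise.\<close>
    have pt: "\<sigma> z * \<rho> R z powr (- (1 / (p - 1))) \<le> \<sigma> z + D R z ^ m * \<sigma> z / s ^ m" if z: "z \<in> rect R" for z
    proof -
      have D1: "0 < D R z / s" using D[OF R z] s by simp
      have "\<rho> R z = (D R z / s) powr (- (1 / 2))"
        unfolding \<rho>_def powr_minus powr_half_sqrt[OF less_imp_le[OF D1]] by (simp add: real_sqrt_divide)
      then have "\<rho> R z powr (- (1 / (p - 1))) = (D R z / s) powr (1 / (2 * (p - 1)))"
        by (simp add: powr_powr)
      also have "\<dots> \<le> 1 + (D R z / s) ^ m"
      proof (cases "D R z / s \<le> 1")
        case True
        then have "(D R z / s) powr (1 / (2 * (p - 1))) \<le> 1" using D1 p by (intro powr_le1) auto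
        then show ?thesis using D1 by (smt (verit) zero_le_power)
      next
        case False
        then have "(D R z / s) powr (1 / (2 * (p - 1))) \<le> (D R z / s) powr real m" using m by (intro powr_mono) auto
        then show ?thesis using D1 by (simp add: powr_realpow)
      qed
      finally have "\<sigma> z * \<rho> R z powr (- (1 / (p - 1))) \<le> \<sigma> z * (1 + (D R z / s) ^ m)"
        using pos(2)[of z] by (intro mult_left_mono) auto
      then show ?thesis by (simp add: algebra_simps power_divide)
    qed
    have "(\<Sum>z\<in>rect R. \<sigma> z * \<rho> R z powr (- (1 / (p - 1)))) \<le> (\<Sum>z\<in>rect R. \<sigma> z + D R z ^ m * \<sigma> z / s ^ m)"
      by (intro sum_mono pt)
    also have "\<dots> = sum \<sigma> (rect R) + (\<Sum>z\<in>rect R. D R z ^ m * \<sigma> z) / s ^ m"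
      by (simp add: sum.distrib sum_divide_distrib)
    also have "(\<Sum>z\<in>rect R. D R z ^ m * \<sigma> z) \<le> (fact m)\<^sup>2 * (s * 4 powr (p / (p - 1))) ^ m * sum \<sigma> (rect R)"
      using depth_moment_sigma[OF S, of R m] R S' unfolding D_def s_def by auto
    finally show "(\<Sum>z\<in>rect R. \<sigma> z * \<rho> R z powr (- (1 / (p - 1)))) \<le> moment_const p m * sum \<sigma> (rect R)"
      using s by (simp add: moment_const_def power_mult_distrib divide_right_mono algebra_simps)
  qed
  have fR: "finite (rect R)" if "R \<in> S" for R using that S' fin by auto
  \<comment> \<open>Along the chain through \<open>z\<close> the weights depend on the rank alone,
    so they can be summed by \<open>sum_rank_chain\<close>.\<close>
  have \<rho>sum: "(\<Sum>R\<in>S. if z \<in> rect R then \<rho> R z else 0) \<le> 6 * sqrt s" for z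
  proof -
    obtain x y where z: "z = (x, y)" by (cases z)
    let ?Z = "{T\<in>S. x \<in> fst T \<and> y \<in> snd T}"
    define C where "C = fst ` ?Z"
    define g where "g k = 1 / sqrt (real k * real (Suc (card C) - k))" for k
    have "(\<Sum>R\<in>S. if z \<in> rect R then \<rho> R z else 0) = (\<Sum>R\<in>?Z. \<rho> R z)"
      using S' by (subst sum.inter_filter[symmetric]) (auto simp: z mem_Times_iff)
    also have "\<dots> = (\<Sum>R\<in>?Z. sqrt s * g (card {I\<in>C. fst R \<subseteq> I}))"
    proof (rule sum.cong[OF refl])
      fix R assume R: "R \<in> ?Z"
      show "\<rho> R z = sqrt s * g (card {I\<in>C. fst R \<subseteq> I})"
        using depth_chain(1,2)[OF S, of R x y] R unfolding \<rho>_def D_def g_def C_def z by (simp add: mult.commute)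
    qed
    also have "\<dots> = sqrt s * (\<Sum>I\<in>C. g (card {I'\<in>C. I \<subseteq> I'}))"
    proof (cases "?Z = {}")
      case False
      then obtain R where "R \<in> ?Z" by blast
      then have "inj_on fst ?Z" using depth_chain(5)[OF S, of R x y] by auto
      then show ?thesis unfolding sum_distrib_left C_def by (simp add: sum.reindex)
    next
      case True
      then have "C = {}" by (simp add: C_def)
      then show ?thesis unfolding True by (simp only: sum.empty mult_zero_right)
    qed
    also have "(\<Sum>I\<in>C. g (card {I'\<in>C. I \<subseteq> I'})) = (\<Sum>k=1..card C. g k)"
    proof (rule sum_rank_chain)
      show "finite C" using S' by (simp add: C_def)
      show "I \<subseteq> J \<or> J \<subseteq> I" if "I \<in> C" "J \<in> C" for I J
      proof -
        from that have "I \<in> \<I>" "J \<in> \<I>" "x \<in> I" "x \<in> J" using S'(2) by (auto simp: C_def)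
        then show ?thesis using laminarD[OF lam(1)] by blast
      qed
    qed
    also have "\<dots> \<le> 6" unfolding g_def by (rule sum_reciprocal_sqrt_product)
    finally show ?thesis using s by (simp add: mult.commute)
  qed
  define \<phi> where "\<phi> z = f z powr p * \<sigma> z powr (1 - p)" for z
  have \<phi>0: "0 \<le> \<phi> z" for z by (simp add: \<phi>_def)
  have c0: "0 \<le> moment_const p m powr (p - 1) * K" using K_ge_1 by simp
  have "sum w (\<Union>R\<in>S. rect R) \<le> (\<Sum>R\<in>S. sum w (rect R))"
    using S' fR pos by (intro sum_UN_le) (auto simp: less_imp_le)
  then have "t powr p * sum w (\<Union>R\<in>S. rect R) \<le> (\<Sum>R\<in>S. t powr p * sum w (rect R))"
    unfolding sum_distrib_left[symmetric] by (intro mult_left_mono) auto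
  also have "\<dots> \<le> (\<Sum>R\<in>S. moment_const p m powr (p - 1) * K * (\<Sum>z\<in>rect R. \<phi> z * \<rho> R z))"
    unfolding \<phi>_def by (intro sum_mono single)
  also have "\<dots> = moment_const p m powr (p - 1) * K * (\<Sum>R\<in>S. \<Sum>z\<in>rect R. \<phi> z * \<rho> R z)"
    by (simp add: sum_distrib_left)
  also have "(\<Sum>R\<in>S. \<Sum>z\<in>rect R. \<phi> z * \<rho> R z) = (\<Sum>R\<in>S. \<Sum>z\<in>Z. \<phi> z * (if z \<in> rect R then \<rho> R z else 0))"
  proof (rule sum.cong[OF refl])
    fix R assume "R \<in> S"
    then have "rect R \<subseteq> Z" using Z by blast
    then have "(\<Sum>z\<in>rect R. \<phi> z * \<rho> R z) = (\<Sum>z\<in>{z\<in>Z. z \<in> rect R}. \<phi> z * \<rho> R z)" by (intro sum.cong) auto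
    also have "\<dots> = (\<Sum>z\<in>Z. if z \<in> rect R then \<phi> z * \<rho> R z else 0)" using Z(1) by (rule sum.inter_filter)
    also have "\<dots> = (\<Sum>z\<in>Z. \<phi> z * (if z \<in> rect R then \<rho> R z else 0))" by (intro sum.cong) auto
    finally show "(\<Sum>z\<in>rect R. \<phi> z * \<rho> R z) = (\<Sum>z\<in>Z. \<phi> z * (if z \<in> rect R then \<rho> R z else 0))" .
  qed
  also have "\<dots> = (\<Sum>z\<in>Z. \<phi> z * (\<Sum>R\<in>S. if z \<in> rect R then \<rho> R z else 0))"
    by (subst sum.swap) (simp add: sum_distrib_left)
  also have "\<dots> \<le> (\<Sum>z\<in>Z. \<phi> z * (6 * sqrt s))"
    by (intro sum_mono mult_left_mono \<rho>sum \<phi>0)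
  also have "\<dots> = 6 * sqrt s * (\<Sum>z\<in>Z. \<phi> z)" by (simp only: sum_distrib_right[symmetric] mult.commute)
  finally have "t powr p * sum w (\<Union>R\<in>S. rect R)
      \<le> moment_const p m powr (p - 1) * K * (6 * sqrt s * (\<Sum>z\<in>Z. \<phi> z))"
    using mult_left_mono[OF _ c0] by blast
  then show ?thesis by (simp only: s_def \<phi>_def mult.assoc)
qed

text \<open>A selected member either crosses \<open>R\<close> in one of the two ways or misses it.
  Half of \<open>R\<close> is thus at most the sum of two total overlaps, and by sparseness each of
  these is at most twice the area covered in its direction. If both proportions were below 1/8, the
  total would give 4/8 + 4/8 < 1.\<close>

lemma selection_covers:
  assumes F: "finite F" "F \<subseteq> \<I> \<times> \<J>" "antichain F" and S: "S \<subseteq> F" "selected S"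
    and cov: "\<And>R. R \<in> F \<Longrightarrow> R \<notin> S \<Longrightarrow>
      card (rect R) \<le> 2 * (\<Sum>T\<in>S. card (rect R \<inter> rect T))"
    and R: "R \<in> F" "R \<notin> S"
  shows "card (fst R) \<le> 8 * card (\<Union>(fst_family S R)) \<or> card (snd R) \<le> 8 * card (\<Union>(snd_family S R))"
proof (rule ccontr)
  assume neg: "\<not> ?thesis"
  let ?X = "{T\<in>S. snd R \<subseteq> snd T \<and> fst T \<subseteq> fst R}" and ?Y = "{T\<in>S. fst R \<subseteq> fst T \<and> snd T \<subseteq> snd R}"
  have S': "finite S" "S \<subseteq> \<I> \<times> \<J>" "antichain S" using S(2) by (auto simp: selected_def)
  have RIJ: "R \<in> \<I> \<times> \<J>" "fst R \<noteq> {}" "snd R \<noteq> {}" using R F ne by auto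
  note sp = sparse_families[OF S(2) RIJ(1)]
  have "(\<Sum>T\<in>S. card (rect R \<inter> rect T)) = (\<Sum>T\<in>?X \<union> ?Y. card (rect R \<inter> rect T))"
  proof (rule sum.mono_neutral_right)
    show "\<forall>T\<in>S - (?X \<union> ?Y). card (rect R \<inter> rect T) = 0"
    proof
      fix T assume T: "T \<in> S - (?X \<union> ?Y)"
      have "fst R \<inter> fst T = {} \<or> snd R \<inter> snd T = {}"
        using antichain_cross[OF lam F(2,3) R(1), of T] T S(1) by blast
      then show "card (rect R \<inter> rect T) = 0" by (auto simp: Times_Int_Times)
    qed
  qed (use S' in auto)
  also have "\<dots> \<le> (\<Sum>T\<in>?X. card (rect R \<inter> rect T)) + (\<Sum>T\<in>?Y. card (rect R \<inter> rect T))"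
    using S' sum.union_inter[of ?X ?Y "\<lambda>T. card (rect R \<inter> rect T)"] by simp
  also have "(\<Sum>T\<in>?X. card (rect R \<inter> rect T)) = (\<Sum>T\<in>?X. card (fst T) * card (snd R))"
    by (intro sum.cong refl) (auto simp: Times_Int_Times card_cartesian_product Int_absorb1 Int_absorb2)
  also have "\<dots> = (\<Sum>I\<in>fst_family S R. card I) * card (snd R)"
  proof -
    have "inj_on fst ?X"
      using inj_on_subset[OF antichain_inj_on[OF lam S'(2,3) ne(1) RIJ(3)], of ?X] by auto
    then show ?thesis by (simp add: fst_family_def sum.reindex sum_distrib_right)
  qed
  also have "(\<Sum>T\<in>?Y. card (rect R \<inter> rect T)) = (\<Sum>T\<in>?Y. card (fst R) * card (snd T))"
    by (intro sum.cong refl) (auto simp: Times_Int_Times card_cartesian_product Int_absorb1 Int_absorb2)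
  also have "\<dots> = card (fst R) * (\<Sum>J\<in>snd_family S R. card J)"
  proof -
    have "inj_on fst (prod.swap ` ?Y)"
      using inj_on_subset[OF antichain_inj_on[OF lam(2,1) _ antichain_swap[OF S'(3)] ne(2) RIJ(2)], of "prod.swap ` ?Y"] S'(2)
      by fastforce
    then have "inj_on snd ?Y" by (auto simp: inj_on_def)
    then show ?thesis by (simp add: snd_family_def sum.reindex sum_distrib_left)
  qed
  also have "(\<Sum>I\<in>fst_family S R. card I) * card (snd R) + card (fst R) * (\<Sum>J\<in>snd_family S R. card J)
     \<le> (2 * card (\<Union>(fst_family S R))) * card (snd R) + card (fst R) * (2 * card (\<Union>(snd_family S R)))"
    by (intro add_mono mult_le_mono sum_card_sparse sp order_refl)
  finally have "card (fst R) * card (snd R)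
      \<le> 4 * (card (\<Union>(fst_family S R)) * card (snd R)) + 4 * (card (fst R) * card (\<Union>(snd_family S R)))"
    using cov[OF R] by (simp add: card_cartesian_product)
  moreover have gt: "0 < card (fst R)" "0 < card (snd R)" using RIJ fin by (auto simp: card_gt_0_iff)
  have "8 * (card (\<Union>(fst_family S R)) * card (snd R)) < card (fst R) * card (snd R)"
    using neg gt(2) mult_strict_right_mono[of "8 * card (\<Union>(fst_family S R))" "card (fst R)" "card (snd R)"] by simp
  moreover have "8 * (card (fst R) * card (\<Union>(snd_family S R))) < card (fst R) * card (snd R)"
    using neg gt(1) mult_strict_left_mono[of "8 * card (\<Union>(snd_family S R))" "card (snd R)" "card (fst R)"] by simp
  ultimately show False by linarith
qed

text \<open>One factor \<open>K\<close> comes from covering the unselected rectangles along lines,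
  the other from the averages over the selected ones. The constant 18 is 3 * 6, with 6 from the
  reciprocal root sum.\<close>

lemma weak_pair:
  assumes F: "finite F" "F \<subseteq> \<I> \<times> \<J>" and f: "\<And>z. 0 \<le> f z" and t: "0 \<le> t"
    and avg: "\<And>R. R \<in> F \<Longrightarrow> t * real (card (rect R)) \<le> sum f (rect R)"
    and Z: "finite Z" "(\<Union>R\<in>F. rect R) \<subseteq> Z" and m: "1 / (2 * (p - 1)) \<le> real m"
  shows "t powr p * sum w (\<Union>R\<in>F. rect R)
    \<le> 18 * 8 powr p * moment_const p m powr (p - 1) * (K\<^sup>2 * sqrt (K powr (1 / (p - 1)))) * (\<Sum>z\<in>Z. f z powr p * \<sigma> z powr (1 - p))"
proof -
  obtain G where G: "G \<subseteq> F" "antichain G" "(\<Union>R\<in>G. rect R) = (\<Union>R\<in>F. rect R)"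
    by (rule antichain_reduction[OF F])
  have finG: "finite G" using G F finite_subset by blast
  have GIJ: "G \<subseteq> \<I> \<times> \<J>" using G F by auto
  obtain S where S: "S \<subseteq> G"
    "\<And>R. R \<in> S \<Longrightarrow> 2 * (\<Sum>T\<in>S - {R}. card (rect R \<inter> rect T)) \<le> card (rect R)"
    "\<And>R. R \<in> G \<Longrightarrow> R \<notin> S \<Longrightarrow> card (rect R) \<le> 2 * (\<Sum>T\<in>S. card (rect R \<inter> rect T))"
    using overlap_selection[OF finG, of rect] by (fastforce simp: Ball_def)
  have sel: "selected S"
    unfolding selected_def
  proof (intro conjI ballI S(2))
    show "finite S" using S(1) finG finite_subset by blast
    show "S \<subseteq> \<I> \<times> \<J>" using S(1) GIJ by blast
    show "antichain S" unfolding antichain_def using S(1) G(2)[unfolded antichain_def] by blast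
  qed
  define U where "U = (\<Union>R\<in>S. rect R)"
  have fR: "finite (fst R)" "finite (snd R)" if "R \<in> G" for R using that GIJ fin by auto
  have finU: "finite U" unfolding U_def using S(1) fR finG finite_subset[of S G] by auto
  define A where "A = {R\<in>G. card (fst R) \<le> 8 * card (\<Union>(fst_family S R))}"
  define B where "B = {R\<in>G. card (snd R) \<le> 8 * card (\<Union>(snd_family S R))}"
  interpret sw: ap_pair \<J> \<I> "w \<circ> prod.swap" "\<sigma> \<circ> prod.swap" p K by (rule swap)
  have A: "sum w (\<Union>R\<in>A. rect R) \<le> 8 powr p * K * sum w U"
  proof (rule fibre_cover_bound)
    show "finite A" "A \<subseteq> \<I> \<times> \<J>" using finG GIJ by (auto simp: A_def)
    fix R y assume R: "R \<in> A" "y \<in> snd R"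
    have "\<Union>(fst_family S R) \<subseteq> {x\<in>fst R. (x, y) \<in> U}"
      using R(2) by (force simp: fst_family_def U_def)
    then have "card (\<Union>(fst_family S R)) \<le> card {x\<in>fst R. (x, y) \<in> U}"
      using fR R by (intro card_mono) (auto simp: A_def)
    then have "card (fst R) \<le> 8 * card {x\<in>fst R. (x, y) \<in> U}" using R by (auto simp: A_def)
    then show "real (card (fst R)) \<le> 8 * real (card {x\<in>fst R. (x, y) \<in> U})" by linarith
  qed (use finU in auto)
  have B': "sum (w \<circ> prod.swap) (\<Union>R\<in>prod.swap ` B. rect R) \<le> 8 powr p * K * sum (w \<circ> prod.swap) (prod.swap ` U)"
  proof (rule sw.fibre_cover_bound)
    show "finite (prod.swap ` B)" "prod.swap ` B \<subseteq> \<J> \<times> \<I>" using finG GIJ by (auto simp: B_def)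
    fix R' x assume R': "R' \<in> prod.swap ` B" "x \<in> snd R'"
    then obtain R where R: "R \<in> B" "R' = prod.swap R" "x \<in> fst R" by auto
    have "\<Union>(snd_family S R) \<subseteq> {y\<in>snd R. (x, y) \<in> U}"
      using R(3) by (force simp: snd_family_def U_def)
    then have "card (\<Union>(snd_family S R)) \<le> card {y\<in>snd R. (x, y) \<in> U}"
      using fR R by (intro card_mono) (auto simp: B_def)
    then have "card (snd R) \<le> 8 * card {y\<in>snd R. (x, y) \<in> U}" using R by (auto simp: B_def)
    then have "card (fst R') \<le> 8 * card {y\<in>fst R'. (y, x) \<in> prod.swap ` U}" by (simp add: R(2))
    then show "real (card (fst R')) \<le> 8 * real (card {y\<in>fst R'. (y, x) \<in> prod.swap ` U})" by linarith
  qed (use finU in auto)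
  have "(\<Union>R\<in>prod.swap ` B. rect R) = prod.swap ` (\<Union>R\<in>B. rect R)"
    by (simp add: image_UN product_swap)
  then have B: "sum w (\<Union>R\<in>B. rect R) \<le> 8 powr p * K * sum w U"
    using B' by (simp add: sum.reindex)
  have w0: "0 \<le> w z" for z using pos(1)[of z] by simp
  have UF: "(\<Union>R\<in>F. rect R) \<subseteq> U \<union> ((\<Union>R\<in>A. rect R) \<union> (\<Union>R\<in>B. rect R))"
  proof -
    have "R \<in> S \<union> (A \<union> B)" if "R \<in> G" for R
      using selection_covers[OF finG GIJ G(2) S(1) sel S(3) that] that by (auto simp: A_def B_def)
    then show ?thesis unfolding G(3)[symmetric] U_def by blast
  qed
  have finAB: "finite (\<Union>R\<in>A. rect R)" "finite (\<Union>R\<in>B. rect R)"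
    using finG fR by (auto simp: A_def B_def)
  have un: "sum w (X \<union> Y) \<le> sum w X + sum w Y" if "finite X" "finite Y" for X Y
    using sum.union_inter[OF that, of w] sum_nonneg[of "X \<inter> Y" w] w0 by simp
  have "sum w (\<Union>R\<in>F. rect R) \<le> sum w (U \<union> ((\<Union>R\<in>A. rect R) \<union> (\<Union>R\<in>B. rect R)))"
    using finU finAB w0 by (intro sum_mono2 UF) auto
  also have "\<dots> \<le> sum w U + (sum w (\<Union>R\<in>A. rect R) + sum w (\<Union>R\<in>B. rect R))"
    using un[OF finU finite_UnI[OF finAB]] un[OF finAB] by linarith
  \<comment> \<open>Three pieces: the selected rectangles, those covered horizontally and those
    covered vertically.\<close>
  also have "\<dots> \<le> 3 * (8 powr p * K * sum w U)"
  proof -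
    have "1 * 1 \<le> 8 powr p * K" using K_ge_1 p by (intro mult_mono ge_one_powr_ge_zero) auto
    then have "sum w U \<le> 8 powr p * K * sum w U" using w0 mult_right_mono[of 1 "8 powr p * K" "sum w U"] by (simp add: sum_nonneg)
    then show ?thesis using A B by linarith
  qed
  finally have "t powr p * sum w (\<Union>R\<in>F. rect R) \<le> t powr p * (3 * (8 powr p * K * sum w U))"
    by (intro mult_left_mono) auto
  also have "\<dots> = 3 * (8 powr p * K) * (t powr p * sum w U)" by simp
  also have "t powr p * sum w U \<le> moment_const p m powr (p - 1) * K * (6 * sqrt (K powr (1 / (p - 1)))) * (\<Sum>z\<in>Z. f z powr p * \<sigma> z powr (1 - p))"
    unfolding U_def
  proof (rule selected_weak_bound[OF sel f t _ Z(1) _ m])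
    show "t * real (card (rect R)) \<le> sum f (rect R)" if "R \<in> S" for R
      using avg that S(1) G(1) by blast
    show "(\<Union>R\<in>S. rect R) \<subseteq> Z" using Z(2) S(1) G(1) by blast
  qed
  finally show ?thesis using K_ge_1 by (simp add: power2_eq_square mult_ac)
qed

end

section \<open>Reverse Hoelder inequality and interpolation\<close>

text \<open>\<open>D j x\<close> is the interval of generation \<open>j\<close> around
  \<open>x\<close>. Points are the intervals of generation 0, and cardinality plays the role of
  length.\<close>

locale dyadic =
  fixes D :: "nat \<Rightarrow> 'a \<Rightarrow> 'a set"
  assumes zero: "D 0 x = {x}"
    and card_D: "card (D j x) = 2 ^ j"
    and Suc_subset: "D j x \<subseteq> D (Suc j) x"
    and D_eq: "y \<in> D j x \<Longrightarrow> D j y = D j x"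
begin

lemma finite_D [simp]: "finite (D j x)"
  by (rule card_ge_0_finite) (simp add: card_D)

lemma D_mono: "i \<le> j \<Longrightarrow> D i x \<subseteq> D j x"
  by (induction j rule: dec_induct) (use Suc_subset in auto)

lemma self [simp]: "x \<in> D j x"
  using D_mono[of 0 j x] zero by auto

lemma nested: "D i x \<inter> D j y \<noteq> {} \<Longrightarrow> D i x \<subseteq> D j y \<or> D j y \<subseteq> D i x"
proof -
  assume "D i x \<inter> D j y \<noteq> {}"
  then obtain z where "D i z = D i x" "D j z = D j y" using D_eq by blast
  then show ?thesis using D_mono[of i j z] D_mono[of j i z] by (cases "i \<le> j") auto
qed

lemma laminar_D: "laminar {D j x | j x. True}"
  unfolding laminar_def using nested by blast

text \<open>A Calderon-Zygmund stopping argument with explicit constants. Stopped intervals have a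
  smaller level, so the bound itself, with the same factor 2, is available on them by
  induction.\<close>

lemma reverse_holder:
  fixes s :: "'a \<Rightarrow> real" and \<kappa> \<delta> :: real
  assumes s: "\<And>x. 0 < s x" and \<kappa>: "1 \<le> \<kappa>" and \<delta>: "0 \<le> \<delta>" "8 powr \<delta> * (1 - 1 / (2 * \<kappa>)) \<le> 1"
    and large: "\<And>j x E. E \<subseteq> D j x \<Longrightarrow> 2 ^ j \<le> 2 * real (card E) \<Longrightarrow> sum s (D j x) \<le> \<kappa> * sum s E"
  shows "(\<Sum>y\<in>D N x. s y powr (1 + \<delta>)) \<le> 2 * sum s (D N x) * (sum s (D N x) / 2 ^ N) powr \<delta>"
proof (induction N arbitrary: x rule: less_induct)
  case (less N)
  define I where "I = D N x"
  define S where "S = sum s I"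
  define a where "a = S / 2 ^ N"
  have S: "0 < S" unfolding S_def I_def using s card_D[of N x] by (intro sum_pos) (auto intro: ccontr)
  have a: "0 < a" using S by (simp add: a_def)
  \<comment> \<open>Stopping at four times the mean \<open>a\<close> confines the stopped intervals
    to a quarter of \<open>I\<close>, so the remaining set \<open>E\<close> is large enough for the
    hypothesis \<open>large\<close>.\<close>
  define C where "C = {D j y | j y. j < N \<and> y \<in> I \<and> 4 * a * 2 ^ j < sum s (D j y)}"
  have sub: "D j y \<subseteq> I" if "j \<le> N" "y \<in> I" for j y
    using D_mono[OF that(1), of y] D_eq[of y N x] that(2) by (simp add: I_def)
  have "C \<subseteq> Pow I" unfolding C_def using sub less_imp_le by blast
  then have finC: "finite C" using finite_subset[of C "Pow I"] by (simp add: I_def)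
  have lamC: "laminar C" by (rule laminar_subset[OF laminar_D]) (auto simp: C_def)
  obtain M where M: "M \<subseteq> C" "\<Union>M = \<Union>C" "\<And>P Q. P \<in> M \<Longrightarrow> Q \<in> M \<Longrightarrow> P \<noteq> Q \<Longrightarrow> P \<inter> Q = {}"
    "\<And>P Q. P \<in> M \<Longrightarrow> Q \<in> C \<Longrightarrow> P \<subseteq> Q \<Longrightarrow> P = Q"
    using laminar_maximal[OF finC lamC] by blast
  define U where "U = \<Union>M"
  define E where "E = I - U"
  have UI: "U \<subseteq> I" using \<open>C \<subseteq> Pow I\<close> M by (auto simp: U_def)
  have finM: "finite M" "\<And>Q. Q \<in> M \<Longrightarrow> finite Q"
  proof -
    show "finite M" using M(1) finC finite_subset by blast
    show "finite Q" if "Q \<in> M" for Q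
    proof (rule finite_subset)
      show "Q \<subseteq> I" using that M(1) \<open>C \<subseteq> Pow I\<close> by blast
      show "finite I" by (simp add: I_def)
    qed
  qed
  have sumU: "sum g U = (\<Sum>Q\<in>M. sum g Q)" for g :: "'a \<Rightarrow> real"
    unfolding U_def using sum.Union_disjoint[of M g] finM M(3) by auto
  have sumI: "sum g I = sum g E + sum g U" for g :: "'a \<Rightarrow> real"
    unfolding E_def using sum.subset_diff[OF UI, of g] by (simp add: I_def)
  have s0: "0 \<le> sum s A" for A using s by (simp add: sum_nonneg less_imp_le)
  have "4 * a * real (card U) \<le> sum s U"
  proof -
    have "4 * a * real (card Q) \<le> sum s Q" if "Q \<in> M" for Q
      using that M(1) by (force simp: C_def card_D)
    then have "(\<Sum>Q\<in>M. 4 * a * real (card Q)) \<le> (\<Sum>Q\<in>M. sum s Q)" by (rule sum_mono)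
    moreover have "(\<Sum>Q\<in>M. 4 * a * real (card Q)) = 4 * a * real (card U)"
      using sumU[of "\<lambda>_. 1"] by (simp add: sum_distrib_left)
    ultimately show ?thesis by (simp add: sumU)
  qed
  also have "\<dots> \<le> a * 2 ^ N" using sumI[of s] s0[of E] by (simp add: a_def S_def)
  finally have "4 * real (card U) \<le> 2 ^ N" using a by simp
  moreover have "real (card E) = 2 ^ N - real (card U)"
    using sumI[of "\<lambda>_. 1"] by (simp add: I_def card_D)
  ultimately have "2 ^ N \<le> 2 * real (card E)" by simp
  then have SE: "S \<le> \<kappa> * sum s E" unfolding S_def I_def by (intro large) (auto simp: E_def I_def)
  have E_le: "s y \<le> 4 * a" if "y \<in> E" for y
  proof (rule ccontr)
    assume *: "\<not> s y \<le> 4 * a"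
    have yI: "y \<in> I" using that by (simp add: E_def)
    show False
    proof (cases "N = 0")
      case True
      then have "y = x" using yI by (simp add: I_def zero)
      then show False using * True s[of x] by (simp add: a_def S_def I_def zero)
    next
      case False
      then have "D 0 y \<in> C" using yI * by (force simp: C_def zero)
      then have "y \<in> U" using M(2) by (auto simp: U_def zero)
      then show False using that by (simp add: E_def)
    qed
  qed
  \<comment> \<open>The bound 4 a on \<open>E\<close> is weakened to 8 a so that both parts carry
    the same factor.\<close>
  have "(\<Sum>y\<in>E. s y powr (1 + \<delta>)) \<le> (\<Sum>y\<in>E. s y * (8 * a) powr \<delta>)"
  proof (rule sum_mono)
    fix y assume "y \<in> E"
    then have "s y powr \<delta> \<le> (8 * a) powr \<delta>" using E_le[of y] s[of y] a \<delta> by (intro powr_mono2) auto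
    then show "s y powr (1 + \<delta>) \<le> s y * (8 * a) powr \<delta>" using s[of y] by (simp add: powr_add)
  qed
  then have partE: "(\<Sum>y\<in>E. s y powr (1 + \<delta>)) \<le> sum s E * (8 * a) powr \<delta>" by (simp add: sum_distrib_right)
  have "(\<Sum>y\<in>Q. s y powr (1 + \<delta>)) \<le> 2 * (8 * a) powr \<delta> * sum s Q" if Q: "Q \<in> M" for Q
  proof -
    obtain j y where jy: "Q = D j y" "j < N" "y \<in> I" using Q M(1) by (auto simp: C_def)
    \<comment> \<open>The parent of a maximal stopped interval is unstopped or all of
      \<open>I\<close>; halving the length at most doubles the mean, which gives 8 a.\<close>
    have "sum s Q \<le> sum s (D (Suc j) y)" unfolding jy(1) using Suc_subset s by (intro sum_mono2) (auto simp: less_imp_le)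
    also have "\<dots> \<le> 8 * a * 2 ^ j"
    proof (cases "Suc j < N")
      case True
      have "D (Suc j) y \<notin> C"
      proof
        assume "D (Suc j) y \<in> C"
        then have "D j y = D (Suc j) y" using M(4)[OF Q, of "D (Suc j) y"] jy(1) Suc_subset by blast
        then show False using card_D[of j y] card_D[of "Suc j" y] by simp
      qed
      then show ?thesis using True jy(3) by (force simp: C_def)
    next
      case False
      then have "Suc j = N" using jy(2) by simp
      moreover then have "D (Suc j) y = I" using jy(3) D_eq[of y N x] by (simp add: I_def)
      ultimately show ?thesis using S by (auto simp: a_def S_def)
    qed
    finally have "sum s Q / 2 ^ j \<le> 8 * a" by (simp add: divide_simps)
    then have "(sum s Q / 2 ^ j) powr \<delta> \<le> (8 * a) powr \<delta>" using \<delta> s0 by (intro powr_mono2) auto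
    then have "2 * sum s Q * (sum s Q / 2 ^ j) powr \<delta> \<le> 2 * sum s Q * (8 * a) powr \<delta>"
      using s0 by (intro mult_left_mono) auto
    then show ?thesis using less.IH[OF jy(2), of y] jy(1) by (simp add: mult_ac)
  qed
  then have "(\<Sum>Q\<in>M. \<Sum>y\<in>Q. s y powr (1 + \<delta>)) \<le> (\<Sum>Q\<in>M. 2 * (8 * a) powr \<delta> * sum s Q)" by (rule sum_mono)
  then have partU: "(\<Sum>y\<in>U. s y powr (1 + \<delta>)) \<le> 2 * (8 * a) powr \<delta> * sum s U"
    by (simp add: sumU sum_distrib_left)
  \<comment> \<open>\<open>E\<close> enters with factor 1 and \<open>U\<close> with factor 2, from
    the induction hypothesis. As \<open>E\<close> carries at least S / \<kappa>, the total is at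
    most (2 - 1/\<kappa>) S, and the assumption on \<delta> is what absorbs 8^\<delta>.\<close>
  have "S / \<kappa> \<le> sum s E" using SE \<kappa> by (simp add: divide_simps mult.commute)
  moreover have "S = sum s E + sum s U" using sumI[of s] by (simp add: S_def)
  ultimately have "sum s E + 2 * sum s U \<le> 2 * S - S / \<kappa>" by linarith
  moreover have "2 * S - S / \<kappa> = S * (2 - 1 / \<kappa>)" by (simp add: algebra_simps)
  ultimately have "sum s E + 2 * sum s U \<le> S * (2 - 1 / \<kappa>)" by simp
  then have "(sum s E + 2 * sum s U) * (8 * a) powr \<delta> \<le> S * (2 - 1 / \<kappa>) * (8 * a) powr \<delta>"
    by (intro mult_right_mono) auto
  also have "\<dots> = 2 * S * a powr \<delta> * (8 powr \<delta> * (1 - 1 / (2 * \<kappa>)))"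
    using a by (simp add: powr_mult algebra_simps)
  also have "\<dots> \<le> 2 * S * a powr \<delta> * 1" using S \<delta> by (intro mult_left_mono) auto
  finally have "(sum s E + 2 * sum s U) * (8 * a) powr \<delta> \<le> 2 * S * a powr \<delta>" by simp
  moreover have "(\<Sum>y\<in>I. s y powr (1 + \<delta>)) \<le> (sum s E + 2 * sum s U) * (8 * a) powr \<delta>"
    using partE partU by (simp add: sumI algebra_simps)
  ultimately show ?case by (simp add: I_def S_def a_def)
qed

end

section \<open>Interpolation from one truncated weak type bound\<close>

lemma sum_powr_ints_le:
  fixes \<eta> y :: real
  assumes \<eta>: "0 < \<eta>" and S: "finite S" "\<And>k. k \<in> S \<Longrightarrow> 2 powr real_of_int k \<le> y"
  shows "(\<Sum>k\<in>S. 2 powr (real_of_int k * \<eta>)) \<le> y powr \<eta> / (1 - 2 powr (- \<eta>))"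
proof (cases "S = {}")
  case False
  define a b where "a = Min S" and "b = Max S"
  have ab: "S \<subseteq> {a..b}" "a \<le> b" "b \<in> S" using False S by (auto simp: a_def b_def)
  have r: "0 < 1 - 2 powr (- \<eta>)" using \<eta> powr_less_one[of 2 "- \<eta>"] by simp
  have tel: "(1 - 2 powr (- \<eta>)) * (\<Sum>k\<in>{a..b}. 2 powr (real_of_int k * \<eta>)) \<le> 2 powr (real_of_int b * \<eta>)"
    if "a \<le> b" for a b :: int
    using that
  proof (induction b rule: int_ge_induct)
    case base
    then show ?case using r by (simp add: mult_left_le_one_le)
  next
    case (step b)
    have "{a..b + 1} = insert (b + 1) {a..b}" using step by auto
    moreover have "2 powr (- \<eta>) * 2 powr (real_of_int (b + 1) * \<eta>) = 2 powr (real_of_int b * \<eta>)"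
      by (simp add: powr_add[symmetric] algebra_simps)
    ultimately show ?case using step by (simp add: algebra_simps)
  qed
  have "(\<Sum>k\<in>S. 2 powr (real_of_int k * \<eta>)) \<le> (\<Sum>k\<in>{a..b}. 2 powr (real_of_int k * \<eta>))"
    using ab by (intro sum_mono2) auto
  also have "\<dots> \<le> 2 powr (real_of_int b * \<eta>) / (1 - 2 powr (- \<eta>))"
    using tel[OF ab(2)] r by (simp add: field_simps)
  also have "2 powr (real_of_int b * \<eta>) = (2 powr real_of_int b) powr \<eta>" by (simp add: powr_powr)
  also have "\<dots> \<le> y powr \<eta>" using S(2)[OF ab(3)] \<eta> by (intro powr_mono2) auto
  finally show ?thesis using r by (simp add: divide_right_mono)
qed (use powr_less_one[of 2 "- \<eta>"] \<eta> in simp)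

text \<open>The right-hand side of \<open>weak\<close> is already cut off at t / 2, so summing over
  dyadic t suffices. At a fixed \<open>z\<close> the admissible t form a geometric series with ratio
  2^(p-q), whose sum brings in the factor 1 / (p - q).\<close>

lemma marcinkiewicz_sum:
  fixes f g w v :: "'a \<Rightarrow> real"
  assumes pq: "0 < q" "q < p" and Z: "finite Z" and A: "0 \<le> A"
    and nn: "\<And>z. 0 \<le> f z" "\<And>z. 0 \<le> g z" "\<And>z. 0 \<le> w z" "\<And>z. 0 \<le> v z"
    and weak: "\<And>t. 0 < t \<Longrightarrow> t powr q * (\<Sum>z | z \<in> Z \<and> t < g z. w z) \<le> A * (\<Sum>z | z \<in> Z \<and> t / 2 < f z. f z powr q * v z)"
  shows "(\<Sum>z\<in>Z. g z powr p * w z) \<le> A * 2 powr (3 * p + 1) / (p - q) * (\<Sum>z\<in>Z. f z powr p * v z)"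
proof -
  \<comment> \<open>Chosen so that 2^(e z) < g z \<le> 2^(e z + 1); the strict lower end matches the
    strict superlevel sets of \<open>weak\<close>.\<close>
  define e where "e z = \<lceil>log 2 (g z)\<rceil> - 1" for z
  define S where "S = e ` {z\<in>Z. 0 < g z}"
  have finS: "finite S" using Z by (simp add: S_def)
  define \<eta> where "\<eta> = p - q"
  have \<eta>: "0 < \<eta>" using pq by (simp add: \<eta>_def)
  have r: "0 < 1 - 2 powr (- \<eta>)" using \<eta> powr_less_one[of 2 "- \<eta>"] by simp
  have pt: "g z powr p * w z \<le> (\<Sum>k\<in>S. 2 powr ((real_of_int k + 1) * p) * (if 2 powr real_of_int k < g z then w z else 0))"
    if z: "z \<in> Z" for z
  proof (cases "0 < g z")
    case True
    have "real_of_int (e z) < log 2 (g z)" "log 2 (g z) \<le> real_of_int (e z) + 1" unfolding e_def by linarith+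
    then have e: "2 powr real_of_int (e z) < g z" "g z \<le> 2 powr (real_of_int (e z) + 1)"
      using True by (auto simp: less_log_iff log_le_iff)
    have "g z powr p \<le> (2 powr (real_of_int (e z) + 1)) powr p" using e(2) True pq by (intro powr_mono2) auto
    then have "g z powr p * w z \<le> 2 powr ((real_of_int (e z) + 1) * p) * (if 2 powr real_of_int (e z) < g z then w z else 0)"
      using e(1) nn(3)[of z] by (simp add: powr_powr mult_right_mono)
    also have "\<dots> \<le> (\<Sum>k\<in>S. 2 powr ((real_of_int k + 1) * p) * (if 2 powr real_of_int k < g z then w z else 0))"
      using True z finS nn(3) by (intro member_le_sum[where f = "\<lambda>k. 2 powr ((real_of_int k + 1) * p) * (if 2 powr real_of_int k < g z then w z else 0)"]) (auto simp: S_def)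
    finally show ?thesis .
  next
    case False
    then have "g z = 0" using nn(2)[of z] by simp
    then show ?thesis using pq nn(3) by (simp add: sum_nonneg)
  qed
  have "(\<Sum>z\<in>Z. g z powr p * w z) \<le> (\<Sum>z\<in>Z. \<Sum>k\<in>S. 2 powr ((real_of_int k + 1) * p) * (if 2 powr real_of_int k < g z then w z else 0))"
    by (intro sum_mono pt)
  also have "\<dots> = (\<Sum>k\<in>S. 2 powr ((real_of_int k + 1) * p) * (\<Sum>z | z \<in> Z \<and> 2 powr real_of_int k < g z. w z))"
    by (subst sum.swap) (simp add: sum_distrib_left[symmetric] sum.inter_filter[OF Z])
  also have "\<dots> \<le> (\<Sum>k\<in>S. 2 powr ((real_of_int k + 1) * p) * (2 powr (- (real_of_int k * q)) * (A * (\<Sum>z | z \<in> Z \<and> 2 powr real_of_int k / 2 < f z. f z powr q * v z))))"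
  proof (intro sum_mono mult_left_mono)
    fix k
    let ?W = "\<Sum>z | z \<in> Z \<and> 2 powr real_of_int k < g z. w z"
    have "2 powr (- (real_of_int k * q)) * ((2 powr real_of_int k) powr q * ?W)
       \<le> 2 powr (- (real_of_int k * q)) * (A * (\<Sum>z | z \<in> Z \<and> 2 powr real_of_int k / 2 < f z. f z powr q * v z))"
      using weak[of "2 powr real_of_int k"] by (intro mult_left_mono) auto
    moreover have "2 powr (- (real_of_int k * q)) * ((2 powr real_of_int k) powr q * ?W) = ?W"
      by (simp add: powr_powr powr_minus field_simps)
    ultimately show "?W \<le> 2 powr (- (real_of_int k * q)) * (A * (\<Sum>z | z \<in> Z \<and> 2 powr real_of_int k / 2 < f z. f z powr q * v z))"
      by simp
  qed auto
  also have "\<dots> = (\<Sum>k\<in>S. \<Sum>z\<in>Z. A * 2 powr p * (f z powr q * v z) * (if 2 powr real_of_int k / 2 < f z then 2 powr (real_of_int k * \<eta>) else 0))"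
  proof (rule sum.cong[OF refl])
    fix k
    have e: "2 powr ((real_of_int k + 1) * p) * 2 powr (- (real_of_int k * q)) = 2 powr p * 2 powr (real_of_int k * \<eta>)"
      by (simp add: powr_add[symmetric] \<eta>_def algebra_simps)
    have "2 powr ((real_of_int k + 1) * p) * (2 powr (- (real_of_int k * q)) * (A * (\<Sum>z | z \<in> Z \<and> 2 powr real_of_int k / 2 < f z. f z powr q * v z)))
      = (2 powr ((real_of_int k + 1) * p) * 2 powr (- (real_of_int k * q))) * A * (\<Sum>z | z \<in> Z \<and> 2 powr real_of_int k / 2 < f z. f z powr q * v z)"
      by (simp only: mult.assoc)
    also have "\<dots> = 2 powr p * 2 powr (real_of_int k * \<eta>) * A * (\<Sum>z\<in>Z. if 2 powr real_of_int k / 2 < f z then f z powr q * v z else 0)"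
      unfolding e by (simp only: sum.inter_filter[OF Z])
    also have "\<dots> = (\<Sum>z\<in>Z. A * 2 powr p * (f z powr q * v z) * (if 2 powr real_of_int k / 2 < f z then 2 powr (real_of_int k * \<eta>) else 0))"
      unfolding sum_distrib_left by (intro sum.cong refl) (simp add: mult_ac)
    finally show "2 powr ((real_of_int k + 1) * p) * (2 powr (- (real_of_int k * q)) * (A * (\<Sum>z | z \<in> Z \<and> 2 powr real_of_int k / 2 < f z. f z powr q * v z)))
      = (\<Sum>z\<in>Z. A * 2 powr p * (f z powr q * v z) * (if 2 powr real_of_int k / 2 < f z then 2 powr (real_of_int k * \<eta>) else 0))" .
  qed
  also have "\<dots> = (\<Sum>z\<in>Z. A * 2 powr p * (f z powr q * v z) * (\<Sum>k | k \<in> S \<and> 2 powr real_of_int k / 2 < f z. 2 powr (real_of_int k * \<eta>)))"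
    by (subst sum.swap) (simp add: sum_distrib_left[symmetric] sum.inter_filter[OF finS])
  also have "\<dots> \<le> (\<Sum>z\<in>Z. A * 2 powr p * (f z powr q * v z) * ((2 * f z) powr \<eta> / (1 - 2 powr (- \<eta>))))"
  proof (intro sum_mono mult_left_mono sum_powr_ints_le \<eta>)
    show "finite {k \<in> S. 2 powr real_of_int k / 2 < f z}" for z using finS by simp
    show "0 \<le> A * 2 powr p * (f z powr q * v z)" for z using A nn by simp
  qed auto
  also have "\<dots> = A * 2 powr p * 2 powr \<eta> / (1 - 2 powr (- \<eta>)) * (\<Sum>z\<in>Z. f z powr p * v z)"
    unfolding sum_distrib_left
  proof (rule sum.cong[OF refl])
    fix z
    have "f z powr q * f z powr \<eta> = f z powr p" by (simp add: powr_add[symmetric] \<eta>_def)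
    then show "A * 2 powr p * (f z powr q * v z) * ((2 * f z) powr \<eta> / (1 - 2 powr - \<eta>)) = A * 2 powr p * 2 powr \<eta> / (1 - 2 powr - \<eta>) * (f z powr p * v z)"
      using nn(1)[of z] by (simp add: powr_mult mult_ac)
  qed
  also have "\<dots> \<le> A * 2 powr (3 * p + 1) / (p - q) * (\<Sum>z\<in>Z. f z powr p * v z)"
  proof (rule mult_right_mono)
    \<comment> \<open>Bounds the denominator of the geometric sum from below by a multiple of \<eta>
      = p - q, uniformly as q tends to p.\<close>
    have "\<eta> * ln 2 \<le> 2 powr \<eta> - 1" 
    proof -
      have "1 + \<eta> * ln 2 \<le> exp (\<eta> * ln 2)" by (rule exp_ge_add_one_self)
      then have "\<eta> * ln 2 \<le> exp (\<eta> * ln 2) - 1" by linarith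
      then show ?thesis by (simp add: powr_def)
    qed
    moreover have "1 / 2 \<le> ln (2::real)" using ln2_ge_two_thirds by linarith
    then have "\<eta> * (1 / 2) \<le> \<eta> * ln 2" using \<eta> by (intro mult_left_mono) auto
    ultimately have "\<eta> / 2 \<le> 2 powr \<eta> - 1" by simp
    then have "\<eta> / 2 * 2 powr (- \<eta>) \<le> (2 powr \<eta> - 1) * 2 powr (- \<eta>)" by (intro mult_right_mono) auto
    also have "\<dots> = 1 - 2 powr (- \<eta>)" by (simp add: algebra_simps powr_add[symmetric])
    finally have *: "\<eta> / 2 * 2 powr (- \<eta>) \<le> 1 - 2 powr (- \<eta>)" .
    have "A * 2 powr p * 2 powr \<eta> / (1 - 2 powr (- \<eta>)) \<le> A * 2 powr p * 2 powr \<eta> / (\<eta> / 2 * 2 powr (- \<eta>))"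
      using * \<eta> A r by (intro divide_left_mono) auto
    also have "\<dots> = A * 2 powr (p + \<eta> + \<eta> + 1) / \<eta>"
    proof -
      have "A * P * X / (\<eta> / 2 * inverse X) = A * (P * X * X * 2) / \<eta>" if "0 < X" for P X :: real
        using that \<eta> by (simp add: field_simps)
      from this[of "2 powr \<eta>" "2 powr p"] show ?thesis
        unfolding powr_add powr_minus by simp
    qed
    also have "\<dots> \<le> A * 2 powr (3 * p + 1) / \<eta>"
      using \<eta> A pq by (intro divide_right_mono mult_left_mono powr_mono) (auto simp: \<eta>_def)
    finally show "A * 2 powr p * 2 powr \<eta> / (1 - 2 powr (- \<eta>)) \<le> A * 2 powr (3 * p + 1) / (p - q)"
      by (simp add: \<eta>_def)
  qed (use nn in \<open>auto intro: sum_nonneg\<close>)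
  finally show ?thesis .
qed

section \<open>The dyadic maximal function over rectangles in a plane\<close>

definition pmax :: "(nat \<Rightarrow> 'a \<Rightarrow> 'a set) \<Rightarrow> (nat \<Rightarrow> 'b \<Rightarrow> 'b set) \<Rightarrow> nat \<Rightarrow> ('a \<times> 'b \<Rightarrow> real) \<Rightarrow> 'a \<times> 'b \<Rightarrow> real" where
  "pmax D1 D2 N f z = Max ((\<lambda>(j, k). sum f (D1 j (fst z) \<times> D2 k (snd z)) / 2 ^ (j + k)) ` ({..N} \<times> {..N}))"

lemma pmax_gt_iff:
  "t < pmax D1 D2 N f z \<longleftrightarrow> (\<exists>j\<le>N. \<exists>k\<le>N. t * 2 ^ (j + k) < sum f (D1 j (fst z) \<times> D2 k (snd z)))"
  unfolding pmax_def by (subst Max_gr_iff) (auto simp: pos_less_divide_eq)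

lemma pmax_nonneg:
  assumes "\<And>z. 0 \<le> f z"
  shows "0 \<le> pmax D1 D2 N f z"
proof -
  have "sum f (D1 0 (fst z) \<times> D2 0 (snd z)) / 2 ^ (0 + 0) \<le> pmax D1 D2 N f z"
    unfolding pmax_def by (rule Max_ge) force+
  moreover have "0 \<le> sum f (D1 0 (fst z) \<times> D2 0 (snd z))" using assms by (simp add: sum_nonneg)
  ultimately show ?thesis by simp
qed

text \<open>The weak bound is applied at the exponent \<open>q < p\<close> that the reverse Hoelder inequality for
  \<open>\<sigma>\<close> makes available; interpolation costs the factor \<open>1 / (p - q)\<close>, comparable to
  \<open>K powr (1 / (p - 1))\<close>.\<close>

definition strong_const :: "real \<Rightarrow> real" where
  "strong_const p =
    2 powr p * (18 * 8 powr p * (1 + (fact (nat \<lceil>1 / (p - 1)\<rceil>))\<^sup>2 * (4 powr (2 * p / (p - 1))) ^ nat \<lceil>1 / (p - 1)\<rceil>) powr p *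
      ((4 powr p)\<^sup>2 * sqrt ((4 powr p) powr (2 / (p - 1)) * exp 1)))
    * 2 powr (3 * p + 1) * (4 * ln 8 * 2 powr (p / (p - 1)) / (p - 1))"

locale dyadic_pair = d1: dyadic D1 + d2: dyadic D2 +
  ap_pair "{D1 j x | j x. True}" "{D2 j x | j x. True}" w \<sigma> p K
  for D1 :: "nat \<Rightarrow> 'a \<Rightarrow> 'a set" and D2 :: "nat \<Rightarrow> 'b \<Rightarrow> 'b set" and w \<sigma> p K
begin

text \<open>The superlevel set is covered by the rectangles that witness it. They stay in
  \<open>Z\<close>, since \<open>Z\<close> contains the cells of level \<open>N\<close> around its
  points.\<close>

lemma weak_pmax:
  assumes Z: "finite Z" "\<And>z. z \<in> Z \<Longrightarrow> D1 N (fst z) \<times> D2 N (snd z) \<subseteq> Z"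
    and f: "\<And>z. 0 \<le> f z" and t: "0 \<le> t" and m: "1 / (2 * (p - 1)) \<le> real m"
  shows "t powr p * (\<Sum>z | z \<in> Z \<and> t < pmax D1 D2 N f z. w z)
    \<le> 18 * 8 powr p * moment_const p m powr (p - 1) * (K\<^sup>2 * sqrt (K powr (1 / (p - 1)))) * (\<Sum>z\<in>Z. f z powr p * \<sigma> z powr (1 - p))"
proof -
  define F where "F = {(D1 j (fst z), D2 k (snd z)) | j k z. j \<le> N \<and> k \<le> N \<and> z \<in> Z \<and>
    t * 2 ^ (j + k) < sum f (D1 j (fst z) \<times> D2 k (snd z))}"
  have "F \<subseteq> (\<lambda>((j, k), z). (D1 j (fst z), D2 k (snd z))) ` (({..N} \<times> {..N}) \<times> Z)"
  proof
    fix R assume "R \<in> F"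
    then obtain j k z where "R = (D1 j (fst z), D2 k (snd z))" "j \<le> N" "k \<le> N" "z \<in> Z" by (auto simp: F_def)
    then show "R \<in> (\<lambda>((j, k), z). (D1 j (fst z), D2 k (snd z))) ` (({..N} \<times> {..N}) \<times> Z)"
      by (intro image_eqI[of _ _ "((j, k), z)"]) auto
  qed
  then have finF: "finite F" using Z(1) finite_subset by fastforce
  have FZ: "(\<Union>R\<in>F. rect R) \<subseteq> Z"
  proof -
    have "D1 j (fst z) \<times> D2 k (snd z) \<subseteq> Z" if "j \<le> N" "k \<le> N" "z \<in> Z" for j k z
      using d1.D_mono[OF that(1)] d2.D_mono[OF that(2)] Z(2)[OF that(3)] by blast
    then show ?thesis unfolding F_def by fastforce
  qed
  have "{z\<in>Z. t < pmax D1 D2 N f z} \<subseteq> (\<Union>R\<in>F. rect R)"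
  proof
    fix z assume "z \<in> {z\<in>Z. t < pmax D1 D2 N f z}"
    then obtain j k where "z \<in> Z" "j \<le> N" "k \<le> N" "t * 2 ^ (j + k) < sum f (D1 j (fst z) \<times> D2 k (snd z))"
      by (auto simp: pmax_gt_iff)
    then have "(D1 j (fst z), D2 k (snd z)) \<in> F" unfolding F_def by blast
    moreover have "z \<in> D1 j (fst z) \<times> D2 k (snd z)" by (cases z) simp
    ultimately show "z \<in> (\<Union>R\<in>F. rect R)" by force
  qed
  then have "(\<Sum>z | z \<in> Z \<and> t < pmax D1 D2 N f z. w z) \<le> sum w (\<Union>R\<in>F. rect R)"
    using finite_subset[OF FZ Z(1)] pos by (intro sum_mono2) (auto simp: less_imp_le)
  then have "t powr p * (\<Sum>z | z \<in> Z \<and> t < pmax D1 D2 N f z. w z) \<le> t powr p * sum w (\<Union>R\<in>F. rect R)"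
    by (intro mult_left_mono) auto
  also have "\<dots> \<le> 18 * 8 powr p * moment_const p m powr (p - 1) * (K\<^sup>2 * sqrt (K powr (1 / (p - 1)))) * (\<Sum>z\<in>Z. f z powr p * \<sigma> z powr (1 - p))"
  proof (rule weak_pair[OF finF _ f t _ Z(1) FZ m])
    show "F \<subseteq> {D1 j x | j x. True} \<times> {D2 j x | j x. True}" by (auto simp: F_def)
    show "t * real (card (rect R)) \<le> sum f (rect R)" if "R \<in> F" for R
      using that by (auto simp: F_def card_cartesian_product d1.card_D d2.card_D power_add)
  qed
  finally show ?thesis .
qed

text \<open>The one-parameter inequality is used twice: on every row, and then for the row sums
  along a column. Both times \<open>large\<close> is \<open>sigma_subset_bound\<close> with
  proportion 1/2, first for rectangles of height one and then for rectangles over the whole of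
  \<open>D1 j x\<close>. The constant is 4 = 2 * 2.\<close>

lemma reverse_holder_pair:
  assumes \<delta>: "0 \<le> \<delta>" "8 powr \<delta> * (1 - 1 / (2 * (K powr (1 / (p - 1)) * 2 powr (p / (p - 1))))) \<le> 1"
  shows "(\<Sum>z\<in>D1 j x \<times> D2 k y. \<sigma> z powr (1 + \<delta>))
    \<le> 4 * sum \<sigma> (D1 j x \<times> D2 k y) * (sum \<sigma> (D1 j x \<times> D2 k y) / 2 ^ (j + k)) powr \<delta>"
proof -
  define \<kappa> where "\<kappa> = K powr (1 / (p - 1)) * 2 powr (p / (p - 1))"
  have "1 * 1 \<le> \<kappa>" unfolding \<kappa>_def using K_ge_1 p by (intro mult_mono ge_one_powr_ge_zero) auto
  then have \<kappa>: "1 \<le> \<kappa>" by simp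
  have cart: "sum g (I \<times> J) = (\<Sum>v\<in>J. \<Sum>u\<in>I. g (u, v))" for g :: "'a \<times> 'b \<Rightarrow> real" and I J
    by (subst sum.swap) (simp add: sum.cartesian_product)
  define s where "s v = (\<Sum>u\<in>D1 j x. \<sigma> (u, v))" for v
  have spos: "0 < s v" for v
    unfolding s_def using pos d1.card_D[of j x] by (intro sum_pos) (auto intro: ccontr)
  have row: "(\<Sum>u\<in>D1 j x. \<sigma> (u, v) powr (1 + \<delta>)) \<le> 2 * s v * (s v / 2 ^ j) powr \<delta>" for v
    unfolding s_def
  proof (rule d1.reverse_holder[OF _ \<kappa> \<delta>(1) \<delta>(2)[folded \<kappa>_def]])
    show "0 < \<sigma> (u, v)" for u by (rule pos)
    fix i u E assume E: "E \<subseteq> D1 i u" "2 ^ i \<le> 2 * real (card E)"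
    have "sum \<sigma> (D1 i u \<times> {v}) \<le> K powr (1 / (p - 1)) * 2 powr (p / (p - 1)) * sum \<sigma> (E \<times> {v})"
    proof (rule sigma_subset_bound)
      show "{v} \<in> {D2 j x | j x. True}" using d2.zero[of v] by blast
      show "real (card (D1 i u \<times> {v})) \<le> 2 * real (card (E \<times> {v}))" using E by (simp add: card_cartesian_product d1.card_D)
    qed (use E in auto)
    then show "(\<Sum>u\<in>D1 i u. \<sigma> (u, v)) \<le> \<kappa> * (\<Sum>u\<in>E. \<sigma> (u, v))" by (simp add: \<kappa>_def cart)
  qed
  have col: "(\<Sum>v\<in>D2 k y. s v powr (1 + \<delta>)) \<le> 2 * sum s (D2 k y) * (sum s (D2 k y) / 2 ^ k) powr \<delta>"
  proof (rule d2.reverse_holder[OF spos \<kappa> \<delta>(1) \<delta>(2)[folded \<kappa>_def]])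
    fix i v E assume E: "E \<subseteq> D2 i v" "2 ^ i \<le> 2 * real (card E)"
    have "sum \<sigma> (D1 j x \<times> D2 i v) \<le> K powr (1 / (p - 1)) * 2 powr (p / (p - 1)) * sum \<sigma> (D1 j x \<times> E)"
    proof (rule sigma_subset_bound)
      show "real (card (D1 j x \<times> D2 i v)) \<le> 2 * real (card (D1 j x \<times> E))"
        using E by (simp add: card_cartesian_product d1.card_D d2.card_D)
    qed (use E in auto)
    then show "sum s (D2 i v) \<le> \<kappa> * sum s E" by (simp add: \<kappa>_def cart s_def)
  qed
  have tot: "sum s (D2 k y) = sum \<sigma> (D1 j x \<times> D2 k y)" by (simp add: cart s_def)
  have "(\<Sum>z\<in>D1 j x \<times> D2 k y. \<sigma> z powr (1 + \<delta>)) \<le> (\<Sum>v\<in>D2 k y. 2 * s v * (s v / 2 ^ j) powr \<delta>)"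
    unfolding cart by (intro sum_mono row)
  also have "\<dots> = 2 / (2 ^ j) powr \<delta> * (\<Sum>v\<in>D2 k y. s v powr (1 + \<delta>))"
    unfolding sum_distrib_left
    by (intro sum.cong refl) (use spos in \<open>simp add: powr_divide powr_add less_imp_le\<close>)
  also have "\<dots> \<le> 2 / (2 ^ j) powr \<delta> * (2 * sum s (D2 k y) * (sum s (D2 k y) / 2 ^ k) powr \<delta>)"
    by (intro mult_left_mono col) auto
  also have "\<dots> = 4 * sum s (D2 k y) * (sum s (D2 k y) / 2 ^ (j + k)) powr \<delta>"
    using spos by (simp add: powr_divide powr_mult power_add sum_nonneg less_imp_le)
  finally show ?thesis by (simp add: tot)
qed

text \<open>Openness of the A_p condition. With (1 + \<delta>) (q - 1) = p - 1 the new second weight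
  raised to q - 1 is \<sigma>^(p-1), so \<open>lower\<close> is unchanged, and the reverse Hoelder
  inequality gives \<open>upper\<close>.\<close>

lemma self_improved:
  assumes \<delta>: "0 \<le> \<delta>" "8 powr \<delta> * (1 - 1 / (2 * (K powr (1 / (p - 1)) * 2 powr (p / (p - 1))))) \<le> 1"
  defines "q \<equiv> 1 + (p - 1) / (1 + \<delta>)"
  shows "dyadic_pair D1 D2 w (\<lambda>z. \<sigma> z powr (1 + \<delta>)) q (4 powr (q - 1) * K)"
proof -
  have q: "1 < q" "(1 + \<delta>) * (q - 1) = p - 1" using p \<delta> by (auto simp: q_def)
  have eq: "(\<sigma> z powr (1 + \<delta>)) powr (q - 1) = \<sigma> z powr (p - 1)" for z using q by (simp add: powr_powr)
  have up: "sum w (I \<times> J) * (\<Sum>z\<in>I \<times> J. \<sigma> z powr (1 + \<delta>)) powr (q - 1) \<le> 4 powr (q - 1) * K * real (card (I \<times> J)) powr q"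
    if IJ: "I \<in> {D1 j x | j x. True}" "J \<in> {D2 j x | j x. True}" for I J
  proof -
    from IJ obtain j x k y where jk: "I = D1 j x" "J = D2 k y" by blast
    let ?n = "real (card (I \<times> J))"
    have n: "?n = 2 ^ (j + k)" by (simp add: jk card_cartesian_product d1.card_D d2.card_D power_add)
    have n0: "0 < ?n" by (simp add: n)
    let ?s = "sum \<sigma> (I \<times> J)"
    have s0: "0 \<le> ?s" using pos by (simp add: sum_nonneg less_imp_le)
    have w0: "0 \<le> sum w (I \<times> J)" using pos by (simp add: sum_nonneg less_imp_le)
    have "(\<Sum>z\<in>I \<times> J. \<sigma> z powr (1 + \<delta>)) \<le> 4 * ?s * (?s / ?n) powr \<delta>"
      unfolding n unfolding jk by (rule reverse_holder_pair[OF \<delta>])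
    then have "(\<Sum>z\<in>I \<times> J. \<sigma> z powr (1 + \<delta>)) powr (q - 1) \<le> (4 * ?s * (?s / ?n) powr \<delta>) powr (q - 1)"
      using q by (intro powr_mono2 sum_nonneg) auto
    also have "4 * ?s * (?s / ?n) powr \<delta> = 4 * ?s powr (1 + \<delta>) * ?n powr (- \<delta>)"
      using s0 n0 by (simp add: powr_divide powr_add powr_minus divide_simps)
    also have "(4 * ?s powr (1 + \<delta>) * ?n powr (- \<delta>)) powr (q - 1) = 4 powr (q - 1) * ?s powr (p - 1) * ?n powr (- (\<delta> * (q - 1)))"
      using s0 n0 q by (simp add: powr_mult powr_powr)
    finally have "sum w (I \<times> J) * (\<Sum>z\<in>I \<times> J. \<sigma> z powr (1 + \<delta>)) powr (q - 1)
       \<le> sum w (I \<times> J) * (4 powr (q - 1) * ?s powr (p - 1) * ?n powr (- (\<delta> * (q - 1))))"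
      using w0 by (intro mult_left_mono) auto
    also have "\<dots> = 4 powr (q - 1) * ?n powr (- (\<delta> * (q - 1))) * (sum w (I \<times> J) * ?s powr (p - 1))" by (simp add: mult_ac)
    also have "\<dots> \<le> 4 powr (q - 1) * ?n powr (- (\<delta> * (q - 1))) * (K * ?n powr p)"
      by (intro mult_left_mono upper IJ) auto
    also have "\<dots> = 4 powr (q - 1) * K * (?n powr (- (\<delta> * (q - 1))) * ?n powr p)" by (simp add: mult_ac)
    also have "?n powr (- (\<delta> * (q - 1))) * ?n powr p = ?n powr q"
    proof -
      have "- (\<delta> * (q - 1)) + p = q" using q(2) by (simp add: algebra_simps)
      then show ?thesis by (simp only: powr_add[symmetric])
    qed
    finally show ?thesis .
  qed
  show ?thesis
    by unfold_locales (use q lam fin ne sing pos lower up eq in \<open>auto simp: order_less_imp_not_eq2\<close>)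
qed

lemma strong_pmax:
  assumes Z: "finite Z" "\<And>z. z \<in> Z \<Longrightarrow> D1 N (fst z) \<times> D2 N (snd z) \<subseteq> Z"
    and f: "\<And>z. 0 \<le> f z"
  shows "(\<Sum>z\<in>Z. pmax D1 D2 N f z powr p * w z)
    \<le> strong_const p * (K\<^sup>2 * sqrt (K powr (1 / (p - 1))) * K powr (1 / (p - 1))) * (\<Sum>z\<in>Z. f z powr p * \<sigma> z powr (1 - p))"
proof -
  define S where "S = K powr (1 / (p - 1))"
  define \<kappa> where "\<kappa> = S * 2 powr (p / (p - 1))"
  \<comment> \<open>Makes 8^\<delta> equal to exp (1 / (2 \<kappa>)), which cancels against 1 - 1 /
    (2 \<kappa>) \<le> exp (- 1 / (2 \<kappa>)). Thus \<delta> is comparable to 1 / S.\<close>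
  define \<delta> where "\<delta> = 1 / (2 * \<kappa> * ln 8)"
  define q where "q = 1 + (p - 1) / (1 + \<delta>)"
  \<comment> \<open>Large enough for the exponent \<open>q\<close>, yet dependent on
    \<open>p\<close> only.\<close>
  define m where "m = nat \<lceil>1 / (p - 1)\<rceil>"
  have S: "1 \<le> S" using K_ge_1 p by (simp add: S_def ge_one_powr_ge_zero)
  have "1 * S \<le> 2 powr (p / (p - 1)) * S" using S p by (intro mult_right_mono ge_one_powr_ge_zero) auto
  then have "S \<le> \<kappa>" by (simp add: \<kappa>_def mult.commute)
  with S have \<kappa>: "S \<le> \<kappa>" "1 \<le> \<kappa>" by linarith+
  have ln8: "1 \<le> ln (8::real)"
    using ln_realpow[of "2::real" 3] ln2_ge_two_thirds by simp
  have "1 * 1 \<le> 2 * \<kappa> * ln 8" using \<kappa> ln8 by (intro mult_mono) auto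
  then have \<delta>: "0 < \<delta>" "\<delta> \<le> 1" using \<kappa> ln8 by (auto simp: \<delta>_def)
  have \<delta>S: "\<delta> * S \<le> 1"
  proof -
    have "S * 1 \<le> 2 * \<kappa> * ln 8" using \<kappa> ln8 S by (intro mult_mono) auto
    then show ?thesis using \<kappa> ln8 by (simp add: \<delta>_def divide_simps)
  qed
  have "8 powr \<delta> = exp (1 / (2 * \<kappa>))" using ln8 by (simp add: powr_def \<delta>_def)
  moreover have "1 - 1 / (2 * \<kappa>) \<le> exp (- (1 / (2 * \<kappa>)))"
  proof -
    have "1 + (- (1 / (2 * \<kappa>))) \<le> exp (- (1 / (2 * \<kappa>)))" by (rule exp_ge_add_one_self)
    then show ?thesis by simp
  qed
  ultimately have "8 powr \<delta> * (1 - 1 / (2 * \<kappa>)) \<le> exp (1 / (2 * \<kappa>)) * exp (- (1 / (2 * \<kappa>)))"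
    by (metis exp_ge_zero mult_left_mono)
  then have \<delta>8: "8 powr \<delta> * (1 - 1 / (2 * (K powr (1 / (p - 1)) * 2 powr (p / (p - 1))))) \<le> 1"
    by (simp add: exp_minus \<kappa>_def S_def)
  \<comment> \<open>As \<delta> is at most 1, q - 1 is at least half of p - 1; constants belonging
    to \<open>q\<close> are therefore bounded in terms of \<open>p\<close>.\<close>
  have q1: "(p - 1) / 2 \<le> q - 1" "q < p" "1 < q" "1 / (q - 1) = (1 + \<delta>) / (p - 1)"
  proof -
    have "(p - 1) / 2 \<le> (p - 1) / (1 + \<delta>)" using \<delta> p by (intro divide_left_mono) auto
    then show "(p - 1) / 2 \<le> q - 1" unfolding q_def by simp
    show "1 < q" using \<delta> p by (simp add: q_def)
    show "1 / (q - 1) = (1 + \<delta>) / (p - 1)" by (simp add: q_def)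
    have "(p - 1) / (1 + \<delta>) < (p - 1) / 1" using \<delta> p by (intro divide_strict_left_mono) auto
    then show "q < p" by (simp add: q_def)
  qed
  interpret Q: dyadic_pair D1 D2 w "\<lambda>z. \<sigma> z powr (1 + \<delta>)" q "4 powr (q - 1) * K"
    unfolding q_def by (rule self_improved[OF less_imp_le[OF \<delta>(1)] \<delta>8])
  have m: "1 / (2 * (q - 1)) \<le> real m"
  proof -
    have "1 / (2 * (q - 1)) \<le> 1 / (p - 1)" using q1 p by (intro divide_left_mono) auto
    also have "\<dots> \<le> real m" unfolding m_def by linarith
    finally show ?thesis .
  qed
  have s1: "(\<sigma> z powr (1 + \<delta>)) powr (1 - q) = \<sigma> z powr (1 - p)" for z
  proof -
    have "(1 + \<delta>) * (1 - q) = 1 - p" using \<delta> by (simp add: q_def field_simps)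
    then show ?thesis by (simp add: powr_powr)
  qed
  define A where "A = 2 powr q * (18 * 8 powr q * moment_const q m powr (q - 1) *
     ((4 powr (q - 1) * K)\<^sup>2 * sqrt ((4 powr (q - 1) * K) powr (1 / (q - 1)))))"
  have A0: "0 \<le> A" by (simp add: A_def)
  have w0: "0 \<le> w z" "0 \<le> \<sigma> z powr (1 - p)" for z using pos(1)[of z] by auto
  have weak: "t powr q * (\<Sum>z | z \<in> Z \<and> t < pmax D1 D2 N f z. w z)
      \<le> A * (\<Sum>z | z \<in> Z \<and> t / 2 < f z. f z powr q * \<sigma> z powr (1 - p))" if t: "0 < t" for t
  proof -
    \<comment> \<open>Dropping values up to t / 2 lowers every average by at most t / 2, so a
      superlevel set of \<open>f\<close> at t is one of \<open>g\<close> at t / 2. This supplies the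
      truncated bound needed for interpolation.\<close>
    define g where "g z = (if t / 2 < f z then f z else 0)" for z
    have "t / 2 < pmax D1 D2 N g z" if big: "t < pmax D1 D2 N f z" for z
    proof -
      from big obtain j k where jk: "j \<le> N" "k \<le> N" "t * 2 ^ (j + k) < sum f (D1 j (fst z) \<times> D2 k (snd z))"
        unfolding pmax_gt_iff by blast
      let ?R = "D1 j (fst z) \<times> D2 k (snd z)"
      have "sum f ?R \<le> (\<Sum>x\<in>?R. g x + t / 2)"
        using t by (intro sum_mono) (auto simp: g_def not_less)
      also have "\<dots> = sum g ?R + t / 2 * 2 ^ (j + k)"
        by (simp add: sum.distrib card_cartesian_product d1.card_D d2.card_D power_add)
      finally have "t / 2 * 2 ^ (j + k) < sum g ?R" using jk(3) by simp
      then show ?thesis using jk(1,2) unfolding pmax_gt_iff by blast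
    qed
    then have "(\<Sum>z | z \<in> Z \<and> t < pmax D1 D2 N f z. w z) \<le> (\<Sum>z | z \<in> Z \<and> t / 2 < pmax D1 D2 N g z. w z)"
      using Z(1) w0 by (intro sum_mono2) auto
    then have "(t / 2) powr q * (\<Sum>z | z \<in> Z \<and> t < pmax D1 D2 N f z. w z)
        \<le> (t / 2) powr q * (\<Sum>z | z \<in> Z \<and> t / 2 < pmax D1 D2 N g z. w z)" by (intro mult_left_mono) auto
    also have "\<dots> \<le> 18 * 8 powr q * moment_const q m powr (q - 1) * ((4 powr (q - 1) * K)\<^sup>2 * sqrt ((4 powr (q - 1) * K) powr (1 / (q - 1))))
        * (\<Sum>z\<in>Z. g z powr q * \<sigma> z powr (1 - p))"
      using Q.weak_pmax[OF Z _ _ m, of g "t / 2"] t f unfolding s1 by (simp add: g_def)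
    also have "(\<Sum>z\<in>Z. g z powr q * \<sigma> z powr (1 - p)) = (\<Sum>z | z \<in> Z \<and> t / 2 < f z. f z powr q * \<sigma> z powr (1 - p))"
      unfolding sum.inter_filter[OF Z(1)] by (intro sum.cong refl) (use q1 in \<open>auto simp: g_def\<close>)
    finally have "2 powr q * ((t / 2) powr q * (\<Sum>z | z \<in> Z \<and> t < pmax D1 D2 N f z. w z)) \<le> A * (\<Sum>z | z \<in> Z \<and> t / 2 < f z. f z powr q * \<sigma> z powr (1 - p))"
      unfolding A_def mult.assoc by (intro mult_left_mono) auto
    moreover have "2 powr q * (t / 2) powr q = t powr q" using t by (simp add: powr_divide)
    ultimately show ?thesis unfolding mult.assoc[symmetric] by simp
  qed
  have main: "(\<Sum>z\<in>Z. pmax D1 D2 N f z powr p * w z) \<le> A * 2 powr (3 * p + 1) / (p - q) * (\<Sum>z\<in>Z. f z powr p * \<sigma> z powr (1 - p))"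
    using q1 f w0 pmax_nonneg[of f] A0 by (intro marcinkiewicz_sum Z(1) weak) auto
  define B where "B = 1 + (fact m)\<^sup>2 * (4 powr (2 * p / (p - 1))) ^ m"
  have B: "moment_const q m \<le> B" "1 \<le> B" "0 \<le> moment_const q m"
  proof -
    have "q / (q - 1) \<le> p / ((p - 1) / 2)" using q1 p by (intro frac_le) auto
    then have "4 powr (q / (q - 1)) \<le> 4 powr (2 * p / (p - 1))" by (simp add: mult.commute)
    then show "moment_const q m \<le> B" unfolding moment_const_def B_def
      by (intro add_left_mono mult_left_mono power_mono) auto
    show "1 \<le> B" by (simp add: B_def)
    show "0 \<le> moment_const q m" unfolding moment_const_def by (intro add_nonneg_nonneg mult_nonneg_nonneg) auto
  qed
  have B': "moment_const q m powr (q - 1) \<le> B powr p"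
  proof -
    have "moment_const q m powr (q - 1) \<le> B powr (q - 1)" using B q1 by (intro powr_mono2) auto
    also have "\<dots> \<le> B powr p" using B q1 by (intro powr_mono) auto
    finally show ?thesis .
  qed
  have K4: "4 powr (q - 1) * K \<le> 4 powr p * K" using q1 K_ge_1 by (intro mult_right_mono powr_mono) auto
  \<comment> \<open>Passing from p to q turns the root S of \<open>K\<close> into S S^\<delta>, and
    S^\<delta> \<le> exp (\<delta> S) \<le> e by the size of \<delta>. So the sharper power of
    \<open>K\<close> survives.\<close>
  have "(4 powr (q - 1) * K) powr (1 / (q - 1)) \<le> (4 powr p * K) powr (1 / (q - 1))"
    using q1(3) K_ge_1 by (intro powr_mono2 K4) auto
  also have "\<dots> = (4 powr p) powr ((1 + \<delta>) / (p - 1)) * (S * S powr \<delta>)"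
    using K_ge_1 p unfolding q1(4) S_def by (simp add: powr_mult powr_powr powr_add[symmetric] add_divide_distrib)
  also have "\<dots> \<le> (4 powr p) powr (2 / (p - 1)) * (S * exp 1)"
  proof (intro mult_mono)
    show "(4 powr p) powr ((1 + \<delta>) / (p - 1)) \<le> (4 powr p) powr (2 / (p - 1))"
      using \<delta> p by (intro powr_mono divide_right_mono ge_one_powr_ge_zero) auto
    have "\<delta> * ln S \<le> \<delta> * S" using \<delta> S ln_le_minus_one[of S] by (intro mult_left_mono) auto
    then show "S powr \<delta> \<le> exp 1" using \<delta>S S by (simp add: powr_def)
  qed (use S in auto)
  finally have root: "(4 powr (q - 1) * K) powr (1 / (q - 1)) \<le> (4 powr p) powr (2 / (p - 1)) * exp 1 * S"
    by (simp add: mult_ac)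
  have A_le: "A \<le> 2 powr p * (18 * 8 powr p * B powr p * ((4 powr p * K)\<^sup>2 * sqrt ((4 powr p) powr (2 / (p - 1)) * exp 1 * S)))"
    unfolding A_def using q1 K_ge_1 p
    by (intro mult_mono powr_mono power_mono real_sqrt_le_mono B' K4 root) (auto intro!: mult_nonneg_nonneg)
  have pq: "1 / (p - q) \<le> 4 * ln 8 * 2 powr (p / (p - 1)) / (p - 1) * S"
  proof -
    have "p - q = (p - 1) * \<delta> / (1 + \<delta>)" using \<delta> by (simp add: q_def field_simps)
    then have "1 / (p - q) = (1 + \<delta>) / ((p - 1) * \<delta>)" by simp
    also have "\<dots> \<le> 2 / ((p - 1) * \<delta>)" using \<delta> p by (intro divide_right_mono) auto
    also have "\<dots> = 4 * ln 8 * 2 powr (p / (p - 1)) / (p - 1) * S"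
      by (simp add: \<delta>_def \<kappa>_def)
    finally show ?thesis .
  qed
  have "A * 2 powr (3 * p + 1) / (p - q) = A * 2 powr (3 * p + 1) * (1 / (p - q))" by simp
  also have "\<dots> \<le> 2 powr p * (18 * 8 powr p * B powr p * ((4 powr p * K)\<^sup>2 * sqrt ((4 powr p) powr (2 / (p - 1)) * exp 1 * S)))
      * 2 powr (3 * p + 1) * (4 * ln 8 * 2 powr (p / (p - 1)) / (p - 1) * S)"
    using A0 q1(2) S by (intro mult_mono A_le pq) (auto intro!: mult_nonneg_nonneg)
  also have "\<dots> = strong_const p * (K\<^sup>2 * sqrt S * S)"
    unfolding strong_const_def B_def m_def by (simp add: real_sqrt_mult power_mult_distrib mult_ac)
  finally have "A * 2 powr (3 * p + 1) / (p - q) * (\<Sum>z\<in>Z. f z powr p * \<sigma> z powr (1 - p))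
      \<le> strong_const p * (K\<^sup>2 * sqrt S * S) * (\<Sum>z\<in>Z. f z powr p * \<sigma> z powr (1 - p))"
    by (intro mult_right_mono sum_nonneg) auto
  then show ?thesis using main unfolding S_def by linarith
qed

end

section \<open>Composition over coordinates\<close>

definition weak_const :: "real \<Rightarrow> real" where
  "weak_const p = 18 * 8 powr p * moment_const p (nat \<lceil>1 / (2 * (p - 1))\<rceil>) powr (p - 1)"

lemma weak_const_nonneg: "0 \<le> weak_const p"
  by (simp add: weak_const_def)

lemma strong_const_nonneg: "1 < p \<Longrightarrow> 0 \<le> strong_const p"
  unfolding strong_const_def by (intro mult_nonneg_nonneg divide_nonneg_nonneg) auto

text \<open>Fubini in one coordinate without splitting the function space: exchanging
  \<open>x i\<close> with the new value \<open>u\<close> is an involution of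
  \<open>X \<times> Xs i\<close>.\<close>

lemma sum_fun_upd_average:
  fixes h :: "('n \<Rightarrow> 'a) \<Rightarrow> real"
  assumes "X = {x. \<forall>i. x i \<in> Xs i}"
  shows "(\<Sum>x\<in>X. \<Sum>u\<in>Xs i. h (x(i := u))) = real (card (Xs i)) * sum h X"
proof -
  have "(\<Sum>x\<in>X. \<Sum>u\<in>Xs i. h (x(i := u))) = (\<Sum>(x, u)\<in>X \<times> Xs i. h (x(i := u)))"
    by (simp add: sum.cartesian_product)
  also have "\<dots> = (\<Sum>(x, u)\<in>X \<times> Xs i. h x)"
    by (rule sum.reindex_bij_witness[of _ "\<lambda>(x, u). (x(i := u), x i)" "\<lambda>(x, u). (x(i := u), x i)"])
       (auto simp: assms)
  also have "\<dots> = (\<Sum>x\<in>X. \<Sum>u\<in>Xs i. h x)" by (simp only: sum.cartesian_product)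
  finally show ?thesis by (simp add: sum_distrib_left)
qed

lemma sum_slices_mono:
  fixes h g :: "('n \<Rightarrow> 'a) \<Rightarrow> real"
  assumes X: "X = {x. \<forall>i. x i \<in> Xs i}" and fin: "\<And>i. finite (Xs i)"
    and le: "\<And>x. x \<in> X \<Longrightarrow> (\<Sum>u\<in>Xs i. h (x(i := u))) \<le> c * (\<Sum>u\<in>Xs i. g (x(i := u)))"
  shows "sum h X \<le> c * sum g X"
proof (cases "Xs i = {}")
  case True
  then have "X = {}" unfolding X by blast
  then show ?thesis by simp
next
  case False
  have "(\<Sum>x\<in>X. \<Sum>u\<in>Xs i. h (x(i := u))) \<le> c * (\<Sum>x\<in>X. \<Sum>u\<in>Xs i. g (x(i := u)))"
  proof -
    have "(\<Sum>x\<in>X. \<Sum>u\<in>Xs i. h (x(i := u))) \<le> (\<Sum>x\<in>X. c * (\<Sum>u\<in>Xs i. g (x(i := u))))" by (intro sum_mono le)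
    then show ?thesis by (simp only: sum_distrib_left[symmetric])
  qed
  then have "real (card (Xs i)) * sum h X \<le> real (card (Xs i)) * (c * sum g X)"
    by (simp add: sum_fun_upd_average[OF X] mult_ac)
  moreover have "0 < real (card (Xs i))" using False fin by (simp add: card_gt_0_iff)
  ultimately show ?thesis by simp
qed

lemma sum_plane_slices_mono:
  fixes h g :: "('n \<Rightarrow> 'a) \<Rightarrow> real"
  assumes X: "X = {x. \<forall>i. x i \<in> Xs i}" and fin: "\<And>i. finite (Xs i)"
    and le: "\<And>x. x \<in> X \<Longrightarrow> (\<Sum>z\<in>Xs i \<times> Xs j. h (x(i := fst z, j := snd z))) \<le> c * (\<Sum>z\<in>Xs i \<times> Xs j. g (x(i := fst z, j := snd z)))"
  shows "sum h X \<le> c * sum g X"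
proof (cases "Xs j = {}")
  case True
  then have "X = {}" unfolding X by blast
  then show ?thesis by simp
next
  case False
  have "(\<Sum>x\<in>X. \<Sum>v\<in>Xs j. h (x(j := v))) \<le> c * (\<Sum>x\<in>X. \<Sum>v\<in>Xs j. g (x(j := v)))"
  proof (rule sum_slices_mono[OF X fin, where i = i])
    fix x assume "x \<in> X"
    then show "(\<Sum>u\<in>Xs i. \<Sum>v\<in>Xs j. h (x(i := u, j := v))) \<le> c * (\<Sum>u\<in>Xs i. \<Sum>v\<in>Xs j. g (x(i := u, j := v)))"
      using le[of x] by (simp add: sum.cartesian_product case_prod_unfold)
  qed
  then have "real (card (Xs j)) * sum h X \<le> real (card (Xs j)) * (c * sum g X)"
    by (simp add: sum_fun_upd_average[OF X] mult_ac)
  moreover have "0 < real (card (Xs j))" using False fin by (simp add: card_gt_0_iff)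
  ultimately show ?thesis by simp
qed

section \<open>Maximal functions over sets of coordinates\<close>

locale dyadic_grid =
  fixes D :: "'n::finite \<Rightarrow> nat \<Rightarrow> 'a \<Rightarrow> 'a set"
  assumes dyadic: "\<And>i. dyadic (D i)"
begin

definition box :: "('n \<Rightarrow> nat) \<Rightarrow> ('n \<Rightarrow> 'a) \<Rightarrow> ('n \<Rightarrow> 'a) set" where
  "box k x = {y. \<forall>i. y i \<in> D i (k i) (x i)}"

text \<open>Level 0 outside \<open>A\<close> makes the other sides singletons, so a maximal function
  over these levels averages in the coordinates of \<open>A\<close> and freezes the rest.\<close>

definition levels :: "'n set \<Rightarrow> nat \<Rightarrow> ('n \<Rightarrow> nat) set" where
  "levels A N = {k. (\<forall>i\<in>A. k i \<le> N) \<and> (\<forall>i. i \<notin> A \<longrightarrow> k i = 0)}"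

definition gmax :: "'n set \<Rightarrow> nat \<Rightarrow> (('n \<Rightarrow> 'a) \<Rightarrow> real) \<Rightarrow> ('n \<Rightarrow> 'a) \<Rightarrow> real" where
  "gmax A N f x = Max ((\<lambda>k. sum f (box k x) / real (card (box k x))) ` levels A N)"

lemma box_PiE: "box k x = Pi\<^sub>E UNIV (\<lambda>i. D i (k i) (x i))"
  by (auto simp: box_def PiE_def Pi_def extensional_def)

lemma finite_box [simp]: "finite (box k x)"
  unfolding box_PiE by (intro finite_PiE) (use dyadic in \<open>auto intro: dyadic.finite_D\<close>)

lemma card_box: "card (box k x) = (\<Prod>i\<in>UNIV. 2 ^ k i)"
  unfolding box_PiE by (subst card_PiE) (use dyadic in \<open>auto simp: dyadic.card_D\<close>)

lemma card_box_pos [simp]: "0 < card (box k x)"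
  by (simp add: card_box prod_pos)

lemma self_in_D: "u \<in> D i j u"
  using dyadic.self[OF dyadic] .

lemma D_0: "D i 0 u = {u}"
  using dyadic.zero[OF dyadic] .

lemma finite_levels [simp]: "finite (levels A N)"
proof (rule finite_subset)
  show "levels A N \<subseteq> Pi\<^sub>E UNIV (\<lambda>_. {..N})" by (force simp: levels_def PiE_def Pi_def extensional_def)
qed (intro finite_PiE, auto)

lemma zero_level: "(\<lambda>_. 0) \<in> levels A N"
  by (simp add: levels_def)

lemma gmax_ge: "k \<in> levels A N \<Longrightarrow> sum f (box k x) / real (card (box k x)) \<le> gmax A N f x"
  unfolding gmax_def by (rule Max_ge) auto

lemma gmax_le: "(\<And>k. k \<in> levels A N \<Longrightarrow> sum f (box k x) / real (card (box k x)) \<le> c) \<Longrightarrow> gmax A N f x \<le> c"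
  unfolding gmax_def using zero_level[of A N] by (subst Max_le_iff) auto

lemma gmax_gt_iff: "t < gmax A N f x \<longleftrightarrow> (\<exists>k\<in>levels A N. t * real (card (box k x)) < sum f (box k x))"
  unfolding gmax_def using zero_level[of A N] by (subst Max_gr_iff) (auto simp: pos_less_divide_eq)

lemma gmax_nonneg: "(\<And>x. 0 \<le> f x) \<Longrightarrow> 0 \<le> gmax A N f x"
  using gmax_ge[OF zero_level, of f x A N] by (meson divide_nonneg_nonneg of_nat_0_le_iff order_trans sum_nonneg)

lemma gmax_empty: "gmax {} N f x = f x"
proof -
  have "levels {} N = {\<lambda>_. 0}" by (auto simp: levels_def)
  moreover have "box (\<lambda>_. 0) x = {x}" by (auto simp: box_def D_0)
  ultimately show ?thesis by (simp add: gmax_def)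
qed

text \<open>A box in the coordinates of both sets is the disjoint union of equally large boxes in
  the coordinates of \<open>B\<close>, based at the points of a box in those of \<open>A\<close>. So
  its mean is a mean of means.\<close>

lemma gmax_Un_le:
  assumes AB: "A \<inter> B = {}"
  shows "gmax (A \<union> B) N f x \<le> gmax A N (gmax B N f) x"
proof (rule gmax_le)
  fix k assume k: "k \<in> levels (A \<union> B) N"
  define kA where "kA i = (if i \<in> A then k i else 0)" for i
  define kB where "kB i = (if i \<in> B then k i else 0)" for i
  have lev: "kA \<in> levels A N" "kB \<in> levels B N" using k by (auto simp: levels_def kA_def kB_def)
  have un: "box k x = (\<Union>y\<in>box kA x. box kB y)"
  proof (intro equalityI subsetI)
    fix z assume z: "z \<in> box k x"
    define y where "y i = (if i \<in> A then z i else x i)" for i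
    have "y \<in> box kA x" using z by (auto simp: box_def y_def kA_def self_in_D)
    moreover have "z \<in> box kB y"
      using z k AB by (auto simp: box_def y_def kB_def levels_def self_in_D) (metis D_0 Un_iff singletonD self_in_D)
    ultimately show "z \<in> (\<Union>y\<in>box kA x. box kB y)" by blast
  next
    fix z assume "z \<in> (\<Union>y\<in>box kA x. box kB y)"
    then obtain y where y: "\<And>i. y i \<in> D i (kA i) (x i)" "\<And>i. z i \<in> D i (kB i) (y i)" by (auto simp: box_def)
    have "z i \<in> D i (k i) (x i)" for i
    proof (cases "i \<in> A")
      case True
      then have "i \<notin> B" using AB by blast
      then show ?thesis using y(1)[of i] y(2)[of i] True by (simp add: kA_def kB_def D_0)
    next
      case False
      then have "y i = x i" using y(1)[of i] by (simp add: kA_def D_0)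
      moreover have "kB i = k i" using False k by (auto simp: kB_def levels_def)
      ultimately show ?thesis using y(2)[of i] by simp
    qed
    then show "z \<in> box k x" by (simp add: box_def)
  qed
  have dis: "box kB y \<inter> box kB y' = {}" if "y \<in> box kA x" "y' \<in> box kA x" "y \<noteq> y'" for y y'
  proof (rule ccontr)
    assume "box kB y \<inter> box kB y' \<noteq> {}"
    then obtain z where z: "\<And>i. z i \<in> D i (kB i) (y i)" "\<And>i. z i \<in> D i (kB i) (y' i)" by (auto simp: box_def)
    have "y i = y' i" for i
    proof (cases "i \<in> A")
      case True
      then have "i \<notin> B" using AB by blast
      then show ?thesis using z(1)[of i] z(2)[of i] by (simp add: kB_def D_0)
    next
      case False
      then show ?thesis using that(1,2) by (auto simp: box_def kA_def D_0 dest!: spec[of _ i])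
    qed
    then show False using that(3) by blast
  qed
  have sumk: "sum g (box k x) = (\<Sum>y\<in>box kA x. sum g (box kB y))" for g :: "('n \<Rightarrow> 'a) \<Rightarrow> real"
    unfolding un by (rule sum.UNION_disjoint) (use dis in auto)
  define c where "c = real (\<Prod>i\<in>UNIV. 2 ^ kB i)"
  have c: "real (card (box kB y)) = c" "0 < c" for y by (simp_all add: card_box c_def prod_pos)
  have "sum f (box k x) \<le> (\<Sum>y\<in>box kA x. c * gmax B N f y)"
    unfolding sumk
  proof (rule sum_mono)
    fix y
    have "sum f (box kB y) / c \<le> gmax B N f y" using gmax_ge[OF lev(2), of f y] by (simp add: c)
    then show "sum f (box kB y) \<le> c * gmax B N f y" using c(2) by (simp add: divide_simps mult.commute)
  qed
  also have "\<dots> = c * sum (gmax B N f) (box kA x)" by (simp add: sum_distrib_left)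
  finally have "sum f (box k x) / (real (card (box kA x)) * c) \<le> c * sum (gmax B N f) (box kA x) / (real (card (box kA x)) * c)"
    using c by (intro divide_right_mono) auto
  also have "\<dots> = sum (gmax B N f) (box kA x) / real (card (box kA x))" using c(2) by simp
  also have "\<dots> \<le> gmax A N (gmax B N f) x" by (rule gmax_ge[OF lev(1)])
  also have "real (card (box kA x)) * c = real (card (box k x))"
    using sumk[of "\<lambda>_. 1"] by (simp add: c)
  finally show "sum f (box k x) / real (card (box k x)) \<le> gmax A N (gmax B N f) x" .
qed

lemma box_pair:
  assumes "i \<noteq> j"
  shows "box ((\<lambda>_. 0)(i := a, j := b)) x = (\<lambda>z. x(i := fst z, j := snd z)) ` (D i a (x i) \<times> D j b (x j))"
proof (intro equalityI subsetI)
  fix y assume y: "y \<in> box ((\<lambda>_. 0)(i := a, j := b)) x"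
  have "y l = (x(i := y i, j := y j)) l" for l
    using y by (auto simp: box_def D_0 dest: spec[of _ l])
  then have "y = x(i := y i, j := y j)" by blast
  moreover have "y i \<in> D i a (x i)" using y assms unfolding box_def by (auto dest: spec[of _ i])
  moreover have "y j \<in> D j b (x j)" using y assms unfolding box_def by (auto dest: spec[of _ j])
  ultimately show "y \<in> (\<lambda>z. x(i := fst z, j := snd z)) ` (D i a (x i) \<times> D j b (x j))"
    by (intro image_eqI[of _ _ "(y i, y j)"]) auto
qed (use assms in \<open>auto simp: box_def D_0\<close>)

lemma inj_plane: "i \<noteq> j \<Longrightarrow> inj_on (\<lambda>z. x(i := fst z, j := snd z)) Z"
  by (rule inj_onI) (metis fun_upd_same fun_upd_twist prod_eqI)

lemma sum_box_pair:
  assumes "i \<noteq> j"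
  shows "sum g (box ((\<lambda>_. 0)(i := a, j := b)) x) = (\<Sum>z\<in>D i a (x i) \<times> D j b (x j). g (x(i := fst z, j := snd z)))"
  unfolding box_pair[OF assms] by (subst sum.reindex) (use inj_plane[OF assms] in auto)

lemma card_box_pair:
  assumes "i \<noteq> j"
  shows "card (box ((\<lambda>_. 0)(i := a, j := b)) x) = card (D i a (x i) \<times> D j b (x j))"
  unfolding box_pair[OF assms] by (rule card_image) (rule inj_plane[OF assms])

lemma levels_pair: "i \<noteq> j \<Longrightarrow> levels {i, j} N = (\<lambda>(a, b). (\<lambda>_. 0)(i := a, j := b)) ` ({..N} \<times> {..N})"
proof (intro equalityI subsetI)
  fix k assume ij: "i \<noteq> j" and k: "k \<in> levels {i, j} N"
  have "k = (\<lambda>_. 0)(i := k i, j := k j)" using k by (auto simp: levels_def fun_eq_iff)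
  then show "k \<in> (\<lambda>(a, b). (\<lambda>_. 0)(i := a, j := b)) ` ({..N} \<times> {..N})"
    using k by (intro image_eqI[of _ _ "(k i, k j)"]) (auto simp: levels_def)
qed (auto simp: levels_def)

lemma gmax_pair:
  assumes "i \<noteq> j"
  shows "gmax {i, j} N f (x(i := u, j := v)) = pmax (D i) (D j) N (\<lambda>z. f (x(i := fst z, j := snd z))) (u, v)"
proof -
  have upd: "x(i := u, j := v, i := a, j := b) = x(i := a, j := b)" for a b
    using assms by (auto simp: fun_eq_iff)
  show ?thesis
    unfolding gmax_def pmax_def levels_pair[OF assms] image_image case_prod_unfold
      sum_box_pair[OF assms] card_box_pair[OF assms]
    using assms by (simp add: upd card_cartesian_product dyadic.card_D[OF dyadic] power_add)
qed

end

section \<open>Weights on a grid and composition of the plane bounds\<close>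

locale ap_grid = dyadic_grid D for D :: "'n::finite \<Rightarrow> nat \<Rightarrow> 'a \<Rightarrow> 'a set" +
  fixes w \<sigma> :: "('n \<Rightarrow> 'a) \<Rightarrow> real" and p K :: real
  assumes p: "1 < p"
    and pos: "\<And>x. 0 < w x" "\<And>x. 0 < \<sigma> x"
    and lower: "\<And>x. 1 \<le> w x * \<sigma> x powr (p - 1)"
    and upper: "\<And>k x. sum w (box k x) * sum \<sigma> (box k x) powr (p - 1) \<le> K * real (card (box k x)) powr p"
begin

lemma box_0: "box (\<lambda>_. 0) x = {x}"
  by (auto simp: box_def D_0)

lemma K_ge_1: "1 \<le> K"
  using upper[of "\<lambda>_. 0" undefined] lower[of undefined] by (simp add: box_0)

lemma dual_le: "\<sigma> x powr (1 - p) \<le> w x"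
proof -
  have "\<sigma> x powr (1 - p) * 1 \<le> \<sigma> x powr (1 - p) * (w x * \<sigma> x powr (p - 1))"
    by (intro mult_left_mono lower) auto
  also have "\<dots> = w x * (\<sigma> x powr (1 - p) * \<sigma> x powr (p - 1))" by (simp add: mult_ac)
  also have "\<sigma> x powr (1 - p) * \<sigma> x powr (p - 1) = 1"
    using pos(2)[of x] by (simp add: powr_add[symmetric])
  finally show ?thesis by simp
qed

text \<open>A rectangle in a plane slice is a box with level 0 in all other coordinates, so the
  slice inherits the same constant \<open>K\<close>.\<close>

lemma plane_slice:
  assumes ij: "i \<noteq> j"
  shows "dyadic_pair (D i) (D j) (\<lambda>z. w (x(i := fst z, j := snd z))) (\<lambda>z. \<sigma> (x(i := fst z, j := snd z))) p K"
proof -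
  interpret d1: dyadic "D i" by (rule dyadic)
  interpret d2: dyadic "D j" by (rule dyadic)
  let ?I = "{D i a u | a u. True}" and ?J = "{D j b v | b v. True}"
  have up: "(\<Sum>z\<in>I \<times> J. w (x(i := fst z, j := snd z))) * (\<Sum>z\<in>I \<times> J. \<sigma> (x(i := fst z, j := snd z))) powr (p - 1)
      \<le> K * real (card (I \<times> J)) powr p" if IJ: "I \<in> ?I" "J \<in> ?J" for I J
  proof -
    from IJ obtain a u b v where *: "I = D i a u" "J = D j b v" by blast
    have upd: "x(i := u, j := v, i := c, j := d) = x(i := c, j := d)" for c d
      using ij by (auto simp: fun_eq_iff)
    show ?thesis
      using upper[of "(\<lambda>_. 0)(i := a, j := b)" "x(i := u, j := v)"]
      unfolding sum_box_pair[OF ij] card_box_pair[OF ij] * using ij by (simp add: upd)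
  qed
  have ne: "{} \<notin> ?I" "{} \<notin> ?J" using d1.self d2.self by blast+
  have sing: "{u} \<in> ?I" "{v} \<in> ?J" for u v using d1.zero[of u] d2.zero[of v] by blast+
  have fin: "finite I" if "I \<in> ?I" for I using that by auto
  have fin': "finite J" if "J \<in> ?J" for J using that by auto
  show ?thesis
    by (intro dyadic_pair.intro ap_pair.intro dyadic p d1.laminar_D d2.laminar_D fin fin' ne sing pos lower up)
qed

text \<open>A finite window containing the cells of level \<open>N\<close> around its points:
  maximal functions truncated at \<open>N\<close> then see only values inside the window.\<close>

context
  fixes Xs :: "'n \<Rightarrow> 'a set" and N :: nat and X :: "('n \<Rightarrow> 'a) set"
  assumes Xs: "\<And>i. finite (Xs i)" "\<And>i u. u \<in> Xs i \<Longrightarrow> D i N u \<subseteq> Xs i"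
  defines "X \<equiv> {x. \<forall>i. x i \<in> Xs i}"
begin

lemma X_eq: "X = {x. \<forall>i. x i \<in> Xs i}"
  by (simp add: X_def)

lemma finite_X: "finite X"
proof -
  have "X = Pi\<^sub>E UNIV Xs" by (auto simp: X_def PiE_def Pi_def extensional_def)
  then show ?thesis using Xs by (simp add: finite_PiE)
qed

lemma closed: "z \<in> Xs i \<times> Xs j \<Longrightarrow> D i N (fst z) \<times> D j N (snd z) \<subseteq> Xs i \<times> Xs j"
  using Xs(2)[of "fst z" i] Xs(2)[of "snd z" j] by (intro Sigma_mono) auto

lemma strong_plane:
  assumes ij: "i \<noteq> j" and f: "\<And>x. 0 \<le> f x"
  shows "(\<Sum>x\<in>X. gmax {i, j} N f x powr p * w x)
    \<le> strong_const p * (K\<^sup>2 * sqrt (K powr (1 / (p - 1))) * K powr (1 / (p - 1))) * (\<Sum>x\<in>X. f x powr p * \<sigma> x powr (1 - p))"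
proof (rule sum_plane_slices_mono[OF X_eq Xs(1), where i = i and j = j])
  fix x
  interpret S: dyadic_pair "D i" "D j" "\<lambda>z. w (x(i := fst z, j := snd z))" "\<lambda>z. \<sigma> (x(i := fst z, j := snd z))" p K
    by (rule plane_slice[OF ij])
  have "(\<Sum>z\<in>Xs i \<times> Xs j. pmax (D i) (D j) N (\<lambda>z. f (x(i := fst z, j := snd z))) z powr p * w (x(i := fst z, j := snd z)))
    \<le> strong_const p * (K\<^sup>2 * sqrt (K powr (1 / (p - 1))) * K powr (1 / (p - 1)))
      * (\<Sum>z\<in>Xs i \<times> Xs j. f (x(i := fst z, j := snd z)) powr p * \<sigma> (x(i := fst z, j := snd z)) powr (1 - p))"
    using Xs f by (intro S.strong_pmax closed) auto
  then show "(\<Sum>z\<in>Xs i \<times> Xs j. gmax {i, j} N f (x(i := fst z, j := snd z)) powr p * w (x(i := fst z, j := snd z)))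
    \<le> strong_const p * (K\<^sup>2 * sqrt (K powr (1 / (p - 1))) * K powr (1 / (p - 1)))
      * (\<Sum>z\<in>Xs i \<times> Xs j. f (x(i := fst z, j := snd z)) powr p * \<sigma> (x(i := fst z, j := snd z)) powr (1 - p))"
    by (simp add: gmax_pair[OF ij])
qed

lemma weak_plane:
  assumes ij: "i \<noteq> j" and f: "\<And>x. 0 \<le> f x" and t: "0 \<le> t"
  shows "t powr p * (\<Sum>x | x \<in> X \<and> t < gmax {i, j} N f x. w x)
    \<le> weak_const p * (K\<^sup>2 * sqrt (K powr (1 / (p - 1)))) * (\<Sum>x\<in>X. f x powr p * \<sigma> x powr (1 - p))"
proof -
  have "(\<Sum>x\<in>X. t powr p * (if t < gmax {i, j} N f x then w x else 0))
    \<le> weak_const p * (K\<^sup>2 * sqrt (K powr (1 / (p - 1)))) * (\<Sum>x\<in>X. f x powr p * \<sigma> x powr (1 - p))"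
  proof (rule sum_plane_slices_mono[OF X_eq Xs(1), where i = i and j = j])
    fix x
    interpret S: dyadic_pair "D i" "D j" "\<lambda>z. w (x(i := fst z, j := snd z))" "\<lambda>z. \<sigma> (x(i := fst z, j := snd z))" p K
      by (rule plane_slice[OF ij])
    let ?Z = "Xs i \<times> Xs j"
    have finZ: "finite ?Z" using Xs by simp
    have "1 / (2 * (p - 1)) \<le> real (nat \<lceil>1 / (2 * (p - 1))\<rceil>)" by linarith
    then have "t powr p * (\<Sum>z | z \<in> ?Z \<and> t < pmax (D i) (D j) N (\<lambda>z. f (x(i := fst z, j := snd z))) z. w (x(i := fst z, j := snd z)))
      \<le> weak_const p * (K\<^sup>2 * sqrt (K powr (1 / (p - 1))))
        * (\<Sum>z\<in>?Z. f (x(i := fst z, j := snd z)) powr p * \<sigma> (x(i := fst z, j := snd z)) powr (1 - p))"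
      unfolding weak_const_def using Xs f t finZ by (intro S.weak_pmax closed) auto
    then show "(\<Sum>z\<in>?Z. t powr p * (if t < gmax {i, j} N f (x(i := fst z, j := snd z)) then w (x(i := fst z, j := snd z)) else 0))
      \<le> weak_const p * (K\<^sup>2 * sqrt (K powr (1 / (p - 1))))
        * (\<Sum>z\<in>?Z. f (x(i := fst z, j := snd z)) powr p * \<sigma> (x(i := fst z, j := snd z)) powr (1 - p))"
      by (simp add: gmax_pair[OF ij] sum.inter_filter[OF finZ] sum_distrib_left[symmetric])
  qed
  then show ?thesis by (simp add: sum.inter_filter[OF finite_X] sum_distrib_left[symmetric])
qed

text \<open>On a line the maximal intervals are disjoint, so Hoelder and the A_p condition on each
  of them give exactly one factor \<open>K\<close>.\<close>

lemma weak_line: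
  assumes f: "\<And>x. 0 \<le> f x" and t: "0 \<le> t"
  shows "t powr p * (\<Sum>x | x \<in> X \<and> t < gmax {i} N f x. w x) \<le> K * (\<Sum>x\<in>X. f x powr p * \<sigma> x powr (1 - p))"
proof -
  interpret d: dyadic "D i" by (rule dyadic)
  have "(\<Sum>x\<in>X. t powr p * (if t < gmax {i} N f x then w x else 0)) \<le> K * (\<Sum>x\<in>X. f x powr p * \<sigma> x powr (1 - p))"
  proof (rule sum_slices_mono[OF X_eq Xs(1), where i = i])
    fix x
    define F where "F u = f (x(i := u))" for u
    define W where "W u = w (x(i := u))" for u
    define \<Sigma> where "\<Sigma> u = \<sigma> (x(i := u))" for u
    have W0: "0 < W u" "0 < \<Sigma> u" "0 \<le> F u" for u using pos f by (auto simp: W_def \<Sigma>_def F_def)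
    have boxi: "box ((\<lambda>_. 0)(i := a)) (x(i := u)) = (\<lambda>v. x(i := v)) ` D i a u" for a u
    proof (intro equalityI subsetI)
      fix y assume y: "y \<in> box ((\<lambda>_. 0)(i := a)) (x(i := u))"
      have "y l = (x(i := y i)) l" for l
        using y by (auto simp: box_def D_0 dest: spec[of _ l])
      then have "y = x(i := y i)" by blast
      moreover have "y i \<in> D i a u" using y unfolding box_def by (auto dest: spec[of _ i])
      ultimately show "y \<in> (\<lambda>v. x(i := v)) ` D i a u" by blast
    qed (auto simp: box_def D_0)
    have inj: "inj_on (\<lambda>v. x(i := v)) Z" for Z by (rule inj_onI) (metis fun_upd_same)
    have sumi: "sum g (box ((\<lambda>_. 0)(i := a)) (x(i := u))) = (\<Sum>v\<in>D i a u. g (x(i := v)))" for g :: "('n \<Rightarrow> 'a) \<Rightarrow> real" and a u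
      unfolding boxi by (subst sum.reindex[OF inj]) simp
    have cardi: "card (box ((\<lambda>_. 0)(i := a)) (x(i := u))) = card (D i a u)" for a u
      unfolding boxi by (rule card_image[OF inj])
    have levi: "levels {i} N = (\<lambda>a. (\<lambda>_. 0)(i := a)) ` {..N}"
    proof (intro equalityI subsetI)
      fix k assume k: "k \<in> levels {i} N"
      then have "k = (\<lambda>_. 0)(i := k i)" by (auto simp: levels_def fun_eq_iff)
      then show "k \<in> (\<lambda>a. (\<lambda>_. 0)(i := a)) ` {..N}" using k by (intro image_eqI[of _ _ "k i"]) (auto simp: levels_def)
    qed (auto simp: levels_def)
    define C where "C = {D i a u | a u. a \<le> N \<and> u \<in> Xs i \<and> t * real (card (D i a u)) < sum F (D i a u)}"
    have C_sub: "C \<subseteq> Pow (Xs i)"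
    proof -
      have "D i a u \<subseteq> Xs i" if "a \<le> N" "u \<in> Xs i" for a u
        using d.D_mono[OF that(1)] Xs(2)[OF that(2)] by blast
      then show ?thesis unfolding C_def by blast
    qed
    have finC: "finite C" using finite_subset[OF C_sub] Xs(1) by simp
    have "t powr p * sum W (\<Union>C) \<le> (\<Sum>u\<in>\<Union>C. K * (F u powr p * \<Sigma> u powr (1 - p)))"
      unfolding sum_distrib_left
    proof (rule laminar_sum_Union_mono[OF finC])
      show "laminar C" by (rule laminar_subset[OF d.laminar_D]) (auto simp: C_def)
      fix I assume "I \<in> C"
      then obtain a u where I: "I = D i a u" "t * real (card I) < sum F I" by (auto simp: C_def)
      show "finite I" using I by simp
      let ?n = "real (card I)"
      have n: "0 < ?n" by (simp add: I d.card_D)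
      have up: "sum W I * sum \<Sigma> I powr (p - 1) \<le> K * ?n powr p"
        using upper[of "(\<lambda>_. 0)(i := a)" "x(i := u)"] unfolding sumi cardi I(1) W_def \<Sigma>_def .
      have "(t * ?n) powr p \<le> sum F I powr p" using I(2) t n p by (intro powr_mono2) auto
      also have "\<dots> \<le> (\<Sum>u\<in>I. F u powr p * \<Sigma> u powr (1 - p)) * sum \<Sigma> I powr (p - 1)"
        using p W0 I(1) by (intro holder_sum) auto
      finally have "(t * ?n) powr p * sum W I \<le> (\<Sum>u\<in>I. F u powr p * \<Sigma> u powr (1 - p)) * sum \<Sigma> I powr (p - 1) * sum W I"
        using W0(1) by (intro mult_right_mono sum_nonneg) (auto simp: less_imp_le)
      also have "\<dots> = (\<Sum>u\<in>I. F u powr p * \<Sigma> u powr (1 - p)) * (sum W I * sum \<Sigma> I powr (p - 1))" by (simp add: mult_ac)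
      also have "\<dots> \<le> (\<Sum>u\<in>I. F u powr p * \<Sigma> u powr (1 - p)) * (K * ?n powr p)"
        by (intro mult_left_mono up sum_nonneg) auto
      finally have "?n powr p * (t powr p * sum W I) \<le> ?n powr p * (K * (\<Sum>u\<in>I. F u powr p * \<Sigma> u powr (1 - p)))"
        using t n by (simp add: powr_mult mult_ac)
      then have "t powr p * sum W I \<le> K * (\<Sum>u\<in>I. F u powr p * \<Sigma> u powr (1 - p))" using n by simp
      then show "(\<Sum>u\<in>I. t powr p * W u) \<le> (\<Sum>u\<in>I. K * (F u powr p * \<Sigma> u powr (1 - p)))"
        by (simp only: sum_distrib_left)
    qed
    also have "\<dots> \<le> (\<Sum>u\<in>Xs i. K * (F u powr p * \<Sigma> u powr (1 - p)))"
      using C_sub Xs(1) K_ge_1 by (intro sum_mono2) auto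
    finally have "t powr p * sum W (\<Union>C) \<le> K * (\<Sum>u\<in>Xs i. F u powr p * \<Sigma> u powr (1 - p))" by (simp only: sum_distrib_left)
    moreover have "{u\<in>Xs i. t < gmax {i} N f (x(i := u))} \<subseteq> \<Union>C"
    proof
      fix u assume "u \<in> {u\<in>Xs i. t < gmax {i} N f (x(i := u))}"
      then obtain a where "u \<in> Xs i" "a \<le> N" "t * real (card (D i a u)) < sum F (D i a u)"
        unfolding gmax_gt_iff levi F_def by (auto simp: sumi cardi)
      then have "D i a u \<in> C" unfolding C_def by blast
      then show "u \<in> \<Union>C" using d.self by blast
    qed
    then have "(\<Sum>u | u \<in> Xs i \<and> t < gmax {i} N f (x(i := u)). W u) \<le> sum W (\<Union>C)"
      using finite_subset[of "\<Union>C" "Xs i"] C_sub Xs(1) W0(1) by (intro sum_mono2) (auto simp: less_imp_le)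
    then have "t powr p * (\<Sum>u | u \<in> Xs i \<and> t < gmax {i} N f (x(i := u)). W u) \<le> t powr p * sum W (\<Union>C)"
      by (intro mult_left_mono) auto
    ultimately have "t powr p * (\<Sum>u | u \<in> Xs i \<and> t < gmax {i} N f (x(i := u)). W u) \<le> K * (\<Sum>u\<in>Xs i. F u powr p * \<Sigma> u powr (1 - p))"
      by linarith
    then show "(\<Sum>u\<in>Xs i. t powr p * (if t < gmax {i} N f (x(i := u)) then w (x(i := u)) else 0))
       \<le> K * (\<Sum>u\<in>Xs i. f (x(i := u)) powr p * \<sigma> (x(i := u)) powr (1 - p))"
      by (simp add: sum.inter_filter[OF Xs(1)] sum_distrib_left[symmetric] F_def W_def \<Sigma>_def)
  qed
  then show ?thesis by (simp add: sum.inter_filter[OF finite_X] sum_distrib_left[symmetric])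
qed

definition plane_factor :: real where
  "plane_factor = K\<^sup>2 * sqrt (K powr (1 / (p - 1)))"

definition strong_factor :: real where
  "strong_factor = strong_const p * (plane_factor * K powr (1 / (p - 1)))"

lemma factors_nonneg: "0 \<le> plane_factor" "0 \<le> strong_factor"
  using strong_const_nonneg[OF p] by (auto simp: plane_factor_def strong_factor_def)

text \<open>\<open>strong_plane\<close> has weight \<open>\<sigma> powr (1 - p)\<close> on its right
  and \<open>w\<close> on its left. The inequality \<open>dual_le\<close> between them allows the
  output of one pair of coordinates to be the input of the next.\<close>

lemma strong_even:
  assumes f: "\<And>x. 0 \<le> f x" and A: "card A = 2 * m"
  shows "(\<Sum>x\<in>X. gmax A N f x powr p * \<sigma> x powr (1 - p)) \<le> strong_factor ^ m * (\<Sum>x\<in>X. f x powr p * \<sigma> x powr (1 - p))"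
  using A
proof (induction m arbitrary: A)
  case 0
  then show ?case by (simp add: gmax_empty)
next
  case (Suc m)
  from Suc.prems obtain i where i: "i \<in> A" by (metis card.empty equals0I mult_is_0 nat.simps(3) zero_neq_numeral)
  then have "card (A - {i}) = Suc (2 * m)" using Suc.prems by simp
  then obtain j where j: "j \<in> A - {i}" by (metis card.empty equals0I nat.simps(3))
  define B where "B = A - {i, j}"
  have ij: "i \<noteq> j" and AB: "A = {i, j} \<union> B" "{i, j} \<inter> B = {}" using i j by (auto simp: B_def)
  have "card A = card {i, j} + card B" unfolding AB(1) by (rule card_Un_disjoint) (use AB in auto)
  then have B: "card B = 2 * m" using Suc.prems ij by simp
  let ?g = "gmax B N f"
  have g0: "0 \<le> ?g x" for x using gmax_nonneg[of f] f by blast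
  have "(\<Sum>x\<in>X. gmax A N f x powr p * \<sigma> x powr (1 - p)) \<le> (\<Sum>x\<in>X. gmax {i, j} N ?g x powr p * w x)"
  proof (rule sum_mono)
    fix x
    have "gmax A N f x powr p \<le> gmax {i, j} N ?g x powr p"
      using gmax_Un_le[OF AB(2), of N f x] gmax_nonneg[of f A N x] f p unfolding AB(1)[symmetric] by (intro powr_mono2) auto
    then show "gmax A N f x powr p * \<sigma> x powr (1 - p) \<le> gmax {i, j} N ?g x powr p * w x"
      using dual_le[of x] by (intro mult_mono) auto
  qed
  also have "\<dots> \<le> strong_factor * (\<Sum>x\<in>X. ?g x powr p * \<sigma> x powr (1 - p))"
    unfolding strong_factor_def plane_factor_def by (rule strong_plane[OF ij g0])
  also have "\<dots> \<le> strong_factor * (strong_factor ^ m * (\<Sum>x\<in>X. f x powr p * \<sigma> x powr (1 - p)))"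
    by (intro mult_left_mono Suc.IH[OF B] factors_nonneg)
  finally show ?case by (simp add: mult.assoc)
qed

text \<open>The maximal function over \<open>A\<close> acts last and is needed in weak form only;
  the one over \<open>B\<close> has to be estimated in norm.\<close>

lemma weak_compose:
  assumes f: "\<And>x. 0 \<le> f x" and A: "UNIV = A \<union> B" "A \<inter> B = {}" "card B = 2 * m" and c: "0 \<le> c"
    and weak: "\<And>g. (\<And>x. 0 \<le> g x) \<Longrightarrow>
      t powr p * (\<Sum>x | x \<in> X \<and> t < gmax A N g x. w x) \<le> c * (\<Sum>x\<in>X. g x powr p * \<sigma> x powr (1 - p))"
  shows "t powr p * (\<Sum>x | x \<in> X \<and> t < gmax UNIV N f x. w x)
    \<le> c * strong_factor ^ m * (\<Sum>x\<in>X. f x powr p * \<sigma> x powr (1 - p))"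
proof -
  let ?g = "gmax B N f"
  have g0: "0 \<le> ?g x" for x using gmax_nonneg[of f] f by blast
  have "(\<Sum>x | x \<in> X \<and> t < gmax UNIV N f x. w x) \<le> (\<Sum>x | x \<in> X \<and> t < gmax A N ?g x. w x)"
    using finite_X pos gmax_Un_le[OF A(2), of N f] unfolding A(1)[symmetric]
    by (intro sum_mono2) (auto simp: less_imp_le intro: less_le_trans)
  then have "t powr p * (\<Sum>x | x \<in> X \<and> t < gmax UNIV N f x. w x) \<le> t powr p * (\<Sum>x | x \<in> X \<and> t < gmax A N ?g x. w x)"
    by (intro mult_left_mono) auto
  also have "\<dots> \<le> c * (\<Sum>x\<in>X. ?g x powr p * \<sigma> x powr (1 - p))" by (rule weak[OF g0])
  also have "\<dots> \<le> c * (strong_factor ^ m * (\<Sum>x\<in>X. f x powr p * \<sigma> x powr (1 - p)))"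
    by (intro mult_left_mono strong_even f A c)
  finally show ?thesis by (simp add: mult.assoc)
qed

lemma weak_even:
  assumes f: "\<And>x. 0 \<le> f x" and t: "0 \<le> t" and d: "CARD('n) = 2 * Suc m"
  shows "t powr p * (\<Sum>x | x \<in> X \<and> t < gmax UNIV N f x. w x)
    \<le> weak_const p * plane_factor * strong_factor ^ m * (\<Sum>x\<in>X. f x powr p * \<sigma> x powr (1 - p))"
proof -
  have "card (UNIV - {undefined :: 'n}) \<noteq> 0" using d by simp
  then obtain j where "j \<in> UNIV - {undefined :: 'n}" by (metis card.empty ex_in_conv)
  then obtain i j :: 'n where ij: "i \<noteq> j" by blast
  have B: "card (UNIV - {i, j}) = 2 * m" using d ij by (simp add: card_Diff_subset)
  show ?thesis
  proof (rule weak_compose[OF f _ _ B])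
    show "UNIV = {i, j} \<union> (UNIV - {i, j})" "{i, j} \<inter> (UNIV - {i, j}) = {}" by auto
    show "0 \<le> weak_const p * plane_factor" using weak_const_nonneg factors_nonneg by simp
  qed (use weak_plane[OF ij _ t] in \<open>simp add: plane_factor_def\<close>)
qed

lemma weak_odd:
  assumes f: "\<And>x. 0 \<le> f x" and t: "0 \<le> t" and d: "CARD('n) = Suc (2 * m)"
  shows "t powr p * (\<Sum>x | x \<in> X \<and> t < gmax UNIV N f x. w x)
    \<le> K * strong_factor ^ m * (\<Sum>x\<in>X. f x powr p * \<sigma> x powr (1 - p))"
proof -
  have B: "card (UNIV - {undefined :: 'n}) = 2 * m" using d by simp
  show ?thesis
  proof (rule weak_compose[OF f _ _ B])
    show "UNIV = {undefined :: 'n} \<union> (UNIV - {undefined})" "{undefined :: 'n} \<inter> (UNIV - {undefined}) = {}" by auto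
  qed (use weak_line[OF _ t] K_ge_1 in auto)
qed

text \<open>For \<open>d = 2 m\<close> a weak bound in one plane is composed with \<open>m - 1\<close> strong bounds, for
  \<open>d = 2 m + 1\<close> a weak bound on a line is composed with \<open>m\<close> strong bounds; the powers of \<open>K\<close> add up to
  the same expression in both cases.\<close>

lemma weak_grid:
  assumes f: "\<And>x. 0 \<le> f x" and t: "0 \<le> t"
  shows "t powr p * (\<Sum>x | x \<in> X \<and> t < gmax UNIV N f x. w x)
    \<le> (1 + weak_const p) * strong_const p ^ ((CARD('n) - 1) div 2)
      * K powr (1 + (real CARD('n) - 1) * p / (p - 1) - real (CARD('n) div 2) / (2 * (p - 1)))
      * (\<Sum>x\<in>X. f x powr p * \<sigma> x powr (1 - p))"
proof -
  define r where "r = 1 / (p - 1)"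
  have K: "0 < K" using K_ge_1 by simp
  have pf: "plane_factor = K powr (2 + r / 2)"
    using K by (simp add: plane_factor_def r_def powr_add powr_half_sqrt[symmetric] powr_powr)
  have sf: "strong_factor ^ m = strong_const p ^ m * K powr (real m * (2 + 3 * r / 2))" for m
  proof -
    have "plane_factor * K powr (1 / (p - 1)) = K powr (2 + 3 * r / 2)"
    proof -
      have "2 + r / 2 + r = 2 + 3 * r / 2" by simp
      then show ?thesis by (simp only: pf r_def[symmetric] powr_add[symmetric])
    qed
    then have "strong_factor ^ m = strong_const p ^ m * (K powr (2 + 3 * r / 2)) ^ m"
      by (simp add: strong_factor_def power_mult_distrib)
    also have "(K powr (2 + 3 * r / 2)) ^ m = K powr (real m * (2 + 3 * r / 2))"
      using K by (simp add: powr_realpow[symmetric] powr_powr mult.commute)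
    finally show ?thesis .
  qed
  \<comment> \<open>In terms of \<open>r\<close> the exponent without gain is 1 + (d - 1) (1 + r),
    and each pair of coordinates saves r / 2.\<close>
  have pr: "p / (p - 1) = 1 + r" using p by (simp add: r_def field_simps)
  have S0: "0 \<le> (\<Sum>x\<in>X. f x powr p * \<sigma> x powr (1 - p))" by (intro sum_nonneg) auto
  show ?thesis
  proof (cases "even CARD('n)")
    case True
    moreover have "CARD('n) \<noteq> 0" by simp
    ultimately obtain m where d: "CARD('n) = 2 * Suc m" by (metis evenE mult_0_right not0_implies_Suc)
    have e: "(CARD('n) - 1) div 2 = m" using d by simp
    have ex: "2 + r / 2 + real m * (2 + 3 * r / 2) = 1 + (real CARD('n) - 1) * p / (p - 1) - real (CARD('n) div 2) / (2 * (p - 1))"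
    proof -
      have "real (CARD('n) div 2) / (2 * (p - 1)) = (real m + 1) * (r / 2)" using d by (simp add: r_def mult.commute add.commute)
      moreover have "real CARD('n) = 2 * real m + 2" using d by simp
      ultimately show ?thesis unfolding times_divide_eq_right[symmetric] pr by (simp add: algebra_simps)
    qed
    have "t powr p * (\<Sum>x | x \<in> X \<and> t < gmax UNIV N f x. w x)
      \<le> weak_const p * (strong_const p ^ m * K powr (2 + r / 2 + real m * (2 + 3 * r / 2))) * (\<Sum>x\<in>X. f x powr p * \<sigma> x powr (1 - p))"
      using weak_even[OF f t d] by (simp add: pf sf powr_add mult_ac)
    also have "\<dots> \<le> (1 + weak_const p) * (strong_const p ^ m * K powr (2 + r / 2 + real m * (2 + 3 * r / 2))) * (\<Sum>x\<in>X. f x powr p * \<sigma> x powr (1 - p))"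
      using S0 strong_const_nonneg[OF p] by (intro mult_right_mono mult_nonneg_nonneg) auto
    finally show ?thesis unfolding e ex by (simp only: mult.assoc)
  next
    case False
    then obtain m where d: "CARD('n) = Suc (2 * m)" by (metis oddE Suc_eq_plus1)
    have e: "(CARD('n) - 1) div 2 = m" using d by simp
    have ex: "1 + real m * (2 + 3 * r / 2) = 1 + (real CARD('n) - 1) * p / (p - 1) - real (CARD('n) div 2) / (2 * (p - 1))"
    proof -
      have "real (CARD('n) div 2) / (2 * (p - 1)) = real m * (r / 2)" using d by (simp add: r_def mult.commute add.commute)
      moreover have "real CARD('n) = 2 * real m + 1" using d by simp
      ultimately show ?thesis unfolding times_divide_eq_right[symmetric] pr by (simp add: algebra_simps)
    qed
    have "t powr p * (\<Sum>x | x \<in> X \<and> t < gmax UNIV N f x. w x)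
      \<le> 1 * (strong_const p ^ m * K powr (1 + real m * (2 + 3 * r / 2))) * (\<Sum>x\<in>X. f x powr p * \<sigma> x powr (1 - p))"
      using weak_odd[OF f t d] K by (simp add: sf powr_add mult_ac)
    also have "\<dots> \<le> (1 + weak_const p) * (strong_const p ^ m * K powr (1 + real m * (2 + 3 * r / 2))) * (\<Sum>x\<in>X. f x powr p * \<sigma> x powr (1 - p))"
      using S0 strong_const_nonneg[OF p] weak_const_nonneg[of p] by (intro mult_right_mono mult_nonneg_nonneg) auto
    finally show ?thesis unfolding e ex by (simp only: mult.assoc)
  qed
qed

end

end

section \<open>Shifted dyadic systems\<close>

text \<open>The shift of the second dyadic system alternates in sign so that its cells are nested.\<close>

definition offset :: "bool \<Rightarrow> int \<Rightarrow> real" where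
  "offset b k = (if b then if even k then 1 / 3 else - 1 / 3 else 0)"

definition cell :: "bool \<Rightarrow> int \<Rightarrow> real \<Rightarrow> int" where
  "cell b k x = \<lfloor>x / 2 powi k - offset b k\<rfloor>"

text \<open>Equals \<open>2 * offset b (k + 1) - offset b k\<close>. The alternating sign makes this
  an integer, so the index of the parent cell is obtained by subtracting it and halving.\<close>

definition skew :: "bool \<Rightarrow> int \<Rightarrow> int" where
  "skew b k = (if b then if even k then - 1 else 1 else 0)"

fun ancestor :: "bool \<Rightarrow> int \<Rightarrow> nat \<Rightarrow> int \<Rightarrow> int" where
  "ancestor b k 0 m = m"
| "ancestor b k (Suc j) m = (ancestor b k j m - skew b (k + int j)) div 2"

text \<open>The base cells with the same ancestor as \<open>m\<close>, that is the dyadic interval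
  of generation \<open>j\<close> around \<open>m\<close>, in terms of indices alone.\<close>

definition descendants :: "bool \<Rightarrow> int \<Rightarrow> nat \<Rightarrow> int \<Rightarrow> int set" where
  "descendants b k j m = {n. ancestor b k j n = ancestor b k j m}"

lemma cell_Suc: "cell b (k + 1) x = (cell b k x - skew b k) div 2"
proof -
  have "x / 2 powi (k + 1) - offset b (k + 1) = (x / 2 powi k - offset b k - of_int (skew b k)) / of_int 2"
  proof -
    have "(2::real) powi (k + 1) = 2 * 2 powi k" by (simp add: power_int_add_1')
    then show ?thesis by (auto simp: offset_def skew_def field_simps)
  qed
  then have "cell b (k + 1) x = \<lfloor>x / 2 powi k - offset b k - of_int (skew b k)\<rfloor> div 2"
    unfolding cell_def by (simp only: floor_divide_real_eq_div[of 2])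
  then show ?thesis by (simp add: cell_def)
qed

lemma cell_ancestor: "cell b (k + int j) x = ancestor b k j (cell b k x)"
proof (induction j)
  case (Suc j)
  have "cell b (k + int (Suc j)) x = cell b (k + int j + 1) x" by (simp add: algebra_simps)
  then show ?case using Suc by (simp add: cell_Suc)
qed simp

lemma card_ancestor_fibre: "finite {n. ancestor b k j n = m} \<and> card {n. ancestor b k j n = m} = 2 ^ j"
proof (induction j arbitrary: m)
  case (Suc j)
  let ?s = "skew b (k + int j)"
  have "{n. ancestor b k (Suc j) n = m} = {n. ancestor b k j n = 2 * m + ?s} \<union> {n. ancestor b k j n = 2 * m + ?s + 1}"
    by auto
  moreover have "card ({n. ancestor b k j n = 2 * m + ?s} \<union> {n. ancestor b k j n = 2 * m + ?s + 1}) = 2 ^ Suc j"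
    using Suc by (subst card_Un_disjoint) auto
  ultimately show ?case using Suc by simp
qed simp

lemma dyadic_descendants: "dyadic (descendants b k)"
proof
  show "descendants b k 0 x = {x}" for x by (auto simp: descendants_def)
  show "card (descendants b k j x) = 2 ^ j" for j x using card_ancestor_fibre by (simp add: descendants_def)
  show "descendants b k j x \<subseteq> descendants b k (Suc j) x" for j x by (auto simp: descendants_def)
  show "descendants b k j y = descendants b k j x" if "y \<in> descendants b k j x" for j x y using that by (auto simp: descendants_def)
qed

lemma cell_vimage: "{x. cell b k x = m} = {(of_int m + offset b k) * 2 powi k ..< (of_int m + 1 + offset b k) * 2 powi k}"
  unfolding cell_def floor_eq_iff by (auto simp: field_simps)

lemma interval_bounds:
  fixes I :: "real set"
  assumes "is_interval I" "bounded I" "0 < emeasure lborel I"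
  obtains a b where "a < b" "I \<subseteq> {a..b}" "{a<..<b} \<subseteq> I"
proof -
  have ne: "I \<noteq> {}" using assms(3) by auto
  have bdd: "bdd_above I" "bdd_below I" using assms(2) bounded_imp_bdd_above bounded_imp_bdd_below by auto
  define a b where "a = Inf I" and "b = Sup I"
  have sub: "I \<subseteq> {a..b}" using bdd by (auto simp: a_def b_def intro: cInf_lower cSup_upper)
  have "a < b"
  proof (rule ccontr)
    assume "\<not> a < b"
    then have "I \<subseteq> {a}" using sub by auto
    then have "emeasure lborel I \<le> emeasure lborel {a}" by (intro emeasure_mono) auto
    then show False using assms(3) by simp
  qed
  moreover have "{a<..<b} \<subseteq> I"
  proof
    fix x assume x: "x \<in> {a<..<b}"
    obtain y where y: "y \<in> I" "y < x" using x ne bdd cInf_lessD[of I x] by (auto simp: a_def)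
    obtain z where z: "z \<in> I" "x < z" using x ne bdd less_cSupD[of I x] by (auto simp: b_def)
    show "x \<in> I" using assms(1) y z unfolding is_interval_1 by (meson less_imp_le)
  qed
  ultimately show ?thesis using sub that by blast
qed

text \<open>At a scale above \<open>3 (b - a)\<close> the end points of the two systems are more than \<open>b - a\<close> apart, so
  one of the systems has no end point inside the interval.\<close>

lemma interval_in_cell:
  assumes "a < b"
  shows "\<exists>s k. 2 powi k \<le> 6 * (b - a) \<and> (\<forall>x\<in>{a..b}. \<forall>y\<in>{a..b}. cell s k x = cell s k y)"
proof -
  \<comment> \<open>The largest scale with 2^k \<le> 6 (b - a); it then exceeds 3 (b - a).\<close>
  define k where "k = \<lfloor>log 2 (6 * (b - a))\<rfloor>"
  have "real_of_int k \<le> log 2 (6 * (b - a))" "log 2 (6 * (b - a)) < real_of_int k + 1" unfolding k_def by linarith+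
  then have "2 powr real_of_int k \<le> 6 * (b - a)" "6 * (b - a) < 2 powr (real_of_int k + 1)"
    using assms by (auto simp: le_log_iff log_less_iff)
  then have k: "2 powi k \<le> 6 * (b - a)" "3 * (b - a) < 2 powi k"
    by (simp_all add: powr_add powr_real_of_int')
  have pos: "0 < (2::real) powi k" by simp
  \<comment> \<open>If the index changes within the interval, some end point of a cell lies in
    it.\<close>
  have jump: "\<exists>n. a \<le> (of_int n + offset s k) * 2 powi k \<and> (of_int n + offset s k) * 2 powi k \<le> b"
    if xy: "x \<in> {a..b}" "y \<in> {a..b}" "cell s k x \<noteq> cell s k y" for s x y
  proof -
    have *: ?thesis if "u \<in> {a..b}" "v \<in> {a..b}" "cell s k u < cell s k v" for u v
    proof -
      have "u / 2 powi k - offset s k < of_int (cell s k v)" "of_int (cell s k v) \<le> v / 2 powi k - offset s k"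
        using that(3) unfolding cell_def by linarith+
      then have "u < (of_int (cell s k v) + offset s k) * 2 powi k" "(of_int (cell s k v) + offset s k) * 2 powi k \<le> v"
        using pos by (simp_all add: field_simps)
      then show ?thesis using that(1,2) by (intro exI[of _ "cell s k v"]) auto
    qed
    show ?thesis using *[of x y] *[of y x] xy
      by (cases "cell s k x" "cell s k y" rule: linorder_cases) auto
  qed
  have "\<exists>s. \<forall>x\<in>{a..b}. \<forall>y\<in>{a..b}. cell s k x = cell s k y"
  proof (rule ccontr)
    assume "\<not> ?thesis"
    then obtain n n' where n: "a \<le> (of_int n + offset False k) * 2 powi k" "(of_int n + offset False k) * 2 powi k \<le> b"
      "a \<le> (of_int n' + offset True k) * 2 powi k" "(of_int n' + offset True k) * 2 powi k \<le> b"
      using jump by metis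
    define d where "d = real_of_int n - of_int n' - offset True k"
    \<comment> \<open>\<open>3 * d\<close> is an integer that is not divisible by 3.\<close>
    have "1 / 3 \<le> \<bar>d\<bar>"
    proof -
      have "3 * d = of_int (3 * (n - n') - (if even k then 1 else - 1))" by (simp add: d_def offset_def)
      moreover have "3 * (n - n') - (if even k then 1 else - 1) \<noteq> 0" by presburger
      then have "1 \<le> \<bar>3 * (n - n') - (if even k then 1 else - 1)\<bar>" by linarith
      then have "1 \<le> \<bar>real_of_int (3 * (n - n') - (if even k then 1 else - 1))\<bar>" by linarith
      ultimately show ?thesis by linarith
    qed
    moreover have "\<bar>d * 2 powi k\<bar> \<le> b - a"
      using n unfolding d_def by (simp add: offset_def algebra_simps split: if_splits)
    then have "\<bar>d\<bar> * 2 powi k \<le> b - a" using pos by (simp add: abs_mult)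
    ultimately have "1 / 3 * 2 powi k \<le> b - a"
      using mult_right_mono[of "1/3" "\<bar>d\<bar>" "2 powi k"] pos by linarith
    then show False using k(2) by simp
  qed
  then show ?thesis using k(1) by blast
qed

text \<open>Faces are null sets, so one formula serves open, closed and half-open
  rectangles.\<close>

lemma emeasure_between_boxes:
  fixes S :: "(real ^ 'n) set"
  assumes "\<And>i. l i \<le> u i" "box (\<chi> i. l i) (\<chi> i. u i) \<subseteq> S" "S \<subseteq> cbox (\<chi> i. l i) (\<chi> i. u i)" "S \<in> sets lebesgue"
  shows "emeasure lebesgue S = ennreal (\<Prod>i\<in>UNIV. u i - l i)"
proof -
  let ?l = "(\<chi> i. l i) :: real ^ 'n" and ?u = "(\<chi> i. u i) :: real ^ 'n"
  have ne: "cbox ?l ?u \<noteq> {}" using assms(1) by (auto simp: interval_ne_empty_cart)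
  have c: "emeasure lebesgue (cbox ?l ?u) = ennreal (\<Prod>i\<in>UNIV. u i - l i)"
  proof -
    have "measure lborel (cbox ?l ?u) = (\<Prod>i\<in>UNIV. u i - l i)"
      using content_cbox_cart[OF ne] by simp
    moreover have "emeasure lborel (cbox ?l ?u) = ennreal (measure lborel (cbox ?l ?u))"
      by (rule emeasure_eq_ennreal_measure) (simp add: emeasure_lborel_cbox_eq)
    ultimately show ?thesis by simp
  qed
  moreover have "emeasure lebesgue (box ?l ?u) = emeasure lebesgue (cbox ?l ?u)"
    by (simp add: emeasure_lborel_box_eq emeasure_lborel_cbox_eq)
  moreover have "emeasure lebesgue (box ?l ?u) \<le> emeasure lebesgue S" "emeasure lebesgue S \<le> emeasure lebesgue (cbox ?l ?u)"
    using emeasure_mono[OF assms(2,4)] emeasure_mono[OF assms(3), of lebesgue] by simp_all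
  ultimately show ?thesis by (simp only: order_antisym)
qed

text \<open>\<open>\<alpha>\<close> picks one of the two systems in each coordinate and
  \<open>k\<close> a separate scale in each, so there are 2^d nested systems of rectangles.\<close>

definition cells :: "('n \<Rightarrow> bool) \<Rightarrow> ('n \<Rightarrow> int) \<Rightarrow> real ^ 'n \<Rightarrow> 'n \<Rightarrow> int" where
  "cells \<alpha> k x i = cell (\<alpha> i) (k i) (x $ i)"

lemma borel_coordinatewise:
  fixes A :: "'n::finite \<Rightarrow> real set"
  assumes "\<And>i. A i \<in> sets borel"
  shows "{x :: real ^ 'n. \<forall>i. x $ i \<in> A i} \<in> sets borel"
proof -
  have "(\<lambda>x :: real ^ 'n. x $ i) \<in> borel_measurable borel" for i
    by (intro borel_measurable_continuous_onI continuous_intros)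
  then have "(\<lambda>x :: real ^ 'n. x $ i) -` A i \<inter> space borel \<in> sets borel" for i
    using assms measurable_sets by blast
  then have "(\<Inter>i. (\<lambda>x :: real ^ 'n. x $ i) -` A i \<inter> space borel) \<in> sets borel" by (intro sets.countable_INT') auto
  moreover have "(\<Inter>i. (\<lambda>x :: real ^ 'n. x $ i) -` A i \<inter> space borel) = {x. \<forall>i. x $ i \<in> A i}" by auto
  ultimately show ?thesis by simp
qed

lemma cells_vimage: "{x :: real ^ 'n. cells \<alpha> k x = m} = {x. \<forall>i. x $ i \<in> {t. cell (\<alpha> i) (k i) t = m i}}"
  by (auto simp: cells_def fun_eq_iff)

lemma cells_borel [measurable]: "{x :: real ^ 'n::finite. cells \<alpha> k x = m} \<in> sets borel"
  unfolding cells_vimage by (rule borel_coordinatewise) (simp add: cell_vimage)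

lemma cells_rectangle: "{x :: real ^ 'n::finite. cells \<alpha> k x = m} \<in> rectangles"
  unfolding rectangles_def cells_vimage
  by (rule CollectI, rule exI[of _ "\<lambda>i. {t. cell (\<alpha> i) (k i) t = m i}"])
     (auto simp: cell_vimage is_interval_co algebra_simps)

lemma emeasure_cells: "emeasure lebesgue {x :: real ^ 'n::finite. cells \<alpha> k x = m} = ennreal (\<Prod>i\<in>UNIV. 2 powi k i)"
proof -
  let ?l = "\<lambda>i. (of_int (m i) + offset (\<alpha> i) (k i)) * 2 powi k i"
  let ?u = "\<lambda>i. (of_int (m i) + 1 + offset (\<alpha> i) (k i)) * 2 powi k i"
  have "emeasure lebesgue {x :: real ^ 'n. cells \<alpha> k x = m} = ennreal (\<Prod>i\<in>UNIV. ?u i - ?l i)"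
    by (rule emeasure_between_boxes)
       (auto simp: cells_vimage cell_vimage mem_box_cart algebra_simps less_imp_le intro: borel_coordinatewise)
  then show ?thesis by (simp add: algebra_simps)
qed

lemma ennreal_less_divide_iff: "b \<noteq> 0 \<Longrightarrow> b < top \<Longrightarrow> c < a / b \<longleftrightarrow> c * b < (a :: ennreal)"
  by (cases a; cases b; cases c)
     (auto simp: divide_ennreal ennreal_mult[symmetric] ennreal_less_iff field_simps ennreal_top_mult ennreal_top_divide)

text \<open>\<open>interval_in_cell\<close> encloses every side of a rectangle in a cell at most 6
  times as long, so the average drops by a factor of at most 6^d.\<close>

lemma strong_maximal_gt:
  fixes f :: "real ^ 'n::finite \<Rightarrow> complex"
  assumes "ennreal t < strong_maximal f x" "0 \<le> t"
  obtains \<alpha> k where "ennreal (t / 6 ^ CARD('n)) < average {y. cells \<alpha> k y = cells \<alpha> k x} (\<lambda>y. ennreal (norm (f y)))"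
proof -
  let ?f = "\<lambda>y. ennreal (norm (f y))"
  obtain R where R: "R \<in> rectangles" "ennreal t < indicator R x * average R ?f"
    using assms(1) unfolding strong_maximal_def less_SUP_iff by blast
  have xR: "x \<in> R" using R(2) by (cases "x \<in> R") auto
  from R(1) obtain I where I': "\<forall>i. is_interval (I i) \<and> bounded (I i) \<and> 0 < emeasure lborel (I i)" "R = {x. \<forall>i. x $ i \<in> I i}"
    unfolding rectangles_def mem_Collect_eq by (elim exE conjE)
  have I: "is_interval (I i)" "bounded (I i)" "0 < emeasure lborel (I i)" "R = {x. \<forall>i. x $ i \<in> I i}" for i
    using I' by auto
  have "\<forall>i. \<exists>a b. a < b \<and> I i \<subseteq> {a..b} \<and> {a<..<b} \<subseteq> I i"
  proof
    fix i
    obtain a b where "a < b" "I i \<subseteq> {a..b}" "{a<..<b} \<subseteq> I i" using interval_bounds[OF I(1-3)[of i]] by blast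
    then show "\<exists>a b. a < b \<and> I i \<subseteq> {a..b} \<and> {a<..<b} \<subseteq> I i" by blast
  qed
  then obtain a b where ab: "\<And>i. a i < b i" "\<And>i. I i \<subseteq> {a i..b i}" "\<And>i. {a i<..<b i} \<subseteq> I i" by metis
  have "\<forall>i. \<exists>s k. 2 powi k \<le> 6 * (b i - a i) \<and> (\<forall>x\<in>{a i..b i}. \<forall>y\<in>{a i..b i}. cell s k x = cell s k y)"
    using interval_in_cell ab(1) by blast
  then obtain \<alpha> k where k: "\<And>i. 2 powi k i \<le> 6 * (b i - a i)"
    "\<And>i x y. x \<in> {a i..b i} \<Longrightarrow> y \<in> {a i..b i} \<Longrightarrow> cell (\<alpha> i) (k i) x = cell (\<alpha> i) (k i) y" by metis
  let ?Q = "{y. cells \<alpha> k y = cells \<alpha> k x}"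
  have RQ: "R \<subseteq> ?Q"
  proof
    fix y assume "y \<in> R"
    then have "y $ i \<in> {a i..b i}" "x $ i \<in> {a i..b i}" for i using xR ab(2)[of i] unfolding I(4) by auto
    then show "y \<in> ?Q" unfolding cells_def fun_eq_iff using k(2) by blast
  qed
  have "I i \<in> sets borel" for i using I(1) by (rule real_interval_borel_measurable)
  then have Rm: "R \<in> sets borel" unfolding I(4) by (rule borel_coordinatewise)
  have mR: "emeasure lebesgue R = ennreal (\<Prod>i\<in>UNIV. b i - a i)"
  proof (rule emeasure_between_boxes)
    show "a i \<le> b i" for i using ab(1)[of i] by simp
    show "box (\<chi> i. a i) (\<chi> i. b i) \<subseteq> R" using ab(3) unfolding I(4) by (auto simp: mem_box_cart subset_iff)
    show "R \<subseteq> cbox (\<chi> i. a i) (\<chi> i. b i)" using ab(2) unfolding I(4) by (auto simp: mem_box_cart subset_iff)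
    show "R \<in> sets lebesgue" using Rm by simp
  qed
  define r q where "r = (\<Prod>i\<in>UNIV. b i - a i)" and "q = (\<Prod>i\<in>UNIV. 2 powi k i :: real)"
  have r: "0 < r" unfolding r_def using ab(1) by (intro prod_pos) auto
  have q: "0 < q" unfolding q_def by (intro prod_pos) auto
  have "q \<le> (\<Prod>i\<in>(UNIV :: 'n set). 6 * (b i - a i))" unfolding q_def using k(1) by (intro prod_mono) auto
  also have "\<dots> = 6 ^ CARD('n) * r" unfolding prod.distrib r_def by simp
  finally have qr: "q \<le> 6 ^ CARD('n) * r" .
  define J where "J = (\<integral>\<^sup>+ y\<in>R. ?f y \<partial>lebesgue)"
  define J' where "J' = (\<integral>\<^sup>+ y\<in>?Q. ?f y \<partial>lebesgue)"
  have JJ: "J \<le> J'" unfolding J_def J'_def using RQ by (intro nn_integral_mono) (auto simp: indicator_def)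
  have "ennreal t < J / ennreal r" using R(2) xR by (simp add: average_def J_def mR r_def)
  then have "ennreal t * ennreal r < J" using r by (simp add: ennreal_less_divide_iff)
  then have tJ: "ennreal (t * r) < J'" using JJ assms(2) r by (simp add: ennreal_mult)
  have "t / 6 ^ CARD('n) * q \<le> t / 6 ^ CARD('n) * (6 ^ CARD('n) * r)" using assms(2) qr by (intro mult_left_mono) auto
  then have "ennreal (t / 6 ^ CARD('n) * q) \<le> ennreal (t * r)" by (intro ennreal_leI) simp
  then have "ennreal (t / 6 ^ CARD('n)) * ennreal q < J'" using tJ assms(2) q by (simp add: ennreal_mult[symmetric])
  then have "ennreal (t / 6 ^ CARD('n)) < J' / ennreal q" using q by (simp add: ennreal_less_divide_iff)
  then show ?thesis using that[of \<alpha> k] by (simp add: average_def J'_def emeasure_cells q_def)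
qed

section \<open>From the grid to the continuum\<close>

text \<open>The tangent argument of \<open>holder_sum\<close> for integrals. As \<open>G\<close> and
  \<open>H\<close> are real numbers, it also shows that \<open>a\<close> has a finite
  integral.\<close>

lemma nn_integral_holder:
  fixes a b :: "'x \<Rightarrow> real"
  assumes p: "1 < p" and meas: "a \<in> borel_measurable M" "b \<in> borel_measurable M"
    and a: "\<And>x. 0 \<le> a x" and b: "AE x in M. 0 < b x"
    and H: "(\<integral>\<^sup>+ x. ennreal (b x) \<partial>M) = ennreal H" "0 < H"
    and G: "(\<integral>\<^sup>+ x. ennreal (a x powr p * b x powr (1 - p)) \<partial>M) = ennreal G" "0 \<le> G"
  shows "(\<integral>\<^sup>+ x. ennreal (a x) \<partial>M) \<le> ennreal (G powr (1 / p) * H powr (1 - 1 / p))"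
proof (cases "G = 0")
  case True
  have "AE x in M. ennreal (a x powr p * b x powr (1 - p)) = 0"
    using G(1) True meas by (subst nn_integral_0_iff_AE[symmetric]) auto
  with b have "AE x in M. ennreal (a x) = 0"
  proof eventually_elim
    case (elim x)
    then have "a x powr p * b x powr (1 - p) \<le> 0" by (simp add: ennreal_eq_0_iff)
    moreover have "0 \<le> a x powr p * b x powr (1 - p)" by simp
    ultimately have "a x powr p * b x powr (1 - p) = 0" by linarith
    then show ?case using elim(1) by simp
  qed
  then have "(\<integral>\<^sup>+ x. ennreal (a x) \<partial>M) = 0" using meas by (subst nn_integral_0_iff_AE) auto
  then show ?thesis by simp
next
  case False
  then have G0: "0 < G" using G by simp
  \<comment> \<open>The point of tangency that makes both terms combine to the Hoelder product. It
    would vanish for \<open>G = 0\<close>, hence the case distinction.\<close>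
  define c where "c = (G / H) powr (1 / p)"
  have c: "0 < c" "c powr p = G / H" using G0 H p by (auto simp: c_def powr_powr)
  have cH: "c * H = G powr (1 / p) * H powr (1 - 1 / p)"
    using G0 H by (simp add: c_def powr_divide powr_diff)
  define A B where "A = 1 / (p * c powr (p - 1))" and "B = (p - 1) * c / p"
  have AB: "0 \<le> A" "0 \<le> B" using p c by (auto simp: A_def B_def)
  have "(\<integral>\<^sup>+ x. ennreal (a x) \<partial>M) \<le> (\<integral>\<^sup>+ x. ennreal A * ennreal (a x powr p * b x powr (1 - p)) + ennreal B * ennreal (b x) \<partial>M)"
  proof (rule nn_integral_mono_AE)
    show "AE x in M. ennreal (a x) \<le> ennreal A * ennreal (a x powr p * b x powr (1 - p)) + ennreal B * ennreal (b x)"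
      using b
    proof eventually_elim
      case (elim x)
      have "p * (a x / b x) * c powr (p - 1) \<le> (a x / b x) powr p + (p - 1) * c powr p"
        using powr_tangent[of p "a x / b x" c] p a[of x] elim c by simp
      from mult_left_mono[OF this, of "b x"] elim
      have "p * a x * c powr (p - 1) \<le> b x * (a x / b x) powr p + (p - 1) * c powr p * b x"
        by (simp add: algebra_simps)
      moreover have "b x * (a x / b x) powr p = a x powr p * b x powr (1 - p)"
        using a[of x] elim by (simp add: powr_divide powr_diff)
      ultimately have "A * (p * a x * c powr (p - 1)) \<le> A * (a x powr p * b x powr (1 - p) + (p - 1) * c powr p * b x)"
        using AB by (intro mult_left_mono) auto
      moreover have "A * (p * a x * c powr (p - 1)) = a x" using p c by (simp add: A_def)
      moreover have "A * ((p - 1) * c powr p * b x) = B * b x"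
        using p c(1) by (simp add: A_def B_def powr_diff)
      ultimately have "a x \<le> A * (a x powr p * b x powr (1 - p)) + B * b x" by (simp add: distrib_left)
      then show ?case using AB elim by (simp add: ennreal_mult[symmetric] ennreal_plus[symmetric] del: ennreal_plus)
    qed
  qed
  also have "\<dots> = ennreal A * ennreal G + ennreal B * ennreal H"
    using meas by (simp add: nn_integral_add nn_integral_cmult G(1) H(1))
  also have "\<dots> = ennreal (A * G + B * H)"
    using AB G H by (simp add: ennreal_mult[symmetric] ennreal_plus[symmetric] del: ennreal_plus)
  also have "A * G + B * H = c * H"
  proof -
    have "G = c * c powr (p - 1) * H" using c H by (simp add: powr_diff)
    then have "A * G = c * H / p" using p c(1) by (simp add: A_def)
    then show ?thesis using p by (simp add: B_def field_simps)
  qed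
  finally show ?thesis by (simp add: cH)
qed

lemma set_nn_integral_holder:
  fixes a b :: "'x \<Rightarrow> real"
  assumes p: "1 < p" and meas: "a \<in> borel_measurable M" "b \<in> borel_measurable M" and Q: "Q \<in> sets M"
    and a: "\<And>x. 0 \<le> a x" and b: "AE x in M. 0 < b x"
    and H: "(\<integral>\<^sup>+ x\<in>Q. ennreal (b x) \<partial>M) = ennreal H" "0 < H"
    and G: "(\<integral>\<^sup>+ x\<in>Q. ennreal (a x powr p * b x powr (1 - p)) \<partial>M) = ennreal G" "0 \<le> G"
  shows "(\<integral>\<^sup>+ x\<in>Q. ennreal (a x) \<partial>M) \<le> ennreal (G powr (1 / p) * H powr (1 - 1 / p))"
proof -
  have Q': "Q \<inter> space M \<in> sets M" using Q by simp
  have "AE x in restrict_space M Q. 0 < b x" using b Q' by (subst AE_restrict_space_iff) auto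
  then show ?thesis
    using nn_integral_holder[of p a "restrict_space M Q" b H G] assms
    by (simp add: nn_integral_restrict_space[OF Q'] measurable_restrict_space1)
qed

lemma set_nn_integral_pos:
  fixes h :: "'x \<Rightarrow> real"
  assumes "h \<in> borel_measurable M" "AE x in M. 0 < h x" "Q \<in> sets M" "0 < emeasure M Q"
  shows "0 < (\<integral>\<^sup>+ x\<in>Q. ennreal (h x) \<partial>M)"
proof (rule ccontr)
  assume "\<not> ?thesis"
  then have "(\<integral>\<^sup>+ x\<in>Q. ennreal (h x) \<partial>M) = 0" by (simp add: zero_less_iff_neq_zero)
  then have "AE x in M. ennreal (h x) * indicator Q x = 0" using assms by (subst nn_integral_0_iff_AE[symmetric]) auto
  with assms(2) have "AE x in M. x \<notin> Q" by eventually_elim (auto simp: indicator_def split: if_splits)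
  then have "emeasure M Q = 0" using AE_iff_null_sets[OF assms(3)] by auto
  then show False using assms(4) by simp
qed

lemma set_nn_integral_fibres:
  assumes B: "finite B" and h: "h \<in> borel_measurable M" and A: "\<And>m. {x. \<Phi> x = m} \<in> sets M"
  shows "(\<integral>\<^sup>+ x\<in>{x. \<Phi> x \<in> B}. h x \<partial>M) = (\<Sum>m\<in>B. \<integral>\<^sup>+ x\<in>{x. \<Phi> x = m}. h x \<partial>M)"
proof -
  have "h x * indicator {x. \<Phi> x \<in> B} x = (\<Sum>m\<in>B. h x * indicator {x. \<Phi> x = m} x)" for x
  proof (cases "\<Phi> x \<in> B")
    case True
    have "(\<Sum>m\<in>B. h x * indicator {x. \<Phi> x = m} x) = (\<Sum>m\<in>{\<Phi> x}. h x * indicator {x. \<Phi> x = m} x)"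
      using True B by (intro sum.mono_neutral_right) (auto simp: indicator_def split: if_splits)
    then show ?thesis using True by simp
  next
    case False
    then have "(\<Sum>m\<in>B. h x * indicator {x. \<Phi> x = m} x) = 0"
      by (intro sum.neutral) (auto simp: indicator_def)
    then show ?thesis using False by simp
  qed
  then show ?thesis using h A by (simp add: nn_integral_sum)
qed

text \<open>Grid bounds apply to finite families of cells, which have a finest scale; continuity
  from below extends them to all cells of a system.\<close>

lemma emeasure_countable_Union_le:
  assumes "countable F" "F \<subseteq> sets M" "\<And>G. finite G \<Longrightarrow> G \<subseteq> F \<Longrightarrow> emeasure M (\<Union>G) \<le> B"
  shows "emeasure M (\<Union>F) \<le> B"
proof (cases "F = {}")
  case False
  let ?A = "\<lambda>n. \<Union>(from_nat_into F ` {..<n})"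
  have F: "range (from_nat_into F) = F" by (rule range_from_nat_into[OF False assms(1)])
  have sub: "from_nat_into F ` {..<n} \<subseteq> F" for n using F by blast
  have "(\<Union>n. ?A n) = \<Union>F"
  proof -
    have "(\<Union>n. ?A n) = \<Union>(range (from_nat_into F))" by blast
    then show ?thesis unfolding F .
  qed
  moreover have "(SUP n. emeasure M (?A n)) = emeasure M (\<Union>n. ?A n)"
  proof (rule SUP_emeasure_incseq)
    show "range ?A \<subseteq> sets M"
    proof
      fix S assume "S \<in> range ?A"
      then obtain n where "S = ?A n" by blast
      then show "S \<in> sets M" using sub[of n] assms(2) by (auto intro!: sets.finite_Union)
    qed
    show "incseq ?A" unfolding incseq_def by (intro allI impI Union_mono image_mono) auto
  qed
  moreover have "(SUP n. emeasure M (?A n)) \<le> B" using assms(3) sub by (intro SUP_least) auto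
  ultimately show ?thesis by simp
qed (use assms(3)[of "{}"] in simp)

lemma epowr_mono:
  assumes "x \<le> ennreal y" "0 \<le> y" "0 \<le> a"
  shows "epowr x a \<le> ennreal (y powr a)"
proof -
  have "x \<noteq> \<infinity>" using assms(1) by (auto simp: top_unique)
  moreover have "enn2real x \<le> y" using assms(1,2) by (simp add: enn2real_leI)
  ultimately show ?thesis using assms(3) by (auto simp: epowr_def intro!: ennreal_leI powr_mono2)
qed

lemma epowr_ennreal: "0 \<le> y \<Longrightarrow> epowr (ennreal y) a = ennreal (y powr a)"
  by (simp add: epowr_def)

section \<open>Cell averages of the weights and of the function\<close>

locale strong_weight =
  fixes p :: real and w :: "real ^ 'n::finite \<Rightarrow> real"
  assumes p: "1 < p" and Ap: "w \<in> Ap_weights p"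
begin

abbreviation dual :: "real ^ 'n \<Rightarrow> real" where "dual \<equiv> dual_weight p w"

lemma measurable_weights: "w \<in> borel_measurable lebesgue" "dual \<in> borel_measurable lebesgue"
proof -
  show w: "w \<in> borel_measurable lebesgue" using Ap by (simp add: Ap_weights_def weight_def)
  show "dual \<in> borel_measurable lebesgue"
    unfolding dual_weight_def[abs_def] using w by measurable
qed

lemma AE_weights: "AE x in lebesgue. 0 < w x" "AE x in lebesgue. 0 < dual x"
  "AE x in lebesgue. dual x powr (1 - p) = w x"
proof -
  show w: "AE x in lebesgue. 0 < w x" using Ap by (simp add: Ap_weights_def weight_def)
  from w show "AE x in lebesgue. 0 < dual x" by eventually_elim (simp add: dual_weight_def)
  have "(1 - conj_exponent p) * (1 - p) = 1" using p by (simp add: conj_exponent_def field_simps)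
  then have *: "(v powr (1 - conj_exponent p)) powr (1 - p) = v" if "0 < v" for v using that by (simp add: powr_powr)
  from w show "AE x in lebesgue. dual x powr (1 - p) = w x" unfolding dual_weight_def
  proof eventually_elim
    case (elim x)
    then show ?case by (rule *)
  qed
qed

lemma sets_cells [measurable]: "{x :: real ^ 'n. cells \<alpha> k x = m} \<in> sets lebesgue"
  using cells_borel by simp

definition volume :: "('n \<Rightarrow> int) \<Rightarrow> real" where
  "volume k = (\<Prod>i\<in>UNIV. 2 powi k i)"

lemma volume_pos: "0 < volume k"
  unfolding volume_def by (intro prod_pos) auto

lemma emeasure_cells': "emeasure lebesgue {x :: real ^ 'n. cells \<alpha> k x = m} = ennreal (volume k)"
  by (simp add: emeasure_cells volume_def)

lemma Ap_cells:
  "average {x. cells \<alpha> k x = m} (\<lambda>x. ennreal (w x)) * epowr (average {x. cells \<alpha> k x = m} (\<lambda>x. ennreal (dual x))) (p - 1)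
    \<le> ennreal (enn2real (Ap_const p w))"
proof -
  have "Ap_const p w < top" using Ap by (simp add: Ap_weights_def)
  then have "ennreal (enn2real (Ap_const p w)) = Ap_const p w" by simp
  moreover have "average {x. cells \<alpha> k x = m} (\<lambda>x. ennreal (w x)) * epowr (average {x. cells \<alpha> k x = m} (\<lambda>x. ennreal (dual x))) (p - 1)
      \<le> Ap_const p w"
    unfolding Ap_const_def by (rule SUP_upper2[OF cells_rectangle[of \<alpha> k m]]) (rule order_refl)
  ultimately show ?thesis by simp
qed

lemma integral_w:
  "0 < (\<integral>\<^sup>+ x\<in>{x. cells \<alpha> k x = m}. ennreal (w x) \<partial>lebesgue)" "(\<integral>\<^sup>+ x\<in>{x. cells \<alpha> k x = m}. ennreal (w x) \<partial>lebesgue) < \<infinity>"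
proof -
  let ?Q = "{x :: real ^ 'n. cells \<alpha> k x = m}"
  show "0 < (\<integral>\<^sup>+ x\<in>?Q. ennreal (w x) \<partial>lebesgue)"
    by (rule set_nn_integral_pos) (auto simp: measurable_weights AE_weights emeasure_cells' volume_pos)
  let ?l = "(\<chi> i. (of_int (m i) + offset (\<alpha> i) (k i)) * 2 powi k i) :: real ^ 'n"
  let ?u = "(\<chi> i. (of_int (m i) + 1 + offset (\<alpha> i) (k i)) * 2 powi k i) :: real ^ 'n"
  have sub: "?Q \<subseteq> cbox ?l ?u" by (auto simp: cells_vimage cell_vimage mem_box_cart less_imp_le)
  have "integrable lebesgue (\<lambda>x. indicator (cbox ?l ?u) x *\<^sub>R w x)"
    using Ap compact_cbox unfolding Ap_weights_def weight_def set_integrable_def by blast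
  then have "(\<integral>\<^sup>+ x. ennreal (norm (indicator (cbox ?l ?u) x *\<^sub>R w x)) \<partial>lebesgue) < \<infinity>"
    by (simp add: integrable_iff_bounded)
  moreover have "(\<integral>\<^sup>+ x\<in>?Q. ennreal (w x) \<partial>lebesgue) \<le> (\<integral>\<^sup>+ x. ennreal (norm (indicator (cbox ?l ?u) x *\<^sub>R w x)) \<partial>lebesgue)"
    using sub by (intro nn_integral_mono) (auto simp: indicator_def ennreal_leI)
  ultimately show "(\<integral>\<^sup>+ x\<in>?Q. ennreal (w x) \<partial>lebesgue) < \<infinity>" by (rule le_less_trans[rotated])
qed

text \<open>Integrability of the dual weight comes from the A_p condition: an infinite average of it
  times the positive average of \<open>w\<close> would make the constant infinite.\<close>

lemma integral_dual:
  "0 < (\<integral>\<^sup>+ x\<in>{x. cells \<alpha> k x = m}. ennreal (dual x) \<partial>lebesgue)" "(\<integral>\<^sup>+ x\<in>{x. cells \<alpha> k x = m}. ennreal (dual x) \<partial>lebesgue) < \<infinity>"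
proof -
  let ?Q = "{x :: real ^ 'n. cells \<alpha> k x = m}"
  show "0 < (\<integral>\<^sup>+ x\<in>?Q. ennreal (dual x) \<partial>lebesgue)"
    by (rule set_nn_integral_pos) (auto simp: measurable_weights AE_weights emeasure_cells' volume_pos)
  show "(\<integral>\<^sup>+ x\<in>?Q. ennreal (dual x) \<partial>lebesgue) < \<infinity>"
  proof (rule ccontr)
    assume "\<not> ?thesis"
    then have "(\<integral>\<^sup>+ x\<in>?Q. ennreal (dual x) \<partial>lebesgue) = top" by (simp add: less_top[symmetric])
    then have "average ?Q (\<lambda>x. ennreal (dual x)) = top"
      by (simp add: average_def emeasure_cells' ennreal_top_divide)
    then have "epowr (average ?Q (\<lambda>x. ennreal (dual x))) (p - 1) = top" by (simp add: epowr_def)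
    moreover have "average ?Q (\<lambda>x. ennreal (w x)) \<noteq> 0"
      using integral_w(1)[of \<alpha> k m] by (simp add: average_def emeasure_cells')
    ultimately have "average ?Q (\<lambda>x. ennreal (w x)) * epowr (average ?Q (\<lambda>x. ennreal (dual x))) (p - 1) = top"
      by (simp add: ennreal_mult_top)
    then show False using Ap_cells[of \<alpha> k m] by (simp add: top_unique)
  qed
qed

abbreviation base_cell :: "('n \<Rightarrow> bool) \<Rightarrow> int \<Rightarrow> ('n \<Rightarrow> int) \<Rightarrow> (real ^ 'n) set" where
  "base_cell \<alpha> k0 m \<equiv> {x. cells \<alpha> (\<lambda>_. k0) x = m}"

definition mean :: "('n \<Rightarrow> bool) \<Rightarrow> int \<Rightarrow> (real ^ 'n \<Rightarrow> real) \<Rightarrow> ('n \<Rightarrow> int) \<Rightarrow> real" where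
  "mean \<alpha> k0 g m = enn2real (\<integral>\<^sup>+ x\<in>base_cell \<alpha> k0 m. ennreal (g x) \<partial>lebesgue) / volume (\<lambda>_. k0)"

lemma grid: "dyadic_grid (\<lambda>i. descendants (\<alpha> i) k0)"
  by (rule dyadic_grid.intro) (rule dyadic_descendants)

abbreviation grid_box :: "('n \<Rightarrow> bool) \<Rightarrow> int \<Rightarrow> ('n \<Rightarrow> nat) \<Rightarrow> ('n \<Rightarrow> int) \<Rightarrow> ('n \<Rightarrow> int) set" where
  "grid_box \<alpha> k0 \<equiv> dyadic_grid.box (\<lambda>i. descendants (\<alpha> i) k0)"

text \<open>Boxes of indices correspond to cells of coarser scales, so averages over them are
  averages over genuine rectangles.\<close>

lemma grid_box_cells:
  "{x. cells \<alpha> (\<lambda>_. k0) x \<in> grid_box \<alpha> k0 k m} = {x. cells \<alpha> (\<lambda>i. k0 + int (k i)) x = (\<lambda>i. ancestor (\<alpha> i) k0 (k i) (m i))}"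
  by (auto simp: dyadic_grid.box_def[OF grid] descendants_def cells_def cell_ancestor fun_eq_iff)

lemma mean_integral:
  assumes "(\<integral>\<^sup>+ x\<in>base_cell \<alpha> k0 m. ennreal (g x) \<partial>lebesgue) < \<infinity>"
  shows "(\<integral>\<^sup>+ x\<in>base_cell \<alpha> k0 m. ennreal (g x) \<partial>lebesgue) = ennreal (volume (\<lambda>_. k0) * mean \<alpha> k0 g m)"
  using assms volume_pos[of "\<lambda>_. k0"] by (simp add: mean_def)

lemma mean_nonneg: "0 \<le> mean \<alpha> k0 g m"
  using volume_pos[of "\<lambda>_. k0"] by (simp add: mean_def)

lemma mean_pos:
  assumes "(\<integral>\<^sup>+ x\<in>base_cell \<alpha> k0 m. ennreal (g x) \<partial>lebesgue) < \<infinity>" "0 < (\<integral>\<^sup>+ x\<in>base_cell \<alpha> k0 m. ennreal (g x) \<partial>lebesgue)"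
  shows "0 < mean \<alpha> k0 g m"
  using assms volume_pos[of "\<lambda>_. k0"] by (simp add: mean_def enn2real_positive_iff)

lemma integral_finite_union:
  assumes "finite B" "g \<in> borel_measurable lebesgue" "\<And>m. (\<integral>\<^sup>+ x\<in>base_cell \<alpha> k0 m. ennreal (g x) \<partial>lebesgue) < \<infinity>"
  shows "(\<integral>\<^sup>+ x\<in>{x. cells \<alpha> (\<lambda>_. k0) x \<in> B}. ennreal (g x) \<partial>lebesgue) = ennreal (volume (\<lambda>_. k0) * sum (mean \<alpha> k0 g) B)"
proof -
  have "(\<integral>\<^sup>+ x\<in>{x. cells \<alpha> (\<lambda>_. k0) x \<in> B}. ennreal (g x) \<partial>lebesgue) = (\<Sum>m\<in>B. \<integral>\<^sup>+ x\<in>base_cell \<alpha> k0 m. ennreal (g x) \<partial>lebesgue)"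
    using assms by (intro set_nn_integral_fibres) auto
  also have "\<dots> = (\<Sum>m\<in>B. ennreal (volume (\<lambda>_. k0) * mean \<alpha> k0 g m))"
    using assms(3) by (intro sum.cong refl mean_integral)
  also have "\<dots> = ennreal (volume (\<lambda>_. k0) * sum (mean \<alpha> k0 g) B)"
    using mean_nonneg volume_pos[of "\<lambda>_. k0"] by (simp add: sum_ennreal sum_distrib_left)
  finally show ?thesis .
qed

lemma average_grid_box:
  assumes "g \<in> borel_measurable lebesgue" "\<And>m. (\<integral>\<^sup>+ x\<in>base_cell \<alpha> k0 m. ennreal (g x) \<partial>lebesgue) < \<infinity>"
  shows "average {x. cells \<alpha> (\<lambda>_. k0) x \<in> grid_box \<alpha> k0 k m} (\<lambda>x. ennreal (g x))
    = ennreal (sum (mean \<alpha> k0 g) (grid_box \<alpha> k0 k m) / real (card (grid_box \<alpha> k0 k m)))"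
proof -
  let ?B = "grid_box \<alpha> k0 k m"
  let ?v = "volume (\<lambda>_. k0)"
  have fin: "finite ?B" and card: "0 < card ?B" using dyadic_grid.finite_box[OF grid] dyadic_grid.card_box_pos[OF grid] by auto
  have v: "0 < ?v" by (rule volume_pos)
  have "emeasure lebesgue {x. cells \<alpha> (\<lambda>_. k0) x \<in> ?B} = (\<integral>\<^sup>+ x\<in>{x. cells \<alpha> (\<lambda>_. k0) x \<in> ?B}. 1 \<partial>lebesgue)"
    unfolding grid_box_cells by simp
  also have "\<dots> = (\<Sum>m\<in>?B. \<integral>\<^sup>+ x\<in>base_cell \<alpha> k0 m. 1 \<partial>lebesgue)"
    using fin by (intro set_nn_integral_fibres) auto
  also have "\<dots> = ennreal (?v * real (card ?B))"
    using v by (simp add: emeasure_cells' ennreal_mult ennreal_of_nat_eq_real_of_nat mult.commute)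
  finally show ?thesis
    unfolding average_def integral_finite_union[OF fin assms]
    using v card mean_nonneg by (simp add: divide_ennreal sum_nonneg)
qed

text \<open>\<open>upper\<close> holds because a grid box corresponds to a coarser cell, itself a
  rectangle. \<open>lower\<close> is Hoelder's inequality for the constant function 1 on one base
  cell.\<close>

lemma ap_grid: "ap_grid (\<lambda>i. descendants (\<alpha> i) k0) (mean \<alpha> k0 w) (mean \<alpha> k0 dual) p (enn2real (Ap_const p w))"
proof (rule ap_grid.intro[OF grid])
  let ?v = "volume (\<lambda>_. k0)"
  let ?W = "mean \<alpha> k0 w" and ?S = "mean \<alpha> k0 dual"
  note w = mean_integral[OF integral_w(2), of \<alpha> k0] and s = mean_integral[OF integral_dual(2), of \<alpha> k0]
  have v: "0 < ?v" by (rule volume_pos)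
  have pos: "0 < ?W m" "0 < ?S m" for m
    using mean_pos[OF integral_w(2,1)] mean_pos[OF integral_dual(2,1)] by auto
  have lower: "1 \<le> ?W m * ?S m powr (p - 1)" for m
  proof -
    have G: "(\<integral>\<^sup>+ x\<in>base_cell \<alpha> k0 m. ennreal (1 powr p * dual x powr (1 - p)) \<partial>lebesgue) = ennreal (?v * ?W m)"
    proof -
      have "(\<integral>\<^sup>+ x\<in>base_cell \<alpha> k0 m. ennreal (1 powr p * dual x powr (1 - p)) \<partial>lebesgue) = (\<integral>\<^sup>+ x\<in>base_cell \<alpha> k0 m. ennreal (w x) \<partial>lebesgue)"
        by (rule nn_integral_cong_AE) (use AE_weights(3) in eventually_elim, simp)
      then show ?thesis by (simp add: w)
    qed
    have "(\<integral>\<^sup>+ x\<in>base_cell \<alpha> k0 m. ennreal 1 \<partial>lebesgue) \<le> ennreal ((?v * ?W m) powr (1 / p) * (?v * ?S m) powr (1 - 1 / p))"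
      by (rule set_nn_integral_holder[OF p _ measurable_weights(2) sets_cells _ AE_weights(2) s _ G])
         (use v pos in \<open>auto simp: less_imp_le\<close>)
    then have "ennreal ?v \<le> ennreal ((?v * ?W m) powr (1 / p) * (?v * ?S m) powr (1 - 1 / p))"
      by (simp add: emeasure_cells')
    then have "?v \<le> (?v * ?W m) powr (1 / p) * (?v * ?S m) powr (1 - 1 / p)" by (simp add: ennreal_le_iff)
    then have "?v powr p \<le> ((?v * ?W m) powr (1 / p) * (?v * ?S m) powr (1 - 1 / p)) powr p"
      using v p by (intro powr_mono2) auto
    also have "\<dots> = (?v * ?W m) * (?v * ?S m) powr (p - 1)"
    proof -
      have "(1 - 1 / p) * p = p - 1" "1 / p * p = 1" using p by (auto simp: field_simps)
      then show ?thesis using v pos[of m] by (simp add: powr_mult powr_powr del: mult_less_cancel_right)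
    qed
    also have "\<dots> = ?v powr p * (?W m * ?S m powr (p - 1))"
      using v pos[of m] by (simp add: powr_mult powr_diff)
    finally show ?thesis using v by simp
  qed
  have upper: "sum ?W (grid_box \<alpha> k0 k m) * sum ?S (grid_box \<alpha> k0 k m) powr (p - 1)
      \<le> enn2real (Ap_const p w) * real (card (grid_box \<alpha> k0 k m)) powr p" for k m
  proof -
    let ?B = "grid_box \<alpha> k0 k m"
    let ?n = "real (card ?B)"
    have n: "0 < ?n" using dyadic_grid.card_box_pos[OF grid] by simp
    have nn: "0 \<le> sum ?W ?B" "0 \<le> sum ?S ?B" by (auto intro: sum_nonneg mean_nonneg)
    have "average {x. cells \<alpha> (\<lambda>_. k0) x \<in> ?B} (\<lambda>x. ennreal (w x)) * epowr (average {x. cells \<alpha> (\<lambda>_. k0) x \<in> ?B} (\<lambda>x. ennreal (dual x))) (p - 1)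
      \<le> ennreal (enn2real (Ap_const p w))"
      unfolding grid_box_cells by (rule Ap_cells)
    then have "ennreal (sum ?W ?B / ?n) * epowr (ennreal (sum ?S ?B / ?n)) (p - 1) \<le> ennreal (enn2real (Ap_const p w))"
      unfolding average_grid_box[OF measurable_weights(1) integral_w(2)] average_grid_box[OF measurable_weights(2) integral_dual(2)] .
    then have "ennreal (sum ?W ?B / ?n * (sum ?S ?B / ?n) powr (p - 1)) \<le> ennreal (enn2real (Ap_const p w))"
      using n nn by (simp only: epowr_ennreal divide_nonneg_nonneg ennreal_mult[symmetric] powr_ge_zero of_nat_0_le_iff)
    then have "sum ?W ?B / ?n * (sum ?S ?B / ?n) powr (p - 1) \<le> enn2real (Ap_const p w)"
      by (simp add: ennreal_le_iff)
    then have "(sum ?W ?B / ?n * (sum ?S ?B / ?n) powr (p - 1)) * ?n powr p \<le> enn2real (Ap_const p w) * ?n powr p"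
      by (intro mult_right_mono) auto
    moreover have "(sum ?W ?B / ?n * (sum ?S ?B / ?n) powr (p - 1)) * ?n powr p = sum ?W ?B * sum ?S ?B powr (p - 1)"
      using n nn by (simp add: powr_divide powr_diff)
    ultimately show ?thesis by simp
  qed
  show "ap_grid_axioms (\<lambda>i. descendants (\<alpha> i) k0) ?W ?S p (enn2real (Ap_const p w))"
    by (rule ap_grid_axioms.intro) (use p pos lower upper in auto)
qed

text \<open>Hoelder on a base cell: averaging |f| does not increase the norm if the discrete weight
  is the power 1 - p of the mean of the dual weight. This is why the grid bounds carry
  \<open>\<sigma> powr (1 - p)\<close> on the right.\<close>

lemma mean_norm_bound:
  fixes f :: "real ^ 'n \<Rightarrow> complex"
  assumes f: "f \<in> borel_measurable lebesgue" "(\<integral>\<^sup>+ x. ennreal (norm (f x) powr p * w x) \<partial>lebesgue) < \<infinity>"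
  shows "(\<integral>\<^sup>+ x\<in>base_cell \<alpha> k0 m. ennreal (norm (f x)) \<partial>lebesgue) < \<infinity>"
    and "volume (\<lambda>_. k0) * (mean \<alpha> k0 (\<lambda>x. norm (f x)) m powr p * mean \<alpha> k0 dual m powr (1 - p))
      \<le> enn2real (\<integral>\<^sup>+ x\<in>base_cell \<alpha> k0 m. ennreal (norm (f x) powr p * w x) \<partial>lebesgue)"
proof -
  let ?v = "volume (\<lambda>_. k0)" and ?Q = "base_cell \<alpha> k0 m" and ?S = "mean \<alpha> k0 dual m" and ?F = "mean \<alpha> k0 (\<lambda>x. norm (f x)) m"
  have v: "0 < ?v" by (rule volume_pos)
  have S: "0 < ?S" by (rule mean_pos[OF integral_dual(2,1)])
  define G where "G = enn2real (\<integral>\<^sup>+ x\<in>?Q. ennreal (norm (f x) powr p * w x) \<partial>lebesgue)"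
  have "(\<integral>\<^sup>+ x\<in>?Q. ennreal (norm (f x) powr p * w x) \<partial>lebesgue) \<le> (\<integral>\<^sup>+ x. ennreal (norm (f x) powr p * w x) \<partial>lebesgue)"
    by (intro nn_integral_mono) (auto simp: indicator_def)
  then have "(\<integral>\<^sup>+ x\<in>?Q. ennreal (norm (f x) powr p * w x) \<partial>lebesgue) < \<infinity>" using f(2) by (rule le_less_trans)
  then have "(\<integral>\<^sup>+ x\<in>?Q. ennreal (norm (f x) powr p * w x) \<partial>lebesgue) = ennreal G" by (simp add: G_def)
  moreover have "(\<integral>\<^sup>+ x\<in>?Q. ennreal (norm (f x) powr p * dual x powr (1 - p)) \<partial>lebesgue)
      = (\<integral>\<^sup>+ x\<in>?Q. ennreal (norm (f x) powr p * w x) \<partial>lebesgue)"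
    by (rule nn_integral_cong_AE) (use AE_weights(3) in eventually_elim, simp)
  ultimately have G: "(\<integral>\<^sup>+ x\<in>?Q. ennreal (norm (f x) powr p * dual x powr (1 - p)) \<partial>lebesgue) = ennreal G" by simp
  have G0: "0 \<le> G" by (simp add: G_def)
  have H: "(\<integral>\<^sup>+ x\<in>?Q. ennreal (norm (f x)) \<partial>lebesgue) \<le> ennreal (G powr (1 / p) * (?v * ?S) powr (1 - 1 / p))"
    by (rule set_nn_integral_holder[OF p _ measurable_weights(2) sets_cells _ AE_weights(2) mean_integral[OF integral_dual(2)] _ G G0])
       (use v S f in auto)
  then show fin: "(\<integral>\<^sup>+ x\<in>?Q. ennreal (norm (f x)) \<partial>lebesgue) < \<infinity>" by (auto intro: le_less_trans)
  have "ennreal (?v * ?F) \<le> ennreal (G powr (1 / p) * (?v * ?S) powr (1 - 1 / p))"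
    using H unfolding mean_integral[OF fin] .
  then have "?v * ?F \<le> G powr (1 / p) * (?v * ?S) powr (1 - 1 / p)" by (simp add: ennreal_le_iff)
  then have "(?v * ?F) powr p \<le> (G powr (1 / p) * (?v * ?S) powr (1 - 1 / p)) powr p"
    using v p mean_nonneg by (intro powr_mono2) auto
  also have "\<dots> = G * (?v * ?S) powr (p - 1)"
  proof -
    have "(1 - 1 / p) * p = p - 1" "1 / p * p = 1" using p by (auto simp: field_simps)
    then show ?thesis using v S G0 by (simp add: powr_mult powr_powr)
  qed
  finally have "(?v * ?F) powr p * ((?v * ?S) powr (1 - p)) \<le> G * (?v * ?S) powr (p - 1) * ((?v * ?S) powr (1 - p))"
    by (intro mult_right_mono) auto
  also have "\<dots> = G" using v S by (simp add: powr_add[symmetric] mult.assoc)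
  also have "(?v * ?F) powr p * ((?v * ?S) powr (1 - p)) = ?v * (?F powr p * ?S powr (1 - p))"
    using v S mean_nonneg[of \<alpha> k0 "\<lambda>x. norm (f x)" m] by (simp add: powr_mult powr_diff)
  finally show "?v * (?F powr p * ?S powr (1 - p)) \<le> enn2real (\<integral>\<^sup>+ x\<in>?Q. ennreal (norm (f x) powr p * w x) \<partial>lebesgue)"
    unfolding G_def .
qed

section \<open>Transfer of the grid bound to superlevel sets\<close>

definition grid_const :: real where
  "grid_const = (1 + weak_const p) * strong_const p ^ ((CARD('n) - 1) div 2)
     * enn2real (Ap_const p w) powr (1 + (real CARD('n) - 1) * p / (p - 1) - real (CARD('n) div 2) / (2 * (p - 1)))"

lemma grid_const_nonneg: "0 \<le> grid_const"
  using strong_const_nonneg[OF p] weak_const_nonneg[of p] by (auto simp: grid_const_def intro!: mult_nonneg_nonneg)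

text \<open>With a base scale no coarser than any occurring one, every cell of the family is an
  exact union of base cells. Averages of |f| over it are then averages of cell means, and
  discretizing loses nothing.\<close>

lemma finite_union_bound:
  fixes f :: "real ^ 'n \<Rightarrow> complex" and P :: "(('n \<Rightarrow> int) \<times> ('n \<Rightarrow> int)) set"
  assumes f: "f \<in> borel_measurable lebesgue" "(\<integral>\<^sup>+ x. ennreal (norm (f x) powr p * w x) \<partial>lebesgue) < \<infinity>"
    and P: "finite P" and t: "0 < t"
    and avg: "\<And>k m. (k, m) \<in> P \<Longrightarrow> ennreal t < average {x. cells \<alpha> k x = m} (\<lambda>x. ennreal (norm (f x)))"
  shows "weight_measure w (\<Union>(k, m)\<in>P. {x. cells \<alpha> k x = m})
    \<le> ennreal (grid_const / t powr p * enn2real (\<integral>\<^sup>+ x. ennreal (norm (f x) powr p * w x) \<partial>lebesgue))"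
proof -
  define L where "L = enn2real (\<integral>\<^sup>+ x. ennreal (norm (f x) powr p * w x) \<partial>lebesgue)"
  \<comment> \<open>The inserted 0 keeps the set of scales nonempty when \<open>P\<close> is
    empty.\<close>
  define Lev where "Lev = insert 0 ((\<lambda>(P, i). fst P i) ` (P \<times> (UNIV :: 'n set)))"
  have finLev: "finite Lev" "Lev \<noteq> {}" using P by (auto simp: Lev_def)
  define k0 where "k0 = Min Lev"
  define N where "N = nat (Max Lev - k0)"
  have lev: "k0 \<le> k i" "k i \<le> Max Lev" if "(k, m) \<in> P" for k m i
  proof -
    have "k i \<in> Lev" using that by (force simp: Lev_def)
    then show "k0 \<le> k i" "k i \<le> Max Lev" using finLev by (auto simp: k0_def)
  qed
  define rel where "rel k i = nat (k i - k0)" for k :: "'n \<Rightarrow> int" and i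
  have rel: "(\<lambda>i. k0 + int (rel k i)) = k" "rel k i \<le> N" if "(k, m) \<in> P" for k m i
  proof -
    show "(\<lambda>i. k0 + int (rel k i)) = k" using lev(1)[OF that] by (auto simp: rel_def)
    show "rel k i \<le> N" unfolding rel_def N_def using lev(2)[OF that, of i] by (intro nat_mono) linarith
  qed
  \<comment> \<open>Every cell contains base cells; \<open>g\<close> will pick one of them as its
    representative.\<close>
  have "\<exists>n. ancestor b k j n = m" for b k j m
  proof -
    have "card {n. ancestor b k j n = m} \<noteq> 0" using card_ancestor_fibre[of b k j m] by simp
    then have "{n. ancestor b k j n = m} \<noteq> {}" by (metis card.empty)
    then show ?thesis by blast
  qed
  then have "\<exists>g. \<forall>i. ancestor (\<alpha> i) k0 (rel k i) (g i) = m i" for k m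
    by (intro choice allI)
  then obtain g where g: "\<And>k m i. ancestor (\<alpha> i) k0 (rel k i) (g k m i) = m i" by metis
  interpret G: ap_grid "\<lambda>i. descendants (\<alpha> i) k0" "mean \<alpha> k0 w" "mean \<alpha> k0 dual" p "enn2real (Ap_const p w)"
    by (rule ap_grid)
  have cells_box: "{x. cells \<alpha> k x = m} = {x. cells \<alpha> (\<lambda>_. k0) x \<in> G.box (rel k) (g k m)}" if "(k, m) \<in> P" for k m
    unfolding grid_box_cells rel(1)[OF that] g by simp
  \<comment> \<open>The window is generated by the intervals of the top level \<open>N\<close>
    around the representatives.\<close>
  define Xs where "Xs i = (\<Union>(k, m)\<in>P. descendants (\<alpha> i) k0 N (g k m i))" for i
  have Xs: "finite (Xs i)" "descendants (\<alpha> i) k0 N u \<subseteq> Xs i" if "u \<in> Xs i" for i u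
    using P dyadic.finite_D[OF dyadic_descendants] that dyadic.D_eq[OF dyadic_descendants] by (fastforce simp: Xs_def)+
  have finXs: "finite (Xs i)" for i
    unfolding Xs_def using P dyadic.finite_D[OF dyadic_descendants] by auto
  define X where "X = {x. \<forall>i. x i \<in> Xs i}"
  have finX: "finite X"
  proof -
    have "X = Pi\<^sub>E UNIV Xs" by (auto simp: X_def PiE_def Pi_def extensional_def)
    then show ?thesis using finXs by (simp add: finite_PiE)
  qed
  let ?F = "mean \<alpha> k0 (\<lambda>x. norm (f x))"
  let ?v = "volume (\<lambda>_. k0)"
  have v: "0 < ?v" by (rule volume_pos)
  have fm: "(\<lambda>x. norm (f x)) \<in> borel_measurable lebesgue" using f(1) by simp
  define B where "B = {x \<in> X. t < G.gmax UNIV N ?F x}"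
  have finB: "finite B" using finX by (simp add: B_def)
  have sub: "(\<Union>(k, m)\<in>P. {x. cells \<alpha> k x = m}) \<subseteq> {x. cells \<alpha> (\<lambda>_. k0) x \<in> B}"
  proof
    fix x assume "x \<in> (\<Union>(k, m)\<in>P. {x. cells \<alpha> k x = m})"
    then obtain k m where km: "(k, m) \<in> P" "cells \<alpha> k x = m" by auto
    let ?z = "cells \<alpha> (\<lambda>_. k0) x"
    have z: "?z \<in> G.box (rel k) (g k m)" using cells_box[OF km(1)] km(2) by blast
    then have zi: "?z i \<in> descendants (\<alpha> i) k0 (rel k i) (g k m i)" for i by (simp add: G.box_def)
    have box_eq: "G.box (rel k) ?z = G.box (rel k) (g k m)"
      unfolding G.box_def using dyadic.D_eq[OF dyadic_descendants zi] by simp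
    have "?z \<in> X"
      using zi dyadic.D_mono[OF dyadic_descendants rel(2)[OF km(1)]] km(1) by (fastforce simp: X_def Xs_def)
    moreover have "t < G.gmax UNIV N ?F ?z"
    proof -
      have "ennreal t < ennreal (sum ?F (G.box (rel k) ?z) / real (card (G.box (rel k) ?z)))"
        using avg[OF km(1)] unfolding cells_box[OF km(1)] average_grid_box[OF fm mean_norm_bound(1)[OF f]] box_eq .
      then have "t < sum ?F (G.box (rel k) ?z) / real (card (G.box (rel k) ?z))"
        using t by (simp add: ennreal_less_iff)
      also have "\<dots> \<le> G.gmax UNIV N ?F ?z"
        by (rule G.gmax_ge) (use rel(2)[OF km(1)] in \<open>auto simp: G.levels_def\<close>)
      finally show ?thesis .
    qed
    ultimately show "x \<in> {x. cells \<alpha> (\<lambda>_. k0) x \<in> B}" by (simp add: B_def)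
  qed
  have Lfin: "(\<integral>\<^sup>+ x. ennreal (norm (f x) powr p * w x) \<partial>lebesgue) = ennreal L" using f(2) by (simp add: L_def)
  have term_fin: "(\<integral>\<^sup>+ x\<in>A. ennreal (norm (f x) powr p * w x) \<partial>lebesgue) \<le> ennreal L" for A
    unfolding Lfin[symmetric] by (intro nn_integral_mono) (auto simp: indicator_def)
  have "?v * (\<Sum>x\<in>X. ?F x powr p * mean \<alpha> k0 dual x powr (1 - p)) \<le> L"
  proof -
    have "?v * (\<Sum>x\<in>X. ?F x powr p * mean \<alpha> k0 dual x powr (1 - p))
      \<le> (\<Sum>m\<in>X. enn2real (\<integral>\<^sup>+ x\<in>base_cell \<alpha> k0 m. ennreal (norm (f x) powr p * w x) \<partial>lebesgue))"
      unfolding sum_distrib_left by (intro sum_mono mean_norm_bound(2)[OF f])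
    also have "\<dots> = enn2real (\<Sum>m\<in>X. \<integral>\<^sup>+ x\<in>base_cell \<alpha> k0 m. ennreal (norm (f x) powr p * w x) \<partial>lebesgue)"
      by (subst enn2real_sum) (simp_all add: comp_def le_less_trans[OF term_fin ennreal_less_top])
    also have "(\<Sum>m\<in>X. \<integral>\<^sup>+ x\<in>base_cell \<alpha> k0 m. ennreal (norm (f x) powr p * w x) \<partial>lebesgue)
        = (\<integral>\<^sup>+ x\<in>{x. cells \<alpha> (\<lambda>_. k0) x \<in> X}. ennreal (norm (f x) powr p * w x) \<partial>lebesgue)"
      using finX f(1) measurable_weights(1) by (intro set_nn_integral_fibres[symmetric]) auto
    also have "enn2real \<dots> \<le> L" using term_fin by (intro enn2real_leI) (auto simp: L_def)
    finally show ?thesis .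
  qed
  moreover have "t powr p * sum (mean \<alpha> k0 w) B \<le> grid_const * (\<Sum>x\<in>X. ?F x powr p * mean \<alpha> k0 dual x powr (1 - p))"
    unfolding B_def X_def grid_const_def
    by (rule G.weak_grid) (use Xs finXs t mean_nonneg in auto)
  then have "?v * (t powr p * sum (mean \<alpha> k0 w) B) \<le> ?v * (grid_const * (\<Sum>x\<in>X. ?F x powr p * mean \<alpha> k0 dual x powr (1 - p)))"
    using v by (intro mult_left_mono) auto
  moreover have "grid_const * (?v * (\<Sum>x\<in>X. ?F x powr p * mean \<alpha> k0 dual x powr (1 - p))) \<le> grid_const * L" if "?v * (\<Sum>x\<in>X. ?F x powr p * mean \<alpha> k0 dual x powr (1 - p)) \<le> L"
    by (intro mult_left_mono that grid_const_nonneg)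
  ultimately have "t powr p * (?v * sum (mean \<alpha> k0 w) B) \<le> grid_const * L" by (simp add: mult_ac)
  then have "?v * sum (mean \<alpha> k0 w) B \<le> grid_const / t powr p * L" using t by (simp add: field_simps)
  then have "ennreal (?v * sum (mean \<alpha> k0 w) B) \<le> ennreal (grid_const / t powr p * L)" by (rule ennreal_leI)
  moreover have "weight_measure w (\<Union>(k, m)\<in>P. {x. cells \<alpha> k x = m}) \<le> weight_measure w {x. cells \<alpha> (\<lambda>_. k0) x \<in> B}"
    unfolding weight_measure_def using sub by (intro nn_integral_mono) (auto simp: indicator_def)
  moreover have "weight_measure w {x. cells \<alpha> (\<lambda>_. k0) x \<in> B} = ennreal (?v * sum (mean \<alpha> k0 w) B)"
    unfolding weight_measure_def by (rule integral_finite_union[OF finB measurable_weights(1) integral_w(2)])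
  ultimately show ?thesis unfolding L_def by simp
qed

text \<open>The superlevel set is covered by the cells with large average in the 2^d systems. Each
  system has countably many cells, and the bounds for the systems are added.\<close>

lemma superlevel_bound:
  fixes f :: "real ^ 'n \<Rightarrow> complex"
  assumes f: "f \<in> borel_measurable lebesgue" "(\<integral>\<^sup>+ x. ennreal (norm (f x) powr p * w x) \<partial>lebesgue) < \<infinity>" and t: "0 < t"
  shows "weight_measure w {x. ennreal t < strong_maximal f x}
    \<le> ennreal (real CARD('n \<Rightarrow> bool) * (grid_const / (t / 6 ^ CARD('n)) powr p * enn2real (\<integral>\<^sup>+ x. ennreal (norm (f x) powr p * w x) \<partial>lebesgue)))"
proof -
  define \<tau> where "\<tau> = t / 6 ^ CARD('n)"
  have \<tau>: "0 < \<tau>" using t by (simp add: \<tau>_def)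
  define C where "C = grid_const / \<tau> powr p * enn2real (\<integral>\<^sup>+ x. ennreal (norm (f x) powr p * w x) \<partial>lebesgue)"
  have C: "0 \<le> C" using grid_const_nonneg by (simp add: C_def)
  define I where "I \<alpha> = {P. ennreal \<tau> < average {x :: real ^ 'n. cells \<alpha> (fst P) x = snd P} (\<lambda>x. ennreal (norm (f x)))}" for \<alpha>
  define Q where "Q \<alpha> P = {x :: real ^ 'n. cells \<alpha> (fst P) x = snd P}" for \<alpha> and P :: "('n \<Rightarrow> int) \<times> ('n \<Rightarrow> int)"
  define \<mu> where "\<mu> = density lebesgue (\<lambda>x. ennreal (w x))"
  have \<mu>: "weight_measure w A = emeasure \<mu> A" if "A \<in> sets lebesgue" for A
    unfolding weight_measure_def \<mu>_def using that measurable_weights(1) by (simp add: emeasure_density)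
  have Qs: "Q \<alpha> ` J \<subseteq> sets \<mu>" for \<alpha> J by (auto simp: Q_def \<mu>_def)
  have bound: "emeasure \<mu> (\<Union>(Q \<alpha> ` I \<alpha>)) \<le> ennreal C" for \<alpha>
  proof (rule emeasure_countable_Union_le)
    show "countable (Q \<alpha> ` I \<alpha>)" by (intro countable_image) (rule countableI_type)
    show "Q \<alpha> ` I \<alpha> \<subseteq> sets \<mu>" by (rule Qs)
    fix G assume "finite G" "G \<subseteq> Q \<alpha> ` I \<alpha>"
    then obtain P where P: "P \<subseteq> I \<alpha>" "finite P" "G = Q \<alpha> ` P" by (meson finite_subset_image)
    have un: "(\<Union>(k, m)\<in>P. {x. cells \<alpha> k x = m}) = \<Union>G" unfolding P(3) by (auto simp: Q_def)
    have "weight_measure w (\<Union>(k, m)\<in>P. {x. cells \<alpha> k x = m}) \<le> ennreal C"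
      unfolding C_def using P(1) by (intro finite_union_bound f P(2) \<tau>) (auto simp: I_def)
    moreover have "\<Union>G \<in> sets lebesgue" using P Qs[of \<alpha> P] by (auto simp: \<mu>_def intro!: sets.finite_Union)
    ultimately show "emeasure \<mu> (\<Union>G) \<le> ennreal C" by (simp add: un \<mu>)
  qed
  let ?E = "\<Union>\<alpha>\<in>UNIV. \<Union>(Q \<alpha> ` I \<alpha>)"
  have meas: "\<Union>(Q \<alpha> ` I \<alpha>) \<in> sets lebesgue" for \<alpha>
    using Qs[of \<alpha> "I \<alpha>"] by (intro sets.countable_Union countable_image countableI_type) (auto simp: \<mu>_def)
  have "{x. ennreal t < strong_maximal f x} \<subseteq> ?E"
  proof
    fix x assume "x \<in> {x. ennreal t < strong_maximal f x}"
    then have "ennreal t < strong_maximal f x" by simp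
    then obtain \<alpha> k where "ennreal \<tau> < average {y. cells \<alpha> k y = cells \<alpha> k x} (\<lambda>y. ennreal (norm (f y)))"
      unfolding \<tau>_def using t by (rule strong_maximal_gt[OF _ less_imp_le])
    then have "(k, cells \<alpha> k x) \<in> I \<alpha>" "x \<in> Q \<alpha> (k, cells \<alpha> k x)" by (auto simp: I_def Q_def)
    then show "x \<in> ?E" by blast
  qed
  then have "weight_measure w {x. ennreal t < strong_maximal f x} \<le> weight_measure w ?E"
    unfolding weight_measure_def by (intro nn_integral_mono) (auto simp: indicator_def)
  also have "\<dots> = emeasure \<mu> ?E" by (intro \<mu> sets.finite_UN meas) simp
  also have "\<dots> \<le> (\<Sum>\<alpha>\<in>UNIV. emeasure \<mu> (\<Union>(Q \<alpha> ` I \<alpha>)))"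
    using meas by (intro emeasure_subadditive_finite) (auto simp: \<mu>_def)
  also have "\<dots> \<le> (\<Sum>\<alpha>\<in>(UNIV :: ('n \<Rightarrow> bool) set). ennreal C)" by (intro sum_mono bound)
  also have "\<dots> = ennreal (real CARD('n \<Rightarrow> bool) * C)"
    using C by (simp add: ennreal_of_nat_eq_real_of_nat ennreal_mult[symmetric])
  finally show ?thesis unfolding C_def \<tau>_def .
qed

end

lemma beta_exponent_eq:
  assumes "1 < p"
  shows "(1 + (real d - 1) * p / (p - 1) - real (d div 2) / (2 * (p - 1))) * (1 / p) = beta_exponent p d"
proof -
  have "real_of_int \<lfloor>real d / 2\<rfloor> = real (d div 2)"
    using floor_divide_of_nat_eq[of d 2, where ?'a = real] by simp
  then show ?thesis using assms by (simp add: beta_exponent_def divide_simps)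
qed

theorem theorem1p2:
  fixes p :: real
  assumes "1 < p" and "2 \<le> CARD('n::finite)"
  shows "\<exists>C::real. 0 < C \<and>
    (\<forall>w \<in> (Ap_weights p :: (real ^ 'n \<Rightarrow> real) set). \<forall>f \<in> Lp_space p w.
       weak_Lp_norm p w (strong_maximal f)
         \<le> ennreal C * epowr (Ap_const p w) (beta_exponent p CARD('n)) * Lp_norm p w f)"
proof -
  let ?d = "CARD('n)"
  \<comment> \<open>The summand 1 keeps \<open>A\<close>, and with it \<open>C\<close>, positive.
    The rest is the number of systems times the grid constant without its power of
    \<open>K\<close>.\<close>
  define A where "A = 1 + real CARD('n \<Rightarrow> bool) * ((1 + weak_const p) * strong_const p ^ ((?d - 1) div 2))"
  have A0: "0 \<le> (1 + weak_const p) * strong_const p ^ ((?d - 1) div 2)"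
    using strong_const_nonneg[OF assms(1)] weak_const_nonneg[of p] by auto
  then have A: "1 \<le> A" "real CARD('n \<Rightarrow> bool) * ((1 + weak_const p) * strong_const p ^ ((?d - 1) div 2)) \<le> A"
    by (auto simp: A_def)
  define C where "C = A powr (1 / p) * 6 ^ ?d"
  show ?thesis
  proof (intro exI[of _ C] conjI ballI)
    show "0 < C" using A(1) by (simp add: C_def)
    fix w :: "real ^ 'n \<Rightarrow> real" and f :: "real ^ 'n \<Rightarrow> complex"
    assume w: "w \<in> Ap_weights p" and f: "f \<in> Lp_space p w"
    interpret S: strong_weight p w by unfold_locales (rule assms(1), rule w)
    define K where "K = enn2real (Ap_const p w)"
    define e where "e = 1 + (real ?d - 1) * p / (p - 1) - real (?d div 2) / (2 * (p - 1))"
    define J where "J = (\<integral>\<^sup>+ x. ennreal (norm (f x) powr p * w x) \<partial>lebesgue)"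
    define L where "L = enn2real J"
    have L0: "0 \<le> L" by (simp add: L_def)
    have fm: "f \<in> borel_measurable lebesgue" and "epowr J (1 / p) < \<infinity>"
      using f by (auto simp: Lp_space_def Lp_norm_def J_def)
    then have J: "J < \<infinity>" by (auto simp: epowr_def less_top split: if_splits)
    have norm: "Lp_norm p w f = ennreal (L powr (1 / p))"
      using J by (simp add: Lp_norm_def J_def[symmetric] epowr_def L_def less_top)
    have "Ap_const p w < \<infinity>" using w by (simp add: Ap_weights_def)
    then have ap: "epowr (Ap_const p w) (beta_exponent p ?d) = ennreal (K powr beta_exponent p ?d)"
      by (simp add: epowr_def K_def less_top)
    have "ennreal t * epowr (weight_measure w {x. ennreal t < strong_maximal f x}) (1 / p)
        \<le> ennreal (C * K powr beta_exponent p ?d * L powr (1 / p))" if t: "0 < t" for t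
    proof -
      have "real CARD('n \<Rightarrow> bool) * (S.grid_const / (t / 6 ^ ?d) powr p * L)
        = real CARD('n \<Rightarrow> bool) * ((1 + weak_const p) * strong_const p ^ ((?d - 1) div 2)) * (K powr e / (t / 6 ^ ?d) powr p * L)"
        by (simp add: S.grid_const_def K_def e_def)
      also have "\<dots> \<le> A * (K powr e / (t / 6 ^ ?d) powr p * L)"
        using L0 by (intro mult_right_mono A(2)) auto
      finally have "weight_measure w {x. ennreal t < strong_maximal f x} \<le> ennreal (A * (K powr e / (t / 6 ^ ?d) powr p * L))"
        using S.superlevel_bound[OF fm _ t] J unfolding J_def[symmetric] L_def[symmetric]
        by (meson ennreal_leI order_trans)
      then have "epowr (weight_measure w {x. ennreal t < strong_maximal f x}) (1 / p)
          \<le> ennreal ((A * (K powr e / (t / 6 ^ ?d) powr p * L)) powr (1 / p))"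
        using A(1) L0 assms(1) by (intro epowr_mono) auto
      then have "ennreal t * epowr (weight_measure w {x. ennreal t < strong_maximal f x}) (1 / p)
          \<le> ennreal t * ennreal ((A * (K powr e / (t / 6 ^ ?d) powr p * L)) powr (1 / p))"
        by (intro mult_left_mono) auto
      also have "\<dots> = ennreal (t * (A * (K powr e / (t / 6 ^ ?d) powr p * L)) powr (1 / p))"
        using t by (simp add: ennreal_mult)
      \<comment> \<open>The factor 6^d of \<open>C\<close> comes from testing averages at t / 6^d;
        the p-th root makes t cancel.\<close>
      also have "t * (A * (K powr e / (t / 6 ^ ?d) powr p * L)) powr (1 / p) = C * K powr beta_exponent p ?d * L powr (1 / p)"
      proof -
        have "(A * (K powr e / (t / 6 ^ ?d) powr p * L)) powr (1 / p)
          = A powr (1 / p) * (K powr (e * (1 / p)) / (t / 6 ^ ?d) * L powr (1 / p))"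
          using A(1) L0 t assms(1) by (simp add: powr_mult powr_divide powr_powr)
        moreover have "e * (1 / p) = beta_exponent p ?d"
          unfolding e_def by (rule beta_exponent_eq[OF assms(1)])
        ultimately show ?thesis using t by (simp add: C_def)
      qed
      finally show ?thesis .
    qed
    then have "weak_Lp_norm p w (strong_maximal f) \<le> ennreal (C * K powr beta_exponent p ?d * L powr (1 / p))"
      unfolding weak_Lp_norm_def by (intro SUP_least) auto
    also have "\<dots> = ennreal C * epowr (Ap_const p w) (beta_exponent p ?d) * Lp_norm p w f"
      using A(1) by (simp add: ap norm ennreal_mult C_def)
    finally show "weak_Lp_norm p w (strong_maximal f)
        \<le> ennreal C * epowr (Ap_const p w) (beta_exponent p ?d) * Lp_norm p w f" .
  qed
qed

end
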